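(* Let $\omega=(\omega_x)_{x\in\mathbb Z}$ be an IID sequence under $\mathbb P$ such that $\mathbb P(\omega_1\in[\alpha,1-\alpha])=1$ for some $\alpha\in(0,1/2)$, $\mathbb E[\log\rho_1]<0$ and $\lambda<\infty$. Then there exists a constant $c=c(\alpha,\mathbb P)>0$ such that, with high probability, $$t^{N,k,\omega}_{\mathrm{mix}}\ \ge\ c\,\max\left\{N,\ N^{\frac1\lambda}(\log N)^{-\frac2\lambda},\ k\,N^{\frac1{2\lambda}}(\log N)^{-2\left(1+\frac1\lambda\right)}\right\},$$ that is, denoting by $B_{N,k}$ the event that this inequality holds, $\lim_{N\to\infty}\inf_{1\le k\le N/2}\mathbb P[B_{N,k}]=1$ (infimum over integers $k$).
   Context: Environment: $\rho_x=(1-\omega_x)/\omega_x$; $\lambda=\inf\{s>0:\mathbb E[\rho_1^s]\ge1\}\in(0,\infty]$. The notation $c(\alpha,\mathbb P)$ means that the constant may depend only on $\alpha$ and the law of the environment. Process: for fixed $\omega$ with values in $(0,1)$, $N\ge2$, $1\le k\le N-1$, let $\Omega_{N,k}=\{\xi\in\{0,1\}^N:\sum_{x=1}^N\xi(x)=k\}$, and let $\xi^{x,x+1}$ be obtained from $\xi$ by exchanging the values at $x$ and $x+1$. The simple exclusion process in environment $\omega$ is the continuous-time Markov chain on $\Omega_{N,k}$ which, for $1\le x\le N-1$, jumps from $\xi$ to $\xi^{x,x+1}$ at rate $\omega_x$ if $\xi(x)=1,\xi(x+1)=0$ and at rate $1-\omega_{x+1}$ if $\xi(x)=0,\xi(x+1)=1$;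 there are no other jumps. Let $P_t(\xi,\cdot)$ be its law at time $t$ started from $\xi$. Its unique invariant probability measure is $\pi^\omega_{N,k}(\xi)\propto e^{-V^\omega(\xi)}$, where $V^\omega(1)=0$, $V^\omega(x)=\sum_{y=2}^x\log\frac{1-\omega_y}{\omega_{y-1}}$ for $x\ge2$, and $V^\omega(\xi)=\sum_{x=1}^N V^\omega(x)\xi(x)$. Set $d^\omega_{N,k}(t)=\max_{\xi}\|P_t(\xi,\cdot)-\pi^\omega_{N,k}\|_{\mathrm{TV}}$ (with $\|\nu_1-\nu_2\|_{\mathrm{TV}}=\sup_A|\nu_1(A)-\nu_2(A)|$) and $t^{N,k,\omega}_{\mathrm{mix}}=\inf\{t\ge0:d^\omega_{N,k}(t)\le1/4\}$. *)

theory Defs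
  imports "HOL-Probability.Probability"
begin

section \<open>Random environment\<close>

definition rho :: "real \<Rightarrow> real" where
  "rho w = (1 - w) / w"

text \<open>\<open>lam \<mu>\<close> is the parameter \<open>\<lambda>\<close> of an IID environment whose one-site marginal law is \<open>\<mu>\<close>; it is
  \<open>\<infinity>\<close> if the set is empty.\<close>

definition lam :: "real measure \<Rightarrow> ereal" where
  "lam \<mu> = (INF s\<in>{s::real. s > 0 \<and> (\<integral>w. rho w powr s \<partial>\<mu>) \<ge> 1}. ereal s)"

definition iid_environment :: "'a measure \<Rightarrow> (int \<Rightarrow> 'a \<Rightarrow> real) \<Rightarrow> real measure \<Rightarrow> bool" where
  "iid_environment M \<omega> \<mu> \<longleftrightarrow>
     prob_space M \<and> prob_space.indep_vars M (\<lambda>_. borel) \<omega> UNIV \<and> (\<forall>x. distr M borel (\<omega> x) = \<mu>)"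

section \<open>Simple exclusion process in a fixed environment\<close>

text \<open>Elements of \<open>{0,1}\<^sup>N\<close> are functions on \<open>nat\<close> that are \<open>undefined\<close> outside \<open>{1..N}\<close>, so that
  equality of configurations is equality of functions.\<close>

type_synonym config = "nat \<Rightarrow> nat"

definition Omega :: "nat \<Rightarrow> nat \<Rightarrow> config set" where
  "Omega N k = {\<xi> \<in> {1..N} \<rightarrow>\<^sub>E {0, 1}. (\<Sum>x=1..N. \<xi> x) = k}"

definition exchange :: "config \<Rightarrow> nat \<Rightarrow> config" where
  "exchange \<xi> x = \<xi>(x := \<xi> (x + 1), x + 1 := \<xi> x)"

definition site_rate :: "(int \<Rightarrow> real) \<Rightarrow> config \<Rightarrow> nat \<Rightarrow> real" where
  "site_rate \<omega> \<xi> x =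
     (if \<xi> x = 1 \<and> \<xi> (x + 1) = 0 then \<omega> (int x)
      else if \<xi> x = 0 \<and> \<xi> (x + 1) = 1 then 1 - \<omega> (int x + 1)
      else 0)"

definition jump_rate :: "(int \<Rightarrow> real) \<Rightarrow> nat \<Rightarrow> config \<Rightarrow> config \<Rightarrow> real" where
  "jump_rate \<omega> N \<xi> \<eta> = (\<Sum>x\<in>{x\<in>{1..N-1}. \<eta> = exchange \<xi> x}. site_rate \<omega> \<xi> x)"

definition generator :: "(int \<Rightarrow> real) \<Rightarrow> nat \<Rightarrow> nat \<Rightarrow> config \<Rightarrow> config \<Rightarrow> real" where
  "generator \<omega> N k \<xi> \<eta> =
     (if \<xi> = \<eta> then - (\<Sum>\<zeta>\<in>Omega N k - {\<xi>}. jump_rate \<omega> N \<xi> \<zeta>) else jump_rate \<omega> N \<xi> \<eta>)"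

fun generator_pow :: "(int \<Rightarrow> real) \<Rightarrow> nat \<Rightarrow> nat \<Rightarrow> nat \<Rightarrow> config \<Rightarrow> config \<Rightarrow> real" where
  "generator_pow \<omega> N k 0 \<xi> \<eta> = (if \<xi> = \<eta> then 1 else 0)"
| "generator_pow \<omega> N k (Suc n) \<xi> \<eta> =
     (\<Sum>\<zeta>\<in>Omega N k. generator \<omega> N k \<xi> \<zeta> * generator_pow \<omega> N k n \<zeta> \<eta>)"

text \<open>The state space is finite, so the transition function \<open>P\<^sub>t(\<xi>,\<eta>)\<close> of the continuous-time Markov
  chain with generator matrix \<open>L\<close> is the entry \<open>(\<xi>,\<eta>)\<close> of the matrix exponential of \<open>t L\<close>.  The
  power series is written out because the dimension is a term and not a type.\<close>

definition transition :: "(int \<Rightarrow> real) \<Rightarrow> nat \<Rightarrow> nat \<Rightarrow> real \<Rightarrow> config \<Rightarrow> config \<Rightarrow> real" where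
  "transition \<omega> N k t \<xi> \<eta> = (\<Sum>n. t ^ n / fact n * generator_pow \<omega> N k n \<xi> \<eta>)"

definition potential :: "(int \<Rightarrow> real) \<Rightarrow> nat \<Rightarrow> real" where
  "potential \<omega> x = (\<Sum>y=2..x. ln ((1 - \<omega> (int y)) / \<omega> (int y - 1)))"

definition config_potential :: "(int \<Rightarrow> real) \<Rightarrow> nat \<Rightarrow> config \<Rightarrow> real" where
  "config_potential \<omega> N \<xi> = (\<Sum>x=1..N. potential \<omega> x * real (\<xi> x))"

definition equilibrium :: "(int \<Rightarrow> real) \<Rightarrow> nat \<Rightarrow> nat \<Rightarrow> config \<Rightarrow> real" where
  "equilibrium \<omega> N k \<xi> =
     exp (- config_potential \<omega> N \<xi>) / (\<Sum>\<zeta>\<in>Omega N k. exp (- config_potential \<omega> N \<zeta>))"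

text \<open>Probability measures on a finite set \<open>S\<close> are represented by their mass functions.\<close>

definition tv_dist :: "'b set \<Rightarrow> ('b \<Rightarrow> real) \<Rightarrow> ('b \<Rightarrow> real) \<Rightarrow> real" where
  "tv_dist S p q = (SUP A\<in>Pow S. \<bar>(\<Sum>a\<in>A. p a) - (\<Sum>a\<in>A. q a)\<bar>)"

definition mix_dist :: "(int \<Rightarrow> real) \<Rightarrow> nat \<Rightarrow> nat \<Rightarrow> real \<Rightarrow> real" where
  "mix_dist \<omega> N k t =
     Max ((\<lambda>\<xi>. tv_dist (Omega N k) (transition \<omega> N k t \<xi>) (equilibrium \<omega> N k)) ` Omega N k)"

definition t_mix :: "(int \<Rightarrow> real) \<Rightarrow> nat \<Rightarrow> nat \<Rightarrow> real" where
  "t_mix \<omega> N k = Inf {t. t \<ge> 0 \<and> mix_dist \<omega> N k t \<le> 1 / 4}"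

end

theory Submission
  imports Defs "HOL-Combinatorics.Permutations" "HOL-Real_Asymp.Real_Asymp"
begin

text \<open>The mixing time is bounded below on an event for the environment that does not depend on \<open>k\<close>: the
  potential drops by at least \<open>3 log N - O(1)\<close> between \<open>{1..3N/8}\<close> and \<open>{N/2..N}\<close>, so that equilibrium
  puts, with probability close to 1, no particle in the former region, and inside \<open>{N/4..3N/8}\<close> there are \<open>x < y\<close> with
  \<open>y - x = O(log N)\<close> and \<open>V(y) - V(x) \<ge> H\<close>, where \<open>e\<^sup>H\<close> is of order \<open>N\<^bsup>1/\<lambda>\<^esup>(log N)\<^bsup>-2/\<lambda>\<^esup>\<close>.

  The bound of order \<open>N\<close> follows the leftmost particle, which moves to the right at rate at most 1. For the second bound the
  process starts from equilibrium conditioned on a particle in \<open>{1..y}\<close>; it leaves this set at rate at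
  most \<open>e\<^bsup>-H\<^esup>\<close>. For the third bound, the current across the barrier is at most \<open>2e\<^bsup>-H/2\<^esup>\<close> per unit of
  time: couple the process with an exclusion process closed in \<open>{x..y}\<close>, in equilibrium at the Fermi level
  halfway up the barrier. If \<open>k = O(log N)\<close> the third bound is implied by the second.

  The barrier exists because the walk with steps \<open>log \<rho>\<close> climbs to height \<open>h\<close> within a block of length
  \<open>O(log N)\<close> with probability at least of order \<open>e\<^bsup>-\<lambda>h\<^esup>\<close>, and there are of order \<open>N/log N\<close> independent blocks.\<close>

section \<open>Chains driven by random mappings\<close>

text \<open>No path space is built. A process enters only through its action on functions, and a
  coupling is a product chain whose coordinate maps share the same clocks; comparing observables of
  the coordinates replaces pathwise statements. Powers of the uniformized operator are visibly
  monotone, which the exponential series of the generator is not.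

  Two features of the formal statement need work beyond the lower bounds on the distance to
  equilibrium. The infimum of an empty set of reals is an unspecified number, so bounding
  \<open>t_mix\<close> from below requires that the chain does come within 1/4 of equilibrium at
  some time; a crude Doeblin argument supplies this. And a non-measurable event has measure 0 by
  convention, so passing from the event of good environments to the event of the theorem requires
  the mixing time to be measurable in the environment.\<close>

locale random_mapping =
  fixes A :: "'i set" and r :: "'i \<Rightarrow> real" and T :: "'i \<Rightarrow> 's \<Rightarrow> 's" and S :: "'s set" and c :: real
  assumes finite_A: "finite A"
    and r_nonneg: "\<And>a. a \<in> A \<Longrightarrow> 0 \<le> r a"
    and c_pos: "0 < c"
    and r_sum: "sum r A \<le> c"
    and T_closed: "\<And>a s. a \<in> A \<Longrightarrow> s \<in> S \<Longrightarrow> T a s \<in> S"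
begin

definition gen :: "('s \<Rightarrow> real) \<Rightarrow> 's \<Rightarrow> real" where
  "gen f s = (\<Sum>a\<in>A. r a * (f (T a s) - f s))"

text \<open>The uniformized chain: \<open>step\<close> is positive, and the semigroup is a Poisson average of its powers.\<close>

definition step :: "('s \<Rightarrow> real) \<Rightarrow> 's \<Rightarrow> real" where
  "step f s = f s + gen f s / c"

definition evolve :: "real \<Rightarrow> ('s \<Rightarrow> real) \<Rightarrow> 's \<Rightarrow> real" where
  "evolve t f s = (\<Sum>n. t ^ n / fact n * (gen ^^ n) f s)"

lemma step_eq: "step f s = (1 - sum r A / c) * f s + (\<Sum>a\<in>A. r a / c * f (T a s))"
  using c_pos by (simp add: step_def gen_def algebra_simps sum_subtractf sum_divide_distrib
      sum_distrib_left diff_divide_distrib)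

lemma step_mono:
  assumes "\<And>s. s \<in> S \<Longrightarrow> f s \<le> g s" and "s \<in> S"
  shows "step f s \<le> step g s"
proof -
  have "0 \<le> 1 - sum r A / c" using r_sum c_pos by simp
  then show ?thesis unfolding step_eq using assms r_nonneg c_pos T_closed
    by (intro add_mono mult_left_mono sum_mono) auto
qed

lemma stepn_mono:
  assumes "\<And>s. s \<in> S \<Longrightarrow> f s \<le> g s" and "s \<in> S"
  shows "(step ^^ n) f s \<le> (step ^^ n) g s"
  using assms(2) by (induction n arbitrary: s) (auto intro: step_mono assms(1))

lemma step_const: "step (\<lambda>_. k) = (\<lambda>_. k)"
  by (simp add: step_def gen_def fun_eq_iff)

lemma stepn_const: "(step ^^ n) (\<lambda>_. k) s = k"
proof -
  have "(step ^^ n) (\<lambda>_. k) = (\<lambda>_. k)" by (induction n) (simp_all add: step_const)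
  then show ?thesis by simp
qed

lemma step_add: "step (\<lambda>s. f s + g s) = (\<lambda>s. step f s + step g s)"
  by (simp add: step_eq fun_eq_iff algebra_simps sum.distrib add_divide_distrib)

lemma step_mult: "step (\<lambda>s. k * f s) = (\<lambda>s. k * step f s)"
  by (simp add: step_eq fun_eq_iff algebra_simps sum_distrib_left)

lemma stepn_add: "(step ^^ n) (\<lambda>s. f s + g s) = (\<lambda>s. (step ^^ n) f s + (step ^^ n) g s)"
  by (induction n) (simp_all add: step_add)

lemma stepn_mult: "(step ^^ n) (\<lambda>s. k * f s) = (\<lambda>s. k * (step ^^ n) f s)"
  by (induction n) (simp_all add: step_mult)

text \<open>Discrete Dynkin formula: the innermost step replaces \<open>f\<close> by at most
  \<open>f + g / c\<close>, and monotonicity carries this through the remaining steps. Inequalities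
  are asked on \<open>S\<close> only, which the maps preserve.\<close>

lemma stepn_drift_upper:
  assumes "\<And>s. s \<in> S \<Longrightarrow> gen f s \<le> g s" and "s \<in> S"
  shows "(step ^^ n) f s \<le> f s + (\<Sum>m<n. (step ^^ m) g s) / c"
proof (induction n)
  case (Suc n)
  have "(step ^^ Suc n) f s = (step ^^ n) (step f) s"
    by (simp only: funpow_Suc_right comp_apply)
  also have "\<dots> \<le> (step ^^ n) (\<lambda>s. f s + (1 / c) * g s) s"
    using assms c_pos by (intro stepn_mono) (auto simp: step_def divide_right_mono)
  also have "\<dots> = (step ^^ n) f s + (step ^^ n) g s / c"
    by (simp only: stepn_add stepn_mult) simp
  finally show ?case using Suc by (simp add: add_divide_distrib)
qed simp

lemma stepn_drift_lower:
  assumes "\<And>s. s \<in> S \<Longrightarrow> - b \<le> gen f s" and "s \<in> S"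
  shows "f s - b * real n / c \<le> (step ^^ n) f s"
proof -
  have "gen (\<lambda>s. -1 * f s) s \<le> b" if "s \<in> S" for s
    using assms(1)[OF that]
    by (simp add: gen_def sum_negf[symmetric] algebra_simps sum_subtractf)
  from stepn_drift_upper[of "\<lambda>s. -1 * f s" "\<lambda>_. b", OF this assms(2), of n]
  show ?thesis by (simp only: stepn_mult stepn_const) (simp add: algebra_simps)
qed

section \<open>The exponential series as a Poisson average\<close>

lemma gen_sum: "finite I \<Longrightarrow> gen (\<lambda>s. \<Sum>i\<in>I. k i * f i s) s = (\<Sum>i\<in>I. k i * gen (f i) s)"
proof (induction I rule: finite_induct)
  case (insert i I)
  then show ?case by (simp add: gen_def algebra_simps sum.distrib sum_subtractf sum_distrib_left)
qed (simp add: gen_def)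

text \<open>Binomial expansion of the n-th power of \<open>1 + gen / c\<close>.\<close>

lemma stepn_eq_gen: "(step ^^ n) f s = (\<Sum>i\<le>n. real (n choose i) / c ^ i * (gen ^^ i) f s)"
proof (induction n arbitrary: s)
  case (Suc n)
  let ?g = "\<lambda>i. (gen ^^ i) f s"
  have IH: "(step ^^ n) f = (\<lambda>s. \<Sum>i\<le>n. real (n choose i) / c ^ i * (gen ^^ i) f s)"
    using Suc.IH by blast
  have "(step ^^ Suc n) f s = step ((step ^^ n) f) s" by simp
  also have "\<dots> = (\<Sum>i\<le>n. real (n choose i) / c ^ i * ?g i)
      + (\<Sum>i\<le>n. real (n choose i) / c ^ Suc i * ?g (Suc i))"
    unfolding step_def IH by (subst gen_sum) (simp_all add: sum_divide_distrib mult.commute)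
  also have "(\<Sum>i\<le>n. real (n choose i) / c ^ i * ?g i) =
      ?g 0 + (\<Sum>i\<le>n. real (n choose Suc i) / c ^ Suc i * ?g (Suc i))"
  proof -
    have "(\<Sum>i\<le>n. real (n choose i) / c ^ i * ?g i)
        = (\<Sum>i\<le>Suc n. real (n choose i) / c ^ i * ?g i)" by simp
    also have "\<dots> = ?g 0 + (\<Sum>i\<le>n. real (n choose Suc i) / c ^ Suc i * ?g (Suc i))"
      by (subst sum.atMost_Suc_shift) simp
    finally show ?thesis .
  qed
  also have "?g 0 + (\<Sum>i\<le>n. real (n choose Suc i) / c ^ Suc i * ?g (Suc i))
      + (\<Sum>i\<le>n. real (n choose i) / c ^ Suc i * ?g (Suc i))
      = ?g 0 + (\<Sum>i\<le>n. real (Suc n choose Suc i) / c ^ Suc i * ?g (Suc i))"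
    by (simp add: sum.distrib[symmetric] algebra_simps add_divide_distrib)
  also have "\<dots> = (\<Sum>i\<le>Suc n. real (Suc n choose i) / c ^ i * ?g i)"
    by (simp add: sum.atMost_Suc_shift del: sum.atMost_Suc binomial_Suc_Suc)
  finally show ?case .
qed simp

text \<open>In the sup norm the generator has norm at most \<open>2 * c\<close>: an increment is at
  most twice the bound, and the rates sum to at most \<open>c\<close>.\<close>

lemma gen_pow_bound:
  assumes "\<And>s. s \<in> S \<Longrightarrow> \<bar>f s\<bar> \<le> B" and "s \<in> S"
  shows "\<bar>(gen ^^ n) f s\<bar> \<le> (2 * c) ^ n * B"
  using assms(2)
proof (induction n arbitrary: s)
  case (Suc n)
  let ?b = "(2 * c) ^ n * B"
  have "\<bar>(gen ^^ Suc n) f s\<bar> \<le> (\<Sum>a\<in>A. \<bar>r a * ((gen ^^ n) f (T a s) - (gen ^^ n) f s)\<bar>)"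
    by (simp add: gen_def)
  also have "\<dots> \<le> (\<Sum>a\<in>A. r a * (2 * ?b))"
  proof (rule sum_mono)
    fix a assume a: "a \<in> A"
    have "\<bar>(gen ^^ n) f (T a s) - (gen ^^ n) f s\<bar> \<le> 2 * ?b"
      using Suc.IH[OF Suc.prems] Suc.IH[OF T_closed[OF a Suc.prems]] by linarith
    then show "\<bar>r a * ((gen ^^ n) f (T a s) - (gen ^^ n) f s)\<bar> \<le> r a * (2 * ?b)"
      using r_nonneg[OF a] by (simp add: abs_mult mult_left_mono)
  qed
  also have "\<dots> = sum r A * (2 * ?b)" by (simp add: sum_distrib_right)
  also have "\<dots> \<le> c * (2 * ?b)"
    using Suc.IH[OF Suc.prems] r_sum by (intro mult_right_mono) auto
  finally show ?case by (simp add: mult_ac)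
qed (use assms(1) in auto)

lemma summable_gen_pow:
  assumes "\<And>s. s \<in> S \<Longrightarrow> \<bar>f s\<bar> \<le> B" and "s \<in> S"
  shows "summable (\<lambda>n. \<bar>t ^ n / fact n * (gen ^^ n) f s\<bar>)"
proof (rule summable_comparison_test')
  show "summable (\<lambda>n. inverse (fact n) * (2 * c * \<bar>t\<bar>) ^ n * B)"
    by (intro summable_mult2 summable_exp)
  fix n :: nat
  have "\<bar>t ^ n / fact n * (gen ^^ n) f s\<bar> \<le> \<bar>t\<bar> ^ n / fact n * ((2 * c) ^ n * B)"
    unfolding abs_mult by (intro mult_mono gen_pow_bound assms) (auto simp: power_abs)
  then show "norm \<bar>t ^ n / fact n * (gen ^^ n) f s\<bar> \<le> inverse (fact n) * (2 * c * \<bar>t\<bar>) ^ n * B"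
    by (simp add: field_simps power_mult_distrib)
qed

text \<open>This is exp(t gen) = exp(-c t) exp(c t step). The Cauchy product of the series of
  \<open>evolve\<close> with that of \<open>exp (c * t)\<close> has the powers of
  \<open>step\<close> as its coefficients, by the binomial expansion.\<close>

lemma evolve_poisson:
  assumes "\<And>s. s \<in> S \<Longrightarrow> \<bar>f s\<bar> \<le> B" and "s \<in> S"
  shows "(\<lambda>n. exp (- (c * t)) * ((c * t) ^ n / fact n * (step ^^ n) f s)) sums evolve t f s"
proof -
  let ?a = "\<lambda>n. t ^ n / fact n * (gen ^^ n) f s"
  let ?b = "\<lambda>n. (c * t) ^ n / fact n"
  have sb: "?b sums exp (c * t)"
    using exp_converges[of "c * t"] by (simp add: field_simps)
  have sb': "summable (\<lambda>n. norm (?b n))"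
    using summable_norm_exp[of "c * t"] by (simp add: field_simps)
  have "(\<lambda>n. \<Sum>i\<le>n. ?a i * ?b (n - i)) sums (suminf ?a * suminf ?b)"
    by (intro Cauchy_product_sums sb') (use summable_gen_pow[OF assms] in simp)
  moreover have "(\<Sum>i\<le>n. ?a i * ?b (n - i)) = (c * t) ^ n / fact n * (step ^^ n) f s" for n
  proof -
    have "?a i * ?b (n - i) = (c * t) ^ n / fact n * (real (n choose i) / c ^ i * (gen ^^ i) f s)"
      if "i \<le> n" for i
    proof -
      have "(c * t) ^ n = c ^ i * (t ^ i * (c * t) ^ (n - i))"
        using that by (metis mult.assoc le_add_diff_inverse power_add power_mult_distrib)
      then show ?thesis using that c_pos by (simp add: binomial_fact field_simps)
    qed
    then show ?thesis unfolding stepn_eq_gen sum_distrib_left by (intro sum.cong) auto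
  qed
  ultimately have "(\<lambda>n. (c * t) ^ n / fact n * (step ^^ n) f s) sums (evolve t f s * exp (c * t))"
    using sums_unique[OF sb] by (simp add: evolve_def)
  from sums_mult[OF this, of "exp (- (c * t))"] show ?thesis
    by (simp add: exp_minus field_simps)
qed

lemma poisson_mean: "(\<lambda>n. exp (- u) * (u ^ n / fact n * (p + q * real n))) sums (p + q * u)" for u :: real
proof -
  have 1: "(\<lambda>n. u ^ n / fact n) sums exp u"
    using exp_converges[of u] by (simp add: field_simps)
  have "(\<lambda>n. u ^ Suc n / fact (Suc n) * real (Suc n)) sums (u * exp u)"
    using sums_mult[OF 1, of u] by (simp add: field_simps del: of_nat_Suc)
  then have 2: "(\<lambda>n. u ^ n / fact n * real n) sums (u * exp u)"
    by (subst (asm) sums_Suc_iff[of "\<lambda>n. u ^ n / fact n * real n"]) simp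
  have "(\<lambda>n. p * (u ^ n / fact n) + q * (u ^ n / fact n * real n)) sums (p * exp u + q * (u * exp u))"
    by (intro sums_add sums_mult 1 2)
  from sums_mult[OF this, of "exp (- u)"] have
    "(\<lambda>n. exp (- u) * (p * (u ^ n / fact n) + q * (u ^ n / fact n * real n))) sums
      (exp (- u) * exp u * (p + q * u))"
    by (simp add: algebra_simps)
  moreover have "exp (- u) * exp u = 1" by (simp add: exp_minus)
  moreover have "(\<lambda>n. exp (- u) * (u ^ n / fact n * (p + q * real n)))
      = (\<lambda>n. exp (- u) * (p * (u ^ n / fact n) + q * (u ^ n / fact n * real n)))"
    by (simp add: algebra_simps add_divide_distrib fun_eq_iff)
  ultimately show ?thesis by simp
qed

text \<open>The number of steps up to time \<open>t\<close> is Poisson with mean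
  \<open>c * t\<close>, so a bound affine in \<open>n / c\<close> integrates to the same bound in
  \<open>t\<close>. The weights \<open>v\<close> allow a random initial state; the weight -1 turns
  upper into lower bounds.\<close>

lemma evolve_sum_upper:
  assumes "\<And>s. s \<in> S \<Longrightarrow> \<bar>f s\<bar> \<le> B" and "D \<subseteq> S" and "0 \<le> t"
    and "\<And>n. (\<Sum>s\<in>D. v s * (step ^^ n) f s) \<le> p + q * real n / c"
  shows "(\<Sum>s\<in>D. v s * evolve t f s) \<le> p + q * t"
proof (rule sums_le)
  show "(\<lambda>n. exp (- (c * t)) * ((c * t) ^ n / fact n * (p + q / c * real n))) sums (p + q * t)"
    using poisson_mean[of "c * t" p "q / c"] c_pos by simp
  show "(\<lambda>n. \<Sum>s\<in>D. v s * (exp (- (c * t)) * ((c * t) ^ n / fact n * (step ^^ n) f s)))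
      sums (\<Sum>s\<in>D. v s * evolve t f s)"
    using assms(2) by (intro sums_sum sums_mult evolve_poisson[of f B] assms(1)) auto
  fix n
  have "(\<Sum>s\<in>D. v s * (exp (- (c * t)) * ((c * t) ^ n / fact n * (step ^^ n) f s)))
      = exp (- (c * t)) * ((c * t) ^ n / fact n * (\<Sum>s\<in>D. v s * (step ^^ n) f s))"
    by (simp add: sum_distrib_left mult_ac)
  also have "\<dots> \<le> exp (- (c * t)) * ((c * t) ^ n / fact n * (p + q / c * real n))"
    using assms(3,4) c_pos by (intro mult_left_mono) auto
  finally show "(\<Sum>s\<in>D. v s * (exp (- (c * t)) * ((c * t) ^ n / fact n * (step ^^ n) f s)))
      \<le> exp (- (c * t)) * ((c * t) ^ n / fact n * (p + q / c * real n))" .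
qed

lemma evolve_upper:
  assumes "\<And>s. s \<in> S \<Longrightarrow> \<bar>f s\<bar> \<le> B" and "s \<in> S" and "0 \<le> t"
    and "\<And>n. (step ^^ n) f s \<le> p + q * real n / c"
  shows "evolve t f s \<le> p + q * t"
  using evolve_sum_upper[of f B "{s}" t "\<lambda>_. 1" p q] assms by simp

lemma evolve_lower:
  assumes "\<And>s. s \<in> S \<Longrightarrow> \<bar>f s\<bar> \<le> B" and "s \<in> S" and "0 \<le> t"
    and "\<And>n. p - q * real n / c \<le> (step ^^ n) f s"
  shows "p - q * t \<le> evolve t f s"
proof -
  have "- (step ^^ n) f s \<le> - p + q * real n / c" for n
    using assms(4)[of n] by simp
  then show ?thesis
    using evolve_sum_upper[of f B "{s}" t "\<lambda>_. -1" "- p" q] assms(1-3) by simp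
qed

text \<open>Generating function of the Poisson law: \<open>q ^ n\<close> has mean
  \<open>exp (- (c * t * (1 - q)))\<close> when \<open>n\<close> has mean
  \<open>c * t\<close>.\<close>

lemma evolve_geometric:
  assumes "\<And>s. s \<in> S \<Longrightarrow> \<bar>f s\<bar> \<le> B" and "s \<in> S" and "0 \<le> t"
    and "\<And>n. \<bar>(step ^^ n) f s - m\<bar> \<le> C * q ^ n"
  shows "\<bar>evolve t f s - m\<bar> \<le> C * exp (- (c * t * (1 - q)))"
proof -
  let ?e = "\<lambda>n. exp (- (c * t)) * ((c * t) ^ n / fact n)"
  have "(\<lambda>n. ?e n * m) sums m"
    using poisson_mean[of "c * t" m 0] by (simp add: mult_ac)
  have d: "(\<lambda>n. ?e n * ((step ^^ n) f s - m)) sums (evolve t f s - m)"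
    using sums_diff[OF evolve_poisson[of f B s t, OF assms(1,2)] \<open>(\<lambda>n. ?e n * m) sums m\<close>]
    by (simp add: right_diff_distrib mult.assoc)
  have "(\<lambda>n. exp (- (c * t)) * C * ((c * t * q) ^ n / fact n)) sums (exp (- (c * t)) * C * exp (c * t * q))"
    using exp_converges[of "c * t * q"] by (intro sums_mult) (simp add: field_simps)
  then have g: "(\<lambda>n. ?e n * (C * q ^ n)) sums (C * exp (- (c * t * (1 - q))))"
    by (simp add: exp_add[symmetric] algebra_simps power_mult_distrib exp_minus field_simps exp_diff)
  have e: "0 \<le> ?e n" for n using c_pos assms(3) by simp
  have le: "\<bar>?e n * ((step ^^ n) f s - m)\<bar> \<le> ?e n * (C * q ^ n)" for n
    using mult_left_mono[OF assms(4) e, of n n] by (simp only: abs_mult[of "?e n"] abs_of_nonneg[OF e])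
  have "evolve t f s - m \<le> C * exp (- (c * t * (1 - q)))"
    by (rule sums_le[OF _ d g]) (rule order_trans[OF abs_ge_self le])
  moreover have "- (evolve t f s - m) \<le> C * exp (- (c * t * (1 - q)))"
    by (rule sums_le[OF _ sums_minus[OF d] g]) (rule order_trans[OF abs_ge_minus_self le])
  ultimately show ?thesis by linarith
qed

text \<open>With \<open>\<phi>\<close> a coordinate of a pair, this says that the coupling has the
  single chain as its marginal.\<close>

lemma stepn_proj:
  assumes "random_mapping A r T' S' c" and "\<And>a s. \<phi> (T' a s) = T a (\<phi> s)"
  shows "(random_mapping.step A r T' c ^^ n) (\<lambda>s. F (\<phi> s)) = (\<lambda>s. (step ^^ n) F (\<phi> s))"
proof -
  interpret X: random_mapping A r T' S' c by fact
  show ?thesis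
    by (induction n) (simp_all add: fun_eq_iff X.step_def X.gen_def step_def gen_def assms(2))
qed

lemma stationary_stepn:
  assumes "\<And>f. (\<Sum>s\<in>S. w s * gen f s) = 0"
  shows "(\<Sum>s\<in>S. w s * (step ^^ n) f s) = (\<Sum>s\<in>S. w s * f s)"
proof (induction n)
  case (Suc n)
  have "(\<Sum>s\<in>S. w s * (step ^^ Suc n) f s)
      = (\<Sum>s\<in>S. w s * (step ^^ n) f s) + (\<Sum>s\<in>S. w s * gen ((step ^^ n) f) s) / c"
    by (simp add: step_def algebra_simps sum.distrib sum_divide_distrib)
  then show ?case using assms Suc by simp
qed simp

end

section \<open>The exclusion process on a segment\<close>

text \<open>\<open>(z, d)\<close> stands for an attempted jump across the edge \<open>{z, z + 1}\<close>, to the right if \<open>d\<close>.\<close>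

definition attempt :: "nat \<times> bool \<Rightarrow> config \<Rightarrow> config" where
  "attempt a \<xi> = (if (if snd a then \<xi> (fst a) = 1 \<and> \<xi> (fst a + 1) = 0 else \<xi> (fst a) = 0 \<and> \<xi> (fst a + 1) = 1)
     then exchange \<xi> (fst a) else \<xi>)"

definition clock :: "(int \<Rightarrow> real) \<Rightarrow> nat \<times> bool \<Rightarrow> real" where
  "clock \<omega> a = (if snd a then \<omega> (int (fst a)) else 1 - \<omega> (int (fst a) + 1))"

text \<open>Grand-canonical weight on the sites \<open>I\<close> with chemical potential
  \<open>\<theta>\<close>. On \<open>{1..N}\<close> with \<open>\<theta> = 0\<close> it is the
  unnormalized equilibrium; the parameter matters for the segment, where the particle number is not
  fixed.\<close>

definition gibbs :: "(nat \<Rightarrow> real) \<Rightarrow> real \<Rightarrow> nat set \<Rightarrow> config \<Rightarrow> real" where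
  "gibbs V \<theta> I \<xi> = exp (\<Sum>x\<in>I. (\<theta> - V x) * real (\<xi> x))"

lemma gibbs_pos: "0 < gibbs V \<theta> I \<xi>"
  by (simp add: gibbs_def)

lemma gibbs_update:
  assumes "finite I" and "u \<in> I"
  shows "gibbs V \<theta> I (\<xi>(u := n)) = gibbs V \<theta> I \<xi> * exp ((\<theta> - V u) * (real n - real (\<xi> u)))"
proof -
  have "(\<Sum>x\<in>I. (\<theta> - V x) * real ((\<xi>(u := n)) x))
      = (\<Sum>x\<in>I. (\<theta> - V x) * real (\<xi> x)) + (\<theta> - V u) * (real n - real (\<xi> u))"
    using assms by (simp add: sum.remove[of I u] algebra_simps)
  then show ?thesis by (simp add: gibbs_def exp_add)
qed

section \<open>Moving one particle, and detailed balance\<close>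

definition swap_sites :: "config \<Rightarrow> nat \<Rightarrow> nat \<Rightarrow> config" where
  "swap_sites \<xi> u v = \<xi> \<circ> Transposition.transpose u v"

lemma swap_sites_apply:
  "swap_sites \<xi> u v x = (if x = u then \<xi> v else if x = v then \<xi> u else \<xi> x)"
  by (simp add: swap_sites_def Transposition.transpose_def)

lemma exchange_eq_swap: "exchange \<xi> z = swap_sites \<xi> z (z + 1)"
  by (auto simp: exchange_def swap_sites_apply fun_eq_iff)

lemma swap_sites_swap [simp]: "swap_sites (swap_sites \<xi> u v) u v = \<xi>"
  by (simp add: swap_sites_def comp_assoc)

lemma inj_swap_sites: "inj_on (\<lambda>\<xi>. swap_sites \<xi> u v) B"
  by (metis inj_on_inverseI swap_sites_swap)

lemma gibbs_swap:
  assumes "finite I" and "u \<in> I" and "v \<in> I" and "\<xi> u = 1" and "\<xi> v = 0"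
  shows "gibbs V \<theta> I (swap_sites \<xi> u v) = gibbs V \<theta> I \<xi> * exp (V u - V v)"
proof -
  have "u \<noteq> v" using assms by auto
  have "swap_sites \<xi> u v = (\<xi>(u := 0))(v := 1)"
    using assms by (auto simp: swap_sites_apply fun_eq_iff)
  then have "gibbs V \<theta> I (swap_sites \<xi> u v)
      = gibbs V \<theta> I \<xi> * exp ((\<theta> - V u) * (0 - 1)) * exp ((\<theta> - V v) * (1 - 0))"
    using assms \<open>u \<noteq> v\<close> by (simp add: gibbs_update)
  then show ?thesis by (simp add: mult.assoc exp_add[symmetric])
qed

text \<open>The estimates of equilibrium weights below all have this shape: an injective
  modification (moving, adding or removing a particle) changes the weight by a controlled
  factor.\<close>

lemma sum_weight_le_inj:
  fixes w :: "'b \<Rightarrow> real"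
  assumes "finite C" and "inj_on \<phi> B" and "\<phi> ` B \<subseteq> C"
    and "\<And>b. b \<in> B \<Longrightarrow> w b \<le> e * w (\<phi> b)" and "0 \<le> e" and "\<And>c. c \<in> C \<Longrightarrow> 0 \<le> w c"
  shows "sum w B \<le> e * sum w C"
proof -
  have "sum w B \<le> (\<Sum>b\<in>B. e * w (\<phi> b))" by (intro sum_mono assms)
  also have "\<dots> = e * sum w (\<phi> ` B)"
    using assms(2) by (simp add: sum.reindex sum_distrib_left)
  also have "\<dots> \<le> e * sum w C"
    using assms by (intro mult_left_mono sum_mono2) auto
  finally show ?thesis .
qed

lemma attempt_gen:
  assumes "\<xi> \<in> I \<rightarrow>\<^sub>E {0, 1}" "{z, z + 1} \<subseteq> I"
  shows "(\<Sum>d\<in>UNIV. clock \<omega> (z, d) * (f (attempt (z, d) \<xi>) - f \<xi>))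
    = site_rate \<omega> \<xi> z * (f (exchange \<xi> z) - f \<xi>)"
  by (auto simp: UNIV_bool clock_def attempt_def site_rate_def)

lemma gibbs_detailed_balance:
  assumes "finite S" and "S \<subseteq> I \<rightarrow>\<^sub>E {0, 1}" and "finite I" and "{z, z + 1} \<subseteq> I"
    and "\<And>\<xi>. \<xi> \<in> S \<Longrightarrow> exchange \<xi> z \<in> S"
    and "0 < \<omega> (int z)" and "\<omega> (int z + 1) < 1"
    and "V (z + 1) = V z + ln ((1 - \<omega> (int z + 1)) / \<omega> (int z))"
  shows "(\<Sum>\<xi>\<in>S. gibbs V \<theta> I \<xi> * (site_rate \<omega> \<xi> z * (f (exchange \<xi> z) - f \<xi>))) = 0"
proof -
  let ?e = "\<lambda>\<xi>. exchange \<xi> z"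
  let ?q = "\<lambda>\<xi>. gibbs V \<theta> I \<xi> * site_rate \<omega> \<xi> z"
  have ee: "?e (?e \<xi>) = \<xi>" for \<xi> by (simp add: exchange_eq_swap)
  have eV: "exp (V (z + 1) - V z) = (1 - \<omega> (int z + 1)) / \<omega> (int z)"
    using assms(6-8) by simp
  have eV': "exp (V z - V (z + 1)) = \<omega> (int z) / (1 - \<omega> (int z + 1))"
    using eV by (metis exp_minus inverse_divide minus_diff_eq)
  \<comment> \<open>Detailed balance: the flow across the edge is equal in both directions, so
    reindexing by the involution \<open>exchange\<close> cancels the gain against the loss.\<close>
  have q: "?q (?e \<xi>) = ?q \<xi>" if "\<xi> \<in> S" for \<xi>
  proof -
    have v: "\<xi> z \<in> {0,1}" "\<xi> (z + 1) \<in> {0,1}" using that assms(2,4) by (auto dest!: subsetD)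
    consider "\<xi> z = 1" "\<xi> (z + 1) = 0" | "\<xi> z = 0" "\<xi> (z + 1) = 1" | "\<xi> z = \<xi> (z + 1)"
      using v by auto
    then show ?thesis
    proof cases
      case 1
      have g: "gibbs V \<theta> I (?e \<xi>) = gibbs V \<theta> I \<xi> * exp (V z - V (z + 1))"
        unfolding exchange_eq_swap using assms(3,4) 1 by (intro gibbs_swap) auto
      show ?thesis unfolding g eV' using 1 assms(7)
        by (simp add: site_rate_def exchange_def)
    next
      case 2
      have "?e \<xi> = swap_sites \<xi> (z + 1) z"
        by (auto simp: exchange_def swap_sites_apply fun_eq_iff)
      then have g: "gibbs V \<theta> I (?e \<xi>) = gibbs V \<theta> I \<xi> * exp (V (z + 1) - V z)"
        using assms(3,4) 2 by (simp add: gibbs_swap)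
      show ?thesis unfolding g eV using 2 assms(6)
        by (simp add: site_rate_def exchange_def)
    next
      case 3
      then have "?e \<xi> = \<xi>" by (auto simp: exchange_def)
      then show ?thesis by simp
    qed
  qed
  have "(\<Sum>\<xi>\<in>S. ?q \<xi> * f (?e \<xi>)) = (\<Sum>\<xi>\<in>S. ?q \<xi> * f \<xi>)"
  proof (rule sum.reindex_bij_witness[of S ?e ?e])
    show "?q (?e \<xi>) * f (?e \<xi>) = ?q \<xi> * f (?e \<xi>)" if "\<xi> \<in> S" for \<xi> using q[OF that] by simp
  qed (use assms(5) ee in auto)
  then show ?thesis by (simp add: algebra_simps sum_subtractf)
qed

section \<open>The generator matrix and total variation\<close>

lemma finite_Omega: "finite (Omega N k)"
  by (rule finite_subset[of _ "{1..N} \<rightarrow>\<^sub>E {0, 1}"]) (auto simp: Omega_def intro!: finite_PiE)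

lemma OmegaD: "\<xi> \<in> Omega N k \<Longrightarrow> x \<in> {1..N} \<Longrightarrow> \<xi> x = 0 \<or> \<xi> x = 1"
  by (auto simp: Omega_def)

lemma swap_sites_PiE:
  assumes "\<xi> \<in> I \<rightarrow>\<^sub>E {0, 1}" and "u \<in> I" and "v \<in> I"
  shows "swap_sites \<xi> u v \<in> I \<rightarrow>\<^sub>E {0, 1}"
  using assms by (auto simp: swap_sites_apply PiE_iff extensional_def)

lemma swap_sites_Omega:
  assumes "\<xi> \<in> Omega N k" and "u \<in> {1..N}" and "v \<in> {1..N}"
  shows "swap_sites \<xi> u v \<in> Omega N k"
proof -
  have "(\<Sum>x=1..N. swap_sites \<xi> u v x) = (\<Sum>x=1..N. \<xi> x)"
    using sum.permute[of "Transposition.transpose u v" "{1..N}" \<xi>] permutes_swap_id[of u "{1..N}" v] assms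
    by (simp add: swap_sites_def)
  then show ?thesis using assms swap_sites_PiE[of \<xi> "{1..N}"] by (simp add: Omega_def)
qed

lemma exchange_Omega: "\<xi> \<in> Omega N k \<Longrightarrow> z \<in> {1..<N} \<Longrightarrow> exchange \<xi> z \<in> Omega N k"
  unfolding exchange_eq_swap by (intro swap_sites_Omega) auto

text \<open>Writing the diagonal entry through differences \<open>f \<zeta> - f \<xi>\<close> makes
  the term \<open>\<zeta> = \<xi>\<close> vanish, so the sum can run over the whole state space and
  be resolved edge by edge.\<close>

lemma generator_sum:
  assumes "\<xi> \<in> Omega N k"
  shows "(\<Sum>\<zeta>\<in>Omega N k. generator \<omega> N k \<xi> \<zeta> * f \<zeta>)
    = (\<Sum>z\<in>{1..<N}. site_rate \<omega> \<xi> z * (f (exchange \<xi> z) - f \<xi>))"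
proof -
  let ?O = "Omega N k" and ?j = "jump_rate \<omega> N \<xi>"
  have set: "{1..N-1} = {1..<N}" by auto
  have "(\<Sum>\<zeta>\<in>?O. generator \<omega> N k \<xi> \<zeta> * f \<zeta>)
      = generator \<omega> N k \<xi> \<xi> * f \<xi> + (\<Sum>\<zeta>\<in>?O - {\<xi>}. generator \<omega> N k \<xi> \<zeta> * f \<zeta>)"
    using finite_Omega assms by (rule sum.remove)
  also have "(\<Sum>\<zeta>\<in>?O - {\<xi>}. generator \<omega> N k \<xi> \<zeta> * f \<zeta>) = (\<Sum>\<zeta>\<in>?O - {\<xi>}. ?j \<zeta> * f \<zeta>)"
    by (intro sum.cong) (auto simp: generator_def)
  also have "generator \<omega> N k \<xi> \<xi> * f \<xi> + \<dots> = (\<Sum>\<zeta>\<in>?O - {\<xi>}. ?j \<zeta> * (f \<zeta> - f \<xi>))"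
    by (simp add: generator_def right_diff_distrib sum_subtractf sum_distrib_right)
  also have "\<dots> = (\<Sum>\<zeta>\<in>?O. ?j \<zeta> * (f \<zeta> - f \<xi>))"
    using finite_Omega assms by (simp add: sum.remove[of ?O \<xi>])
  also have "\<dots> = (\<Sum>\<zeta>\<in>?O. \<Sum>z\<in>{1..<N}. if \<zeta> = exchange \<xi> z then site_rate \<omega> \<xi> z * (f \<zeta> - f \<xi>) else 0)"
    unfolding jump_rate_def set
    by (intro sum.cong refl, subst sum.inter_filter[symmetric]) (simp_all only: sum_distrib_right finite_atLeastLessThan)
  also have "\<dots> = (\<Sum>z\<in>{1..<N}. \<Sum>\<zeta>\<in>?O. if \<zeta> = exchange \<xi> z then site_rate \<omega> \<xi> z * (f \<zeta> - f \<xi>) else 0)"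
    by (rule sum.swap)
  also have "\<dots> = (\<Sum>z\<in>{1..<N}. site_rate \<omega> \<xi> z * (f (exchange \<xi> z) - f \<xi>))"
    using exchange_Omega[OF assms] finite_Omega by (intro sum.cong refl) (simp add: sum.delta)
  finally show ?thesis .
qed

lemma generator_pow_bound:
  assumes "\<xi> \<in> Omega N k"
  shows "\<bar>generator_pow \<omega> N k n \<xi> \<eta>\<bar>
    \<le> (\<Sum>\<xi>\<in>Omega N k. \<Sum>\<zeta>\<in>Omega N k. \<bar>generator \<omega> N k \<xi> \<zeta>\<bar>) ^ n"
  using assms
proof (induction n arbitrary: \<xi>)
  case (Suc n)
  let ?G = "\<Sum>\<xi>\<in>Omega N k. \<Sum>\<zeta>\<in>Omega N k. \<bar>generator \<omega> N k \<xi> \<zeta>\<bar>"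
  have "\<bar>generator_pow \<omega> N k (Suc n) \<xi> \<eta>\<bar>
      \<le> (\<Sum>\<zeta>\<in>Omega N k. \<bar>generator \<omega> N k \<xi> \<zeta> * generator_pow \<omega> N k n \<zeta> \<eta>\<bar>)" by simp
  also have "\<dots> \<le> (\<Sum>\<zeta>\<in>Omega N k. \<bar>generator \<omega> N k \<xi> \<zeta>\<bar> * ?G ^ n)"
    unfolding abs_mult by (intro sum_mono mult_left_mono Suc.IH) auto
  also have "\<dots> = (\<Sum>\<zeta>\<in>Omega N k. \<bar>generator \<omega> N k \<xi> \<zeta>\<bar>) * ?G ^ n"
    by (simp add: sum_distrib_right)
  also have "\<dots> \<le> ?G * ?G ^ n"
    using Suc.prems finite_Omega
    by (intro mult_right_mono member_le_sum[of \<xi> "Omega N k"] zero_le_power sum_nonneg) (auto intro: sum_nonneg)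
  finally show ?case by simp
qed simp

lemma summable_generator_pow:
  assumes "\<xi> \<in> Omega N k"
  shows "summable (\<lambda>n. t ^ n / fact n * generator_pow \<omega> N k n \<xi> \<eta>)"
proof (rule summable_comparison_test')
  let ?G = "\<Sum>\<xi>\<in>Omega N k. \<Sum>\<zeta>\<in>Omega N k. \<bar>generator \<omega> N k \<xi> \<zeta>\<bar>"
  show "summable (\<lambda>n. inverse (fact n) * (\<bar>t\<bar> * ?G) ^ n)"
    by (rule summable_exp)
  fix n :: nat
  have "\<bar>t ^ n / fact n * generator_pow \<omega> N k n \<xi> \<eta>\<bar> \<le> \<bar>t\<bar> ^ n / fact n * ?G ^ n"
    unfolding abs_mult by (intro mult_mono generator_pow_bound assms) (auto simp: power_abs)
  then show "norm (t ^ n / fact n * generator_pow \<omega> N k n \<xi> \<eta>) \<le> inverse (fact n) * (\<bar>t\<bar> * ?G) ^ n"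
    by (simp add: field_simps power_mult_distrib)
qed

lemma potential_Suc:
  assumes "1 \<le> z"
  shows "potential \<omega> (z + 1) = potential \<omega> z + ln ((1 - \<omega> (int z + 1)) / \<omega> (int z))"
  using assms by (simp add: potential_def add.commute)

lemma equilibrium_gibbs:
  "equilibrium \<omega> N k \<xi> = gibbs (potential \<omega>) 0 {1..N} \<xi> / (\<Sum>\<zeta>\<in>Omega N k. gibbs (potential \<omega>) 0 {1..N} \<zeta>)"
  by (simp add: equilibrium_def gibbs_def config_potential_def sum_negf)

text \<open>Among test functions with values in [0, 1] the difference of the means is largest for
  the indicator of the states with \<open>p s < q s\<close>.\<close>

lemma tv_dist_ge:
  assumes "finite S" and "\<And>s. s \<in> S \<Longrightarrow> 0 \<le> f s" and "\<And>s. s \<in> S \<Longrightarrow> f s \<le> 1"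
  shows "(\<Sum>s\<in>S. q s * f s) - (\<Sum>s\<in>S. p s * f s) \<le> tv_dist S p q"
proof -
  let ?A = "{s \<in> S. p s < q s}"
  have "(\<Sum>s\<in>S. q s * f s) - (\<Sum>s\<in>S. p s * f s) = (\<Sum>s\<in>S. (q s - p s) * f s)"
    by (simp add: algebra_simps sum_subtractf)
  also have "\<dots> \<le> (\<Sum>s\<in>S. if p s < q s then q s - p s else 0)"
  proof (rule sum_mono)
    fix s assume "s \<in> S"
    then show "(q s - p s) * f s \<le> (if p s < q s then q s - p s else 0)"
      using assms(2,3)[of s] mult_left_mono[of "f s" 1 "q s - p s"] mult_nonneg_nonneg[of "p s - q s" "f s"]
      by (auto simp: algebra_simps)
  qed
  also have "\<dots> = sum q ?A - sum p ?A"
    using assms(1) by (simp add: sum.inter_filter[symmetric] sum_subtractf)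
  also have "\<dots> \<le> \<bar>sum p ?A - sum q ?A\<bar>" by simp
  also have "\<dots> \<le> tv_dist S p q"
    unfolding tv_dist_def using assms(1) by (intro cSUP_upper bdd_above_finite) auto
  finally show ?thesis .
qed

section \<open>Measurability of the mixing time\<close>

lemma continuous_on_Max_image:
  fixes f :: "'i \<Rightarrow> real \<Rightarrow> real"
  assumes "finite I" and "I \<noteq> {}" and "\<And>i. i \<in> I \<Longrightarrow> continuous_on UNIV (f i)"
  shows "continuous_on UNIV (\<lambda>t. Max ((\<lambda>i. f i t) ` I))"
  using assms
proof (induction I rule: finite_ne_induct)
  case (insert i I)
  then show ?case by (simp add: continuous_on_max)
qed simp

text \<open>Replaces an existence statement over real times by countably many conditions at rational
  times. From right to left, the minimum over the compact interval is attained and lies below every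
  \<open>a + 1 / Suc n\<close>.\<close>

lemma sublevel_point_iff_rational:
  fixes D :: "real \<Rightarrow> real" and q :: rat
  assumes "continuous_on UNIV D" and "0 \<le> q"
  shows "(\<exists>t. 0 \<le> t \<and> t \<le> of_rat q \<and> D t \<le> a) \<longleftrightarrow>
    (\<forall>n. \<exists>r. 0 \<le> r \<and> r \<le> q \<and> D (of_rat r) < a + 1 / real (Suc n))"
proof
  assume "\<exists>t. 0 \<le> t \<and> t \<le> of_rat q \<and> D t \<le> a"
  then obtain t where t: "0 \<le> t" "t \<le> of_rat q" "D t \<le> a" by blast
  show "\<forall>n. \<exists>r. 0 \<le> r \<and> r \<le> q \<and> D (of_rat r) < a + 1 / real (Suc n)"
  proof
    fix n
    have "0 < 1 / real (Suc n)" by simp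
    then obtain d where d: "0 < d" "\<And>r. \<bar>r - t\<bar> < d \<Longrightarrow> \<bar>D r - D t\<bar> < 1 / real (Suc n)"
      using assms(1) unfolding continuous_on_iff dist_real_def by (metis UNIV_I)
    obtain r where r: "0 \<le> r" "r \<le> q" "\<bar>of_rat r - t\<bar> < d"
    \<comment> \<open>At the right endpoint there is no room above \<open>t\<close> inside the
      interval, but there \<open>t\<close> is itself rational.\<close>
    proof (cases "t = of_rat q")
      case True
      then show ?thesis using d(1) assms(2) that[of q] by simp
    next
      case False
      then have "t < min (of_rat q) (t + d)" using t d(1) by simp
      then obtain r where r: "t < of_rat r" "of_rat r < min (of_rat q) (t + d)"
        using of_rat_dense by blast
      then have "0 < (of_rat r :: real)" "of_rat r < (of_rat q :: real)" using t(1) by linarith+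
      then have "0 < r" "r < q" by (simp_all add: of_rat_less)
      then show ?thesis using r t by (intro that[of r]) auto
    qed
    then show "\<exists>r. 0 \<le> r \<and> r \<le> q \<and> D (of_rat r) < a + 1 / real (Suc n)"
      using d(2)[OF r(3)] t(3) by (intro exI[of _ r]) (auto simp: abs_less_iff)
  qed
next
  assume R: "\<forall>n. \<exists>r. 0 \<le> r \<and> r \<le> q \<and> D (of_rat r) < a + 1 / real (Suc n)"
  have "compact {0..of_rat q :: real}" "{0..of_rat q :: real} \<noteq> {}" using assms(2) by auto
  then obtain t where t: "t \<in> {0..of_rat q}" "\<And>u. u \<in> {0..of_rat q} \<Longrightarrow> D t \<le> D u"
    using continuous_attains_inf[of "{0..of_rat q}" D] continuous_on_subset[OF assms(1)] by blast
  have "D t \<le> a + 1 / real (Suc n)" for n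
  proof -
    obtain r where r: "0 \<le> r" "r \<le> q" "D (of_rat r) < a + 1 / real (Suc n)" using R by blast
    have "(of_rat r :: real) \<in> {0..of_rat q}" using r by (simp add: of_rat_less_eq)
    then show ?thesis using t(2) r(3) by fastforce
  qed
  moreover have "(\<lambda>n. a + 1 / real (Suc n)) \<longlonglongrightarrow> a + 0"
    by (intro tendsto_add tendsto_const LIMSEQ_inverse_real_of_nat[unfolded inverse_eq_divide])
  ultimately have "D t \<le> a" using LIMSEQ_le_const by fastforce
  then show "\<exists>t. 0 \<le> t \<and> t \<le> of_rat q \<and> D t \<le> a" using t by auto
qed

lemma sets_Inf_sublevel:
  fixes D :: "real \<Rightarrow> 'a \<Rightarrow> real"
  assumes cont: "\<And>e. continuous_on UNIV (\<lambda>t. D t e)" and meas [measurable]: "\<And>t. D t \<in> borel_measurable M"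
  shows "{e \<in> space M. s \<le> Inf {t. 0 \<le> t \<and> D t e \<le> a}} \<in> sets M"
proof -
  define H where "H = (\<lambda>(q::rat) e. 0 \<le> q \<and> (\<forall>n. \<exists>r. 0 \<le> r \<and> r \<le> q \<and> D (of_rat r) e < a + 1 / real (Suc n)))"
  have H: "H q e \<longleftrightarrow> 0 \<le> q \<and> (\<exists>t. 0 \<le> t \<and> t \<le> of_rat q \<and> D t e \<le> a)" for q e
    unfolding H_def using sublevel_point_iff_rational[OF cont] by blast
  have [measurable]: "Measurable.pred M (H q)" for q
    unfolding H_def by measurable
  let ?T = "\<lambda>e. {t. 0 \<le> t \<and> D t e \<le> a}"
  have ne: "?T e \<noteq> {} \<longleftrightarrow> (\<exists>q. H q e)" for e
  proof
    assume "?T e \<noteq> {}"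
    then obtain t where t: "0 \<le> t" "D t e \<le> a" by blast
    obtain q where "t < of_rat q" using of_rat_dense[of t "t + 1"] by auto
    moreover from this t(1) have "0 < (of_rat q :: real)" by linarith
    then have "0 < q" by simp
    ultimately show "\<exists>q. H q e" unfolding H using t by (intro exI[of _ q]) auto
  qed (auto simp: H)
  have le: "s \<le> Inf (?T e) \<longleftrightarrow> (\<forall>q. of_rat q < s \<longrightarrow> \<not> H q e)" if "?T e \<noteq> {}" for e
  proof
    assume "s \<le> Inf (?T e)"
    moreover have "Inf (?T e) \<le> t" if "t \<in> ?T e" for t
      using that by (intro cInf_lower bdd_belowI[of _ 0]) auto
    ultimately show "\<forall>q. of_rat q < s \<longrightarrow> \<not> H q e" unfolding H by fastforce
  next
    assume *: "\<forall>q. of_rat q < s \<longrightarrow> \<not> H q e"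
    show "s \<le> Inf (?T e)"
    proof (rule cInf_greatest[OF that])
      fix t assume t: "t \<in> ?T e"
      show "s \<le> t"
      proof (rule ccontr)
        assume "\<not> s \<le> t"
        then obtain q where q: "t < of_rat q" "of_rat q < s" using of_rat_dense[of t s] by auto
        moreover have "0 \<le> t" using t by simp
        ultimately have "0 < (of_rat q :: real)" by linarith
        then have "0 < q" by simp
        then have "H q e" unfolding H using t q by auto
        then show False using * q by blast
      qed
    qed
  qed
  \<comment> \<open>Where no time qualifies, the infimum is the unspecified number
    \<open>Inf {}\<close>. It does not depend on \<open>e\<close>, so that branch is measurable as
    well.\<close>
  have "{e \<in> space M. s \<le> Inf (?T e)} = {e \<in> space M. (\<exists>q. H q e) \<and> (\<forall>q. of_rat q < s \<longrightarrow> \<not> H q e)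
      \<or> \<not> (\<exists>q. H q e) \<and> s \<le> Inf {}}"
  proof (intro Collect_cong conj_cong refl)
    fix e
    show "s \<le> Inf (?T e) \<longleftrightarrow> (\<exists>q. H q e) \<and> (\<forall>q. of_rat q < s \<longrightarrow> \<not> H q e) \<or> \<not> (\<exists>q. H q e) \<and> s \<le> Inf {}"
    proof (cases "?T e = {}")
      case True
      then show ?thesis using ne[of e] by (simp only: True) simp
    next
      case False
      then show ?thesis using le[of e] ne[of e] by blast
    qed
  qed
  also have "\<dots> \<in> sets M" by measurable
  finally show ?thesis .
qed

lemma continuous_transition:
  assumes "\<xi> \<in> Omega N k"
  shows "continuous_on UNIV (\<lambda>t. transition \<omega> N k t \<xi> \<eta>)"
proof -
  have "isCont (\<lambda>t. \<Sum>n. (generator_pow \<omega> N k n \<xi> \<eta> / fact n) * t ^ n) t" for t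
    using summable_generator_pow[OF assms] by (intro isCont_powser_converges_everywhere) (simp add: mult.commute)
  then show ?thesis
    unfolding transition_def by (simp add: continuous_on_eq_continuous_at mult.commute)
qed

lemma tv_dist_Max:
  assumes "finite S"
  shows "tv_dist S p q = Max ((\<lambda>A. \<bar>(\<Sum>a\<in>A. p a) - (\<Sum>a\<in>A. q a)\<bar>) ` Pow S)"
  unfolding tv_dist_def using assms by (intro cSup_eq_Max) auto

lemma continuous_mix_dist:
  assumes "Omega N k \<noteq> {}"
  shows "continuous_on UNIV (\<lambda>t. mix_dist \<omega> N k t)"
  unfolding mix_dist_def tv_dist_Max[OF finite_Omega]
proof (intro continuous_on_Max_image finite_Omega assms)
  fix \<xi> B assume \<xi>: "\<xi> \<in> Omega N k"
  show "continuous_on UNIV (\<lambda>t. \<bar>sum (transition \<omega> N k t \<xi>) B - sum (equilibrium \<omega> N k) B\<bar>)"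
    by (intro continuous_intros continuous_transition \<xi>)
qed (use finite_Omega in auto)

context
  fixes M :: "'a measure" and \<omega> :: "int \<Rightarrow> 'a \<Rightarrow> real"
  assumes env [measurable]: "\<And>x. \<omega> x \<in> borel_measurable M"
begin

lemma measurable_generator [measurable]: "(\<lambda>e. generator (\<lambda>x. \<omega> x e) N k \<xi> \<eta>) \<in> borel_measurable M"
  unfolding generator_def jump_rate_def site_rate_def by measurable

lemma measurable_generator_pow [measurable]: "(\<lambda>e. generator_pow (\<lambda>x. \<omega> x e) N k n \<xi> \<eta>) \<in> borel_measurable M"
  by (induction n arbitrary: \<xi>) auto

lemma measurable_transition [measurable]: "(\<lambda>e. transition (\<lambda>x. \<omega> x e) N k t \<xi> \<eta>) \<in> borel_measurable M"
  unfolding transition_def by measurable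

lemma measurable_potential [measurable]: "(\<lambda>e. potential (\<lambda>x. \<omega> x e) y) \<in> borel_measurable M"
  unfolding potential_def by measurable

lemma measurable_equilibrium [measurable]: "(\<lambda>e. equilibrium (\<lambda>x. \<omega> x e) N k \<xi>) \<in> borel_measurable M"
  unfolding equilibrium_def config_potential_def by measurable

lemma measurable_mix_dist [measurable]: "(\<lambda>e. mix_dist (\<lambda>x. \<omega> x e) N k t) \<in> borel_measurable M"
  unfolding mix_dist_def tv_dist_Max[OF finite_Omega]
  by (intro borel_measurable_Max finite_Omega) (use finite_Omega in \<open>auto\<close>)

lemma sets_t_mix_ge:
  assumes "Omega N k \<noteq> {}"
  shows "{e \<in> space M. s \<le> t_mix (\<lambda>x. \<omega> x e) N k} \<in> sets M"
  unfolding t_mix_def by (intro sets_Inf_sublevel continuous_mix_dist assms measurable_mix_dist)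

end

section \<open>The law of the environment\<close>

text \<open>Comes from \<open>exp u \<le> 1 / (1 - u)\<close>, whose right side is bounded to second
  order.\<close>

lemma exp_le_quadratic:
  fixes u :: real
  assumes "\<bar>u\<bar> \<le> 1 / 2"
  shows "exp u \<le> 1 + u + 2 * u\<^sup>2"
proof -
  have pos: "0 < 1 - u" using assms by linarith
  have "(1 - u) * exp u \<le> exp (- u) * exp u"
    using exp_ge_add_one_self[of "- u"] by (intro mult_right_mono) auto
  then have "(1 - u) * exp u \<le> 1" by (simp add: exp_minus)
  also have "1 \<le> (1 - u) * (1 + u + 2 * u\<^sup>2)"
  proof -
    have "(1 - u) * (1 + u + 2 * u\<^sup>2) = 1 + u\<^sup>2 * (1 - 2 * u)"
      by (simp add: algebra_simps power2_eq_square)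
    moreover have "0 \<le> u\<^sup>2 * (1 - 2 * u)" using assms by (intro mult_nonneg_nonneg) auto
    ultimately show ?thesis by linarith
  qed
  finally show ?thesis using pos by simp
qed

locale env_law =
  fixes \<alpha> :: real and \<mu> :: "real measure" and l :: real
  assumes prob_\<mu>: "prob_space \<mu>" and sets_\<mu>: "sets \<mu> = sets borel"
    and \<alpha>: "0 < \<alpha>" "\<alpha> < 1 / 2"
    and ellip: "measure \<mu> {\<alpha>..1 - \<alpha>} = 1"
    and drift: "(\<integral>w. ln (rho w) \<partial>\<mu>) < 0"
    and lam_finite: "lam \<mu> < \<infinity>"
    and l_def: "l = real_of_ereal (lam \<mu>)"
begin

sublocale \<mu>: prob_space \<mu> by (rule prob_\<mu>)

text \<open>One constant with two roles: it bounds the steps \<open>ln \<rho>\<close>, hence the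
  overshoot of the walk, and the changes of \<open>ln \<omega>\<close>, by which the potential
  differs from the walk.\<close>

definition B :: real where "B = ln ((1 - \<alpha>) / \<alpha>)"

lemma B_pos: "0 < B"
  using \<alpha> by (simp add: B_def divide_simps)

lemma measurable_\<mu>: "f \<in> borel_measurable borel \<Longrightarrow> f \<in> borel_measurable \<mu>"
  using measurable_cong_sets[OF sets_\<mu> refl] by blast

lemma rho_measurable [measurable]: "rho \<in> borel_measurable borel"
  unfolding rho_def[abs_def] by measurable

lemma rho_bounds:
  assumes "w \<in> {\<alpha>..1 - \<alpha>}"
  shows "0 < w" "w < 1" "0 < rho w" "\<bar>ln (rho w)\<bar> \<le> B"
proof -
  show w: "0 < w" "w < 1" using assms \<alpha> by auto
  then show r: "0 < rho w" by (simp add: rho_def)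
  have up: "rho w \<le> (1 - \<alpha>) / \<alpha>" unfolding rho_def using assms \<alpha> by (intro frac_le) auto
  have lo: "\<alpha> / (1 - \<alpha>) \<le> rho w" unfolding rho_def using assms \<alpha> by (intro frac_le) auto
  have "ln (rho w) \<le> B" unfolding B_def using r \<alpha> up by (subst ln_le_cancel_iff) auto
  moreover have "ln (\<alpha> / (1 - \<alpha>)) \<le> ln (rho w)" using r \<alpha> lo by (subst ln_le_cancel_iff) auto
  moreover have "ln (\<alpha> / (1 - \<alpha>)) = - B" unfolding B_def using \<alpha> by (simp add: ln_div)
  ultimately show "\<bar>ln (rho w)\<bar> \<le> B" by simp
qed

lemma ln_diff_bound:
  assumes "w \<in> {\<alpha>..1 - \<alpha>}" and "w' \<in> {\<alpha>..1 - \<alpha>}"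
  shows "\<bar>ln w - ln w'\<bar> \<le> B"
proof -
  have "0 < w" "0 < w'" using assms \<alpha> by auto
  then have "ln \<alpha> \<le> ln w" "ln \<alpha> \<le> ln w'" "ln w \<le> ln (1 - \<alpha>)" "ln w' \<le> ln (1 - \<alpha>)"
    using assms \<alpha> by simp_all
  moreover have "B = ln (1 - \<alpha>) - ln \<alpha>" unfolding B_def using \<alpha> by (simp add: ln_div)
  ultimately show "\<bar>ln w - ln w'\<bar> \<le> B" by linarith
qed

lemma AE_ellip: "AE w in \<mu>. w \<in> {\<alpha>..1 - \<alpha>}"
  using ellip by (rule \<mu>.AE_prob_1)

lemma rho_powr:
  assumes "w \<in> {\<alpha>..1 - \<alpha>}"
  shows "rho w powr s = exp (s * ln (rho w))"
  using rho_bounds(3)[OF assms] by (simp add: powr_def)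

lemma rho_powr_le:
  assumes "w \<in> {\<alpha>..1 - \<alpha>}"
  shows "rho w powr s \<le> exp (\<bar>s\<bar> * B)"
proof -
  have "s * ln (rho w) \<le> \<bar>s\<bar> * \<bar>ln (rho w)\<bar>" by (metis abs_ge_self abs_mult)
  also have "\<dots> \<le> \<bar>s\<bar> * B" using rho_bounds(4)[OF assms] by (intro mult_left_mono) auto
  finally show ?thesis by (simp add: rho_powr[OF assms])
qed

lemma rho_powr_measurable: "(\<lambda>w. rho w powr s) \<in> borel_measurable \<mu>"
  by (intro measurable_\<mu>) measurable

lemma rho_powr_integrable: "integrable \<mu> (\<lambda>w. rho w powr s)"
proof (rule \<mu>.integrable_const_bound[where B = "exp (\<bar>s\<bar> * B)"])
  show "AE w in \<mu>. norm (rho w powr s) \<le> exp (\<bar>s\<bar> * B)"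
    using AE_ellip by eventually_elim (simp add: rho_powr_le)
qed (rule rho_powr_measurable)

lemma ln_rho_integrable: "integrable \<mu> (\<lambda>w. ln (rho w))"
proof (rule \<mu>.integrable_const_bound[where B = B])
  show "AE w in \<mu>. norm (ln (rho w)) \<le> B"
    using AE_ellip by eventually_elim (simp add: rho_bounds(4))
  show "(\<lambda>w. ln (rho w)) \<in> borel_measurable \<mu>" by (intro measurable_\<mu>) measurable
qed

abbreviation F :: "real \<Rightarrow> real" where
  "F s \<equiv> \<integral>w. rho w powr s \<partial>\<mu>"

text \<open>The moment is \<open>1 + s * E[ln \<rho>]\<close> up to order s^2, and the drift is
  negative. The first term of the minimum \<open>?s0\<close> allows the quadratic bound on the
  exponential, the second makes the linear term win.\<close>

lemma F_less_1_near_0: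
  obtains s0 where "0 < s0" "\<And>s. 0 < s \<Longrightarrow> s < s0 \<Longrightarrow> F s < 1"
proof
  let ?m = "\<integral>w. ln (rho w) \<partial>\<mu>"
  let ?s0 = "min (1 / (2 * B)) (- ?m / (2 * B\<^sup>2))"
  show "0 < ?s0" using B_pos drift by (simp add: divide_neg_pos)
  fix s assume s: "0 < s" "s < ?s0"
  have sB: "s * B \<le> 1 / 2" and sm: "2 * s * B\<^sup>2 < - ?m"
    using s B_pos by (auto simp: field_simps)
  have "F s \<le> (\<integral>w. (1 + 2 * (s * B)\<^sup>2) + s * ln (rho w) \<partial>\<mu>)"
  proof (rule integral_mono_AE)
    show "AE w in \<mu>. rho w powr s \<le> (1 + 2 * (s * B)\<^sup>2) + s * ln (rho w)"
      using AE_ellip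
    proof eventually_elim
      case (elim w)
      let ?u = "s * ln (rho w)"
      have u: "\<bar>?u\<bar> \<le> s * B"
        using rho_bounds(4)[OF elim] s by (simp add: abs_mult mult_left_mono)
      then have "exp ?u \<le> 1 + ?u + 2 * ?u\<^sup>2" using sB by (intro exp_le_quadratic) linarith
      also have "?u\<^sup>2 \<le> (s * B)\<^sup>2" using u by (metis abs_le_square_iff abs_of_nonneg abs_ge_zero order_trans)
      finally show ?case by (simp add: rho_powr[OF elim])
    qed
  qed (use rho_powr_integrable ln_rho_integrable in auto)
  also have "\<dots> = 1 + 2 * (s * B)\<^sup>2 + s * ?m"
    using ln_rho_integrable by (subst Bochner_Integration.integral_add) (auto simp: \<mu>.prob_space)
  also have "\<dots> = 1 + s * (2 * s * B\<^sup>2 + ?m)" by (simp add: power2_eq_square algebra_simps)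
  also have "\<dots> < 1" using s(1) sm by (simp add: mult_pos_neg)
  finally show "F s < 1" .
qed

text \<open>The infimum is positive because moments near 0 are below 1. Dominated convergence along
  admissible exponents tending to it gives \<open>1 \<le> F l\<close>. Since \<open>l / 2\<close> is
  positive and below the infimum, its moment is below 1. Later arguments use
  \<open>\<lambda>\<close> through these three facts.\<close>

lemma l_props: "0 < l" "1 \<le> F l" "F (l / 2) < 1"
proof -
  let ?S = "{s::real. s > 0 \<and> 1 \<le> F s}"
  have ne: "?S \<noteq> {}"
  proof
    assume empty: "?S = {}"
    have "lam \<mu> = \<infinity>" unfolding lam_def empty by (simp add: top_ereal_def)
    then show False using lam_finite by simp
  qed
  have bdd: "bdd_below ?S" by (rule bdd_belowI[of _ 0]) auto
  obtain s0 where s0: "0 < s0" "\<And>s. 0 < s \<Longrightarrow> s < s0 \<Longrightarrow> F s < 1" by (rule F_less_1_near_0) blast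
  have "l = Inf ?S"
  proof -
    have "0 \<le> lam \<mu>" unfolding lam_def by (intro INF_greatest) auto
    then have "\<bar>Inf (ereal ` ?S)\<bar> \<noteq> \<infinity>" using lam_finite by (auto simp: lam_def)
    then have "ereal (Inf ?S) = lam \<mu>" unfolding lam_def by (rule ereal_Inf)
    then show ?thesis unfolding l_def by (metis real_of_ereal.simps(1))
  qed
  then have l: "l = Inf ?S" .
  have "s0 \<le> l" unfolding l
    using ne s0 by (intro cInf_greatest) (auto simp: not_less[symmetric])
  then show lpos: "0 < l" using s0 by linarith
  show "F (l / 2) < 1"
  proof (rule ccontr)
    assume "\<not> ?thesis"
    then have "l / 2 \<in> ?S" using lpos by simp
    then have "l \<le> l / 2" unfolding l by (intro cInf_lower bdd) (simp add: l)
    then show False using lpos by simp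
  qed
  have "l \<in> closure ?S" unfolding l by (rule closure_contains_Inf[OF ne bdd])
  then obtain s where s: "\<And>n. s n \<in> ?S" "s \<longlonglongrightarrow> l" unfolding closure_sequential by blast
  obtain C where C: "\<And>n. \<bar>s n\<bar> \<le> C"
    using convergent_imp_Bseq[of s] s(2) by (auto simp: convergent_def Bseq_def)
  have "(\<lambda>n. F (s n)) \<longlonglongrightarrow> F l"
  proof (rule integral_dominated_convergence[where w = "\<lambda>_. exp (C * B)"])
    show "AE w in \<mu>. (\<lambda>n. rho w powr s n) \<longlonglongrightarrow> rho w powr l"
      using AE_ellip
    proof eventually_elim
      case (elim w)
      show ?case unfolding rho_powr[OF elim] by (intro tendsto_intros s(2))
    qed
    show "AE w in \<mu>. norm (rho w powr s n) \<le> exp (C * B)" for n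
      using AE_ellip
    proof eventually_elim
      case (elim w)
      have "rho w powr s n \<le> exp (\<bar>s n\<bar> * B)" by (rule rho_powr_le[OF elim])
      also have "\<dots> \<le> exp (C * B)" using C[of n] B_pos by (simp add: mult_right_mono)
      finally show ?case by simp
    qed
  qed (use rho_powr_measurable in auto)
  then show "1 \<le> F l" using s(1) by (intro LIMSEQ_le_const[of "\<lambda>n. F (s n)"]) auto
qed

lemma F_half_pos: "0 < F (l / 2)"
proof -
  have "(\<integral>w. exp (- (l / 2 * B)) \<partial>\<mu>) \<le> F (l / 2)"
  proof (rule integral_mono_AE)
    show "AE w in \<mu>. exp (- (l / 2 * B)) \<le> rho w powr (l / 2)"
      using AE_ellip
    proof eventually_elim
      case (elim w)
      have "l / 2 * - B \<le> l / 2 * ln (rho w)"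
        using rho_bounds(4)[OF elim] l_props(1) by (intro mult_left_mono) (auto simp: abs_le_iff)
      then show ?case by (simp add: rho_powr[OF elim])
    qed
  qed (use rho_powr_integrable in auto)
  then have "exp (- (l / 2 * B)) \<le> F (l / 2)" by (simp add: \<mu>.prob_space)
  then show ?thesis by (meson exp_gt_zero less_le_trans)
qed

end

section \<open>Climbs of the random walk\<close>

text \<open>\<open>climb f a m\<close> is the maximal increase over \<open>a, \<dots>, a + m\<close>, started at \<open>a\<close>, of the walk with steps
  \<open>ln \<rho>\<close>, computed by Lindley's recursion.\<close>

fun climb :: "(int \<Rightarrow> real) \<Rightarrow> int \<Rightarrow> nat \<Rightarrow> real" where
  "climb f a 0 = 0"
| "climb f a (Suc m) = max 0 (ln (rho (f (a + 1))) + climb f (a + 1) m)"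

lemma climb_nonneg: "0 \<le> climb f a m"
  by (cases m) auto

lemma climb_cong:
  assumes "\<And>x. a < x \<Longrightarrow> x \<le> a + int m \<Longrightarrow> f x = g x"
  shows "climb f a m = climb g a m"
  using assms
proof (induction m arbitrary: a)
  case (Suc m)
  have "climb f (a + 1) m = climb g (a + 1) m" using Suc.prems by (intro Suc.IH) auto
  then show ?case using Suc.prems[of "a + 1"] by simp
qed simp

lemma climb_witness:
  assumes "0 < h" and "h \<le> climb f a m"
  obtains i where "1 \<le> i" "i \<le> m" "h \<le> (\<Sum>j=1..i. ln (rho (f (a + int j))))"
proof -
  have "\<exists>i. 1 \<le> i \<and> i \<le> m \<and> h \<le> (\<Sum>j=1..i. ln (rho (f (a + int j))))"
    using assms
  proof (induction m arbitrary: a h)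
    case (Suc m)
    let ?s = "ln (rho (f (a + 1)))"
    have hs: "h \<le> ?s + climb f (a + 1) m" using Suc.prems by auto
    show ?case
    proof (cases "h \<le> ?s")
      case True
      then show ?thesis by (intro exI[of _ 1]) simp
    next
      case False
      then obtain i where i: "1 \<le> i" "i \<le> m" "h - ?s \<le> (\<Sum>j=1..i. ln (rho (f (a + 1 + int j))))"
        using Suc.IH[of "h - ?s" "a + 1"] hs by auto
      have "(\<Sum>j=1..Suc i. ln (rho (f (a + int j)))) = ?s + (\<Sum>j=1..i. ln (rho (f (a + 1 + int j))))"
        by (subst sum.atLeast_Suc_atMost, simp, subst sum.shift_bounds_cl_Suc_ivl) (simp add: add_ac)
      then show ?thesis using i by (intro exI[of _ "Suc i"]) simp
    qed
  qed auto
  then show ?thesis using that by blast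
qed

text \<open>States the measurability on the coordinates that the climb reads, so that independence
  of restrictions of the environment to disjoint sets passes to climbs.\<close>

lemma climb_measurable:
  assumes "\<And>x. a < x \<Longrightarrow> x \<le> a + int m \<Longrightarrow> x \<in> I" and "rho \<in> borel_measurable borel"
  shows "(\<lambda>f. climb f a m) \<in> borel_measurable (PiM I (\<lambda>_. borel))"
  using assms(1)
proof (induction m arbitrary: a)
  case (Suc m)
  have [measurable]: "(\<lambda>f. climb f (a + 1) m) \<in> borel_measurable (PiM I (\<lambda>_. borel))"
    using Suc.prems by (intro Suc.IH) auto
  have "a + 1 \<in> I" using Suc.prems by auto
  then have [measurable]: "(\<lambda>f. f (a + 1)) \<in> borel_measurable (PiM I (\<lambda>_. borel))"
    by (rule measurable_component_singleton)
  note assms(2)[measurable]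
  show ?case by simp
qed simp

locale iid_env = env_law \<alpha> \<mu> l for \<alpha> \<mu> l +
  fixes M :: "'a measure" and \<omega> :: "int \<Rightarrow> 'a \<Rightarrow> real"
  assumes iid: "iid_environment M \<omega> \<mu>"
begin

sublocale M: prob_space M using iid by (simp add: iid_environment_def)

lemma indep: "M.indep_vars (\<lambda>_. borel) \<omega> UNIV"
  using iid by (simp add: iid_environment_def)

lemma env_measurable [measurable]: "\<omega> x \<in> borel_measurable M"
  using indep by (auto simp: M.indep_vars_def)

lemma env_distr: "distr M borel (\<omega> x) = \<mu>"
  using iid by (simp add: iid_environment_def)

lemma env_ellip: "AE e in M. \<omega> x e \<in> {\<alpha>..1 - \<alpha>}"
proof -
  have "AE w in distr M borel (\<omega> x). w \<in> {\<alpha>..1 - \<alpha>}" unfolding env_distr by (rule AE_ellip)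
  then show ?thesis by (subst (asm) AE_distr_iff) auto
qed

lemma climb_env_measurable [measurable]: "(\<lambda>e. climb (\<lambda>x. \<omega> x e) a m) \<in> borel_measurable M"
  by (induction m arbitrary: a) auto

text \<open>A tilted exponential moment: the induction closes because \<open>F l \<ge> 1\<close>, and \<open>F (l / 2) < 1\<close> makes
  the correction term decay in \<open>m\<close>.\<close>

lemma prob_climb_ge:
  assumes "0 < h"
  shows "exp (- l * (h + B)) * (1 - exp (l * h / 2) * F (l / 2) ^ m) \<le> M.prob {e \<in> space M. h \<le> climb (\<lambda>x. \<omega> x e) a m}"
  using assms
proof (induction m arbitrary: a h)
  case 0
  have "1 \<le> exp (l * h / 2)" using 0 l_props(1) by simp
  then have "exp (- l * (h + B)) * (1 - exp (l * h / 2)) \<le> 0" by (simp add: mult_nonneg_nonpos)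
  then show ?case using 0 measure_nonneg[of M "{e \<in> space M. h \<le> 0}"] by simp
next
  case (Suc m)
  let ?q = "F (l / 2)"
  let ?\<phi> = "\<lambda>h. exp (- l * (h + B)) * (1 - exp (l * h / 2) * ?q ^ m)"
  let ?Y = "\<lambda>e. climb (\<lambda>x. \<omega> x e) (a + 1) m"
  let ?\<nu> = "distr M borel ?Y"
  interpret \<nu>: prob_space ?\<nu> by (rule M.prob_space_distr) simp
  interpret P: pair_prob_space \<mu> ?\<nu> ..
  \<comment> \<open>The climb from \<open>a + 1\<close> reads only sites beyond
    \<open>a + 1\<close>, so it is independent of the first step, and Fubini's theorem conditions on
    that step.\<close>
  have ind: "M.indep_var borel (\<omega> (a + 1)) borel ?Y"
  proof -
    let ?I = "{a + 2..a + 1 + int m}"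
    have "M.indep_var (PiM {a + 1} (\<lambda>_. borel)) (\<lambda>e. restrict (\<lambda>x. \<omega> x e) {a + 1})
       (PiM ?I (\<lambda>_. borel)) (\<lambda>e. restrict (\<lambda>x. \<omega> x e) ?I)"
      by (rule M.indep_var_restrict[OF indep]) auto
    then have "M.indep_var borel ((\<lambda>f. f (a + 1)) \<circ> (\<lambda>e. restrict (\<lambda>x. \<omega> x e) {a + 1}))
       borel ((\<lambda>f. climb f (a + 1) m) \<circ> (\<lambda>e. restrict (\<lambda>x. \<omega> x e) ?I))"
      by (rule M.indep_var_compose) (auto intro!: climb_measurable)
    moreover have "(\<lambda>f. climb f (a + 1) m) \<circ> (\<lambda>e. restrict (\<lambda>x. \<omega> x e) ?I) = ?Y"
      by (auto simp: fun_eq_iff intro!: climb_cong)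
    ultimately show ?thesis by (simp add: comp_def)
  qed
  have dist: "distr M (borel \<Otimes>\<^sub>M borel) (\<lambda>e. (\<omega> (a + 1) e, ?Y e)) = \<mu> \<Otimes>\<^sub>M ?\<nu>"
    using ind unfolding M.indep_var_distribution_eq by (simp add: env_distr)
  define Q where "Q = {z :: real \<times> real. h \<le> ln (rho (fst z)) + snd z}"
  have Qb: "Q \<in> sets (borel \<Otimes>\<^sub>M borel)"
  proof -
    have "{z \<in> space (borel \<Otimes>\<^sub>M borel). h \<le> ln (rho (fst z)) + snd z} \<in> sets (borel \<Otimes>\<^sub>M borel)"
      by measurable
    then show ?thesis by (simp add: Q_def space_pair_measure)
  qed
  have sP: "sets (\<mu> \<Otimes>\<^sub>M ?\<nu>) = sets (borel \<Otimes>\<^sub>M borel)" using sets_\<mu> by (intro sets_pair_measure_cong) auto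
  have Q: "Q \<in> sets (\<mu> \<Otimes>\<^sub>M ?\<nu>)" using Qb sP by simp
  have "{e \<in> space M. h \<le> climb (\<lambda>x. \<omega> x e) a (Suc m)} = (\<lambda>e. (\<omega> (a + 1) e, ?Y e)) -` Q \<inter> space M"
    using Suc.prems by (auto simp: Q_def)
  then have "M.prob {e \<in> space M. h \<le> climb (\<lambda>x. \<omega> x e) a (Suc m)}
      = measure (distr M (borel \<Otimes>\<^sub>M borel) (\<lambda>e. (\<omega> (a + 1) e, ?Y e))) Q"
    using Qb by (subst measure_distr) auto
  also have "\<dots> = measure (\<mu> \<Otimes>\<^sub>M ?\<nu>) Q" by (simp add: dist)
  also have "\<dots> = (\<integral>z. indicator Q z \<partial>(\<mu> \<Otimes>\<^sub>M ?\<nu>))" using Q by simp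
  also have "\<dots> = (\<integral>x. (\<integral>y. indicator Q (x, y) \<partial>?\<nu>) \<partial>\<mu>)"
    using Q by (intro P.integral_fst'[symmetric]) (auto simp: integrable_indicator_iff P.emeasure_finite less_top[symmetric])
  finally have eq: "M.prob {e \<in> space M. h \<le> climb (\<lambda>x. \<omega> x e) a (Suc m)}
      = (\<integral>x. (\<integral>y. indicator Q (x, y) \<partial>?\<nu>) \<partial>\<mu>)" .
  have "(\<integral>x. exp (- l * (h + B)) * (rho x powr l - exp (l * h / 2) * ?q ^ m * rho x powr (l / 2)) \<partial>\<mu>)
      \<le> (\<integral>x. (\<integral>y. indicator Q (x, y) \<partial>?\<nu>) \<partial>\<mu>)"
  proof (rule integral_mono_AE)
    show "integrable \<mu> (\<lambda>x. exp (- l * (h + B)) * (rho x powr l - exp (l * h / 2) * ?q ^ m * rho x powr (l / 2)))"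
      by (intro integrable_mult_right Bochner_Integration.integrable_diff rho_powr_integrable)
    show "integrable \<mu> (\<lambda>x. \<integral>y. (indicator Q (x, y) :: real) \<partial>?\<nu>)"

      using Q by (intro P.integrable_fst'[where f = "indicator Q :: _ \<Rightarrow> real"]) (auto simp: integrable_indicator_iff P.emeasure_finite less_top[symmetric])
    show "AE x in \<mu>. exp (- l * (h + B)) * (rho x powr l - exp (l * h / 2) * ?q ^ m * rho x powr (l / 2))
        \<le> (\<integral>y. indicator Q (x, y) \<partial>?\<nu>)"
      using AE_ellip
    proof eventually_elim
      case (elim x)
      let ?s = "ln (rho x)"
      \<comment> \<open>Lowering the target from \<open>h\<close> to \<open>h - ?s\<close>
        multiplies the two exponentials by \<open>rho x powr l\<close> and
        \<open>rho x powr (l / 2)\<close>, whose means are \<open>F l\<close> and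
        \<open>F (l / 2)\<close>.\<close>
      have "exp (- l * (h + B)) * (rho x powr l - exp (l * h / 2) * ?q ^ m * rho x powr (l / 2)) = ?\<phi> (h - ?s)"
        by (simp add: rho_powr[OF elim] exp_add[symmetric] exp_diff[symmetric] algebra_simps diff_divide_distrib mult_exp_exp)
      also have "\<dots> \<le> M.prob {e \<in> space M. h - ?s \<le> ?Y e}"
      proof (cases "0 < h - ?s")
        case True
        then show ?thesis by (rule Suc.IH)
      next
        case False
        then have "h - ?s \<le> ?Y e" for e by (intro order_trans[OF _ climb_nonneg]) simp
        then have "{e \<in> space M. h - ?s \<le> ?Y e} = space M" by auto
        \<comment> \<open>Here the first step alone reaches \<open>h\<close>. The overshoot is at
          most \<open>B\<close>, and the factor \<open>exp (- l * B)\<close> in the bound is there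
          to absorb it.\<close>
        moreover have "?\<phi> (h - ?s) \<le> 1 * 1"
        proof (rule mult_mono)
          have "?s \<le> B" using rho_bounds(4)[OF elim] by simp
          then have "- l * (h - ?s + B) \<le> 0" using Suc.prems l_props(1) by (intro mult_nonpos_nonneg) auto
          then show "exp (- l * (h - ?s + B)) \<le> 1" by simp
          show "1 - exp (l * (h - ?s) / 2) * ?q ^ m \<le> 1" using F_half_pos by simp
          have "exp (l * (h - ?s) / 2) \<le> 1" using False l_props(1) by (simp add: mult_le_0_iff)
          moreover have "?q ^ m \<le> 1" using F_half_pos l_props(3) by (intro power_le_one) auto
          ultimately show "0 \<le> 1 - exp (l * (h - ?s) / 2) * ?q ^ m"
            using F_half_pos by (simp add: mult_le_one)
        qed simp
        ultimately show ?thesis by (simp add: M.prob_space)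
      qed
      also have "\<dots> = measure ?\<nu> {y. h - ?s \<le> y}"
        by (subst measure_distr) (auto intro!: arg_cong[of _ _ M.prob])
      also have "\<dots> = (\<integral>y. indicator {y. h - ?s \<le> y} y \<partial>?\<nu>)" by simp
      also have "\<dots> = (\<integral>y. indicator Q (x, y) \<partial>?\<nu>)"
        by (intro Bochner_Integration.integral_cong) (auto simp: Q_def indicator_def)
      finally show ?case .
    qed
  qed
  moreover have "(\<integral>x. exp (- l * (h + B)) * (rho x powr l - exp (l * h / 2) * ?q ^ m * rho x powr (l / 2)) \<partial>\<mu>)
      = exp (- l * (h + B)) * (F l - exp (l * h / 2) * ?q ^ m * ?q)"
    using rho_powr_integrable by (simp add: Bochner_Integration.integral_diff)
  moreover have "exp (- l * (h + B)) * (1 - exp (l * h / 2) * ?q ^ Suc m)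
      \<le> exp (- l * (h + B)) * (F l - exp (l * h / 2) * ?q ^ m * ?q)"
    using l_props(2) by (intro mult_left_mono) (auto simp: mult_ac)
  ultimately show ?case using eq by linarith
qed

text \<open>Consecutive stretches of \<open>m\<close> sites read disjoint coordinates, so the climbs
  are independent and each fails with probability at most
  \<open>1 - p \<le> exp (- p)\<close>.\<close>

lemma prob_no_climb:
  assumes p: "\<And>a. p \<le> M.prob {e \<in> space M. h \<le> climb (\<lambda>x. \<omega> x e) a m}"
  shows "M.prob {e \<in> space M. \<forall>j<n. climb (\<lambda>x. \<omega> x e) (a + int j * int m) m < h} \<le> exp (- p * real n)"
proof (cases "n = 0")
  case False
  let ?K = "\<lambda>j::nat. {a + int j * int m + 1..a + int j * int m + int m}"
  have disj: "disjoint_family_on ?K {..<n}"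
    unfolding disjoint_family_on_def
  proof (intro ballI impI)
    fix i j :: nat assume "i \<noteq> j"
    have aux: "?K i \<inter> ?K j = {}" if "i < j" for i j
    proof -
      have "(int i + 1) * int m \<le> int j * int m" using that by (intro mult_right_mono) auto
      then have "int i * int m + int m \<le> int j * int m" by (simp add: algebra_simps)
      then show ?thesis by auto
    qed
    show "?K i \<inter> ?K j = {}" using \<open>i \<noteq> j\<close> aux[of i j] aux[of j i] by (cases "i < j") auto
  qed
  have "M.indep_vars (\<lambda>j. PiM (?K j) (\<lambda>_. borel)) (\<lambda>j e. restrict (\<lambda>x. \<omega> x e) (?K j)) {..<n}"
    by (rule M.indep_vars_restrict[OF indep _ disj]) auto
  then have "M.indep_vars (\<lambda>_. borel) (\<lambda>j e. climb (restrict (\<lambda>x. \<omega> x e) (?K j)) (a + int j * int m) m) {..<n}"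
    by (rule M.indep_vars_compose2[where Y = "\<lambda>j f. climb f (a + int j * int m) m"]) (auto intro!: climb_measurable)
  moreover have "climb (restrict (\<lambda>x. \<omega> x e) (?K j)) (a + int j * int m) m = climb (\<lambda>x. \<omega> x e) (a + int j * int m) m" for j e
    by (rule climb_cong) auto
  ultimately have ind: "M.indep_vars (\<lambda>_. borel) (\<lambda>j e. climb (\<lambda>x. \<omega> x e) (a + int j * int m) m) {..<n}" by simp
  let ?X = "\<lambda>j e. climb (\<lambda>x. \<omega> x e) (a + int j * int m) m"
  have "{e \<in> space M. \<forall>j<n. ?X j e < h} = (\<Inter>j\<in>{..<n}. ?X j -` {..<h} \<inter> space M)"
    using False by auto
  then have "M.prob {e \<in> space M. \<forall>j<n. ?X j e < h} = (\<Prod>j<n. M.prob (?X j -` {..<h} \<inter> space M))"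
    using M.indep_varsD_finite[OF ind, of "\<lambda>_. {..<h}"] False by (simp add: lessThan_empty_iff)
  also have "\<dots> \<le> (\<Prod>j<n. exp (- p))"
  proof (rule prod_mono, safe)
    fix j
    have "?X j -` {..<h} \<inter> space M = space M - {e \<in> space M. h \<le> ?X j e}" by auto
    then have "M.prob (?X j -` {..<h} \<inter> space M) = 1 - M.prob {e \<in> space M. h \<le> ?X j e}"
      by (simp add: M.prob_compl)
    also have "\<dots> \<le> 1 - p" using p by simp
    also have "\<dots> \<le> exp (- p)" using exp_ge_add_one_self[of "- p"] by simp
    finally show "M.prob (?X j -` {..<h} \<inter> space M) \<le> exp (- p)" .
  qed simp
  also have "\<dots> = exp (- p * real n)" by (simp add: exp_of_nat_mult[symmetric] mult.commute)
  finally show ?thesis .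
qed (simp add: M.prob_space)

text \<open>Markov's inequality, with independence for the mean of the product. At the exponent
  \<open>l / 2\<close> the moment is below 1, so the bound decays exponentially in the number of
  sites.\<close>

lemma prob_slope:
  assumes "0 < b" and "finite I"
  shows "M.prob {e \<in> space M. b \<le> (\<Prod>x\<in>I. rho (\<omega> x e) powr (l / 2))} \<le> F (l / 2) ^ card I / b"
proof -
  let ?X = "\<lambda>x e. rho (\<omega> x e) powr (l / 2)"
  have ind: "M.indep_vars (\<lambda>_. borel) ?X I"
    by (rule M.indep_vars_compose2[OF M.indep_vars_subset[OF indep], where Y = "\<lambda>_ w. rho w powr (l / 2)"]) auto
  have int: "integrable M (?X x)" for x
  proof -
    have "integrable (distr M borel (\<omega> x)) (\<lambda>w. rho w powr (l / 2))"
      using rho_powr_integrable by (simp add: env_distr)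
    then show ?thesis by (subst (asm) integrable_distr_eq) auto
  qed
  have ex: "(\<integral>e. ?X x e \<partial>M) = F (l / 2)" for x
  proof -
    have "F (l / 2) = (\<integral>w. rho w powr (l / 2) \<partial>distr M borel (\<omega> x))" by (simp add: env_distr)
    also have "\<dots> = (\<integral>e. ?X x e \<partial>M)" by (subst integral_distr) auto
    finally show ?thesis by simp
  qed
  have "M.prob {e \<in> space M. b \<le> (\<Prod>x\<in>I. ?X x e)} \<le> (\<integral>e. (\<Prod>x\<in>I. ?X x e) \<partial>M) / b"
    using M.indep_vars_integrable[OF assms(2) ind int] assms(1)
    by (intro integral_Markov_inequality_measure[where A = "space M"]) (auto intro!: prod_nonneg)
  also have "(\<integral>e. (\<Prod>x\<in>I. ?X x e) \<partial>M) = F (l / 2) ^ card I"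
    using M.indep_vars_lebesgue_integral[OF assms(2) ind int] by (simp add: ex)
  finally show ?thesis .
qed

end

section \<open>Lower bounds in a fixed environment\<close>

declare One_nat_def [simp del]

lemma attempt_PiE:
  assumes "\<xi> \<in> I \<rightarrow>\<^sub>E {0, 1}" and "fst a \<in> I" and "fst a + 1 \<in> I"
  shows "attempt a \<xi> \<in> I \<rightarrow>\<^sub>E {0, 1}"
  using swap_sites_PiE[OF assms] assms(1) by (simp add: attempt_def exchange_eq_swap)

text \<open>Signed current of the attempt through its edge: 1, -1, or 0 when nothing moves.\<close>

definition shift :: "nat \<times> bool \<Rightarrow> config \<Rightarrow> real" where
  "shift a \<xi> = real (attempt a \<xi> (fst a + 1)) - real (\<xi> (fst a + 1))"

lemma sum_attempt:
  fixes g :: "nat \<Rightarrow> real"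
  assumes "finite I"
  shows "(\<Sum>w\<in>I. g w * real (attempt a \<xi> w)) = (\<Sum>w\<in>I. g w * real (\<xi> w))
     + ((if fst a + 1 \<in> I then g (fst a + 1) else 0) - (if fst a \<in> I then g (fst a) else 0)) * shift a \<xi>"
proof -
  let ?z = "fst a"
  have "g w * real (attempt a \<xi> w) = g w * real (\<xi> w)
     + (if w = ?z + 1 then g (?z + 1) * shift a \<xi> else 0) - (if w = ?z then g ?z * shift a \<xi> else 0)" for w
    by (auto simp: attempt_def shift_def exchange_def algebra_simps)
  then show ?thesis
    using assms by (simp add: sum.distrib sum_subtractf left_diff_distrib)
qed

lemma sum_tail_attempt:
  assumes "fst a + 1 \<le> m"
  shows "(\<Sum>w=z..m. real (attempt a \<xi> w)) = (\<Sum>w=z..m. real (\<xi> w)) + (if z = fst a + 1 then shift a \<xi> else 0)"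
  using sum_attempt[of "{z..m}" "\<lambda>_. 1" a \<xi>] assms by auto

lemma shift_cases:
  "shift a \<xi> = (if snd a \<and> \<xi> (fst a) = 1 \<and> \<xi> (fst a + 1) = 0 then 1
     else if \<not> snd a \<and> \<xi> (fst a) = 0 \<and> \<xi> (fst a + 1) = 1 then -1 else 0)"
  by (auto simp: shift_def attempt_def exchange_def)

locale sep =
  fixes \<omega> :: "int \<Rightarrow> real" and N k :: nat
  assumes omega: "\<And>x. 1 \<le> x \<Longrightarrow> x \<le> int N \<Longrightarrow> 0 < \<omega> x \<and> \<omega> x < 1"
    and k: "1 \<le> k" "k \<le> N" and N: "2 \<le> N"
begin

definition moves :: "(nat \<times> bool) set" where
  "moves = {1..<N} \<times> UNIV"

lemma clock_bounds: "a \<in> moves \<Longrightarrow> 0 < clock \<omega> a \<and> clock \<omega> a < 1"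
  using omega[of "int (fst a)"] omega[of "int (fst a) + 1"] by (auto simp: clock_def moves_def)

text \<open>The total rate stays 2 below the uniformization constant \<open>2 * real N\<close>, so
  \<open>step\<close> is lazy with probability at least \<open>1 / N\<close>; the Doeblin argument
  relies on this.\<close>

lemma sum_clock: "sum (clock \<omega>) moves \<le> 2 * real N - 2"
proof -
  have "sum (clock \<omega>) moves \<le> (\<Sum>a\<in>moves. 1)"
    using clock_bounds by (intro sum_mono) (auto simp: less_imp_le)
  also have "\<dots> = 2 * real N - 2"
    using N by (simp add: moves_def card_cartesian_product of_nat_diff algebra_simps)
  finally show ?thesis .
qed

sublocale chain: random_mapping moves "clock \<omega>" attempt "Omega N k" "2 * real N"
proof
  fix a \<xi> assume "a \<in> moves" "\<xi> \<in> Omega N k"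
  then show "attempt a \<xi> \<in> Omega N k"
    using exchange_Omega[of \<xi> N k "fst a"] by (auto simp: attempt_def moves_def)
qed (use clock_bounds sum_clock N in \<open>auto simp: less_imp_le moves_def\<close>)

lemma gen_eq:
  assumes "\<xi> \<in> Omega N k"
  shows "chain.gen f \<xi> = (\<Sum>z\<in>{1..<N}. site_rate \<omega> \<xi> z * (f (exchange \<xi> z) - f \<xi>))"
proof -
  have "chain.gen f \<xi> = (\<Sum>z\<in>{1..<N}. \<Sum>d\<in>UNIV. clock \<omega> (z, d) * (f (attempt (z, d) \<xi>) - f \<xi>))"
    unfolding chain.gen_def by (simp add: moves_def sum.cartesian_product)
  also have "\<dots> = (\<Sum>z\<in>{1..<N}. site_rate \<omega> \<xi> z * (f (exchange \<xi> z) - f \<xi>))"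
    using assms by (intro sum.cong refl attempt_gen[of \<xi> "{1..N}"]) (auto simp: Omega_def)
  finally show ?thesis .
qed

lemma sum_generator_pow:
  assumes "\<xi> \<in> Omega N k"
  shows "(\<Sum>\<eta>\<in>Omega N k. generator_pow \<omega> N k n \<xi> \<eta> * f \<eta>) = (chain.gen ^^ n) f \<xi>"
  using assms
proof (induction n arbitrary: \<xi>)
  case 0
  have "(\<Sum>\<eta>\<in>Omega N k. generator_pow \<omega> N k 0 \<xi> \<eta> * f \<eta>) = (\<Sum>\<eta>\<in>Omega N k. if \<xi> = \<eta> then f \<eta> else 0)"
    by (intro sum.cong) auto
  then show ?case using 0 finite_Omega by (simp add: sum.delta)
next
  case (Suc n)
  have "(\<Sum>\<eta>\<in>Omega N k. generator_pow \<omega> N k (Suc n) \<xi> \<eta> * f \<eta>)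
      = (\<Sum>\<eta>\<in>Omega N k. \<Sum>\<zeta>\<in>Omega N k. generator \<omega> N k \<xi> \<zeta> * (generator_pow \<omega> N k n \<zeta> \<eta> * f \<eta>))"
    by (simp add: sum_distrib_right mult.assoc)
  also have "\<dots> = (\<Sum>\<zeta>\<in>Omega N k. \<Sum>\<eta>\<in>Omega N k. generator \<omega> N k \<xi> \<zeta> * (generator_pow \<omega> N k n \<zeta> \<eta> * f \<eta>))"
    by (rule sum.swap)
  also have "\<dots> = (\<Sum>\<zeta>\<in>Omega N k. generator \<omega> N k \<xi> \<zeta> * (chain.gen ^^ n) f \<zeta>)"
    by (intro sum.cong refl) (simp add: sum_distrib_left[symmetric] Suc.IH)
  also have "\<dots> = chain.gen ((chain.gen ^^ n) f) \<xi>"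
    by (simp add: generator_sum gen_eq Suc.prems)
  finally show ?case by simp
qed

text \<open>Links the matrix exponential in the definition of the mixing time to the semigroup on
  functions, which carries all later estimates.\<close>

lemma sum_transition:
  assumes "\<xi> \<in> Omega N k"
  shows "(\<Sum>\<eta>\<in>Omega N k. transition \<omega> N k t \<xi> \<eta> * f \<eta>) = chain.evolve t f \<xi>"
proof -
  have "(\<Sum>\<eta>\<in>Omega N k. transition \<omega> N k t \<xi> \<eta> * f \<eta>)
      = (\<Sum>\<eta>\<in>Omega N k. \<Sum>n. t ^ n / fact n * generator_pow \<omega> N k n \<xi> \<eta> * f \<eta>)"
    unfolding transition_def by (intro sum.cong refl suminf_mult2 summable_generator_pow assms)
  also have "\<dots> = (\<Sum>n. \<Sum>\<eta>\<in>Omega N k. t ^ n / fact n * generator_pow \<omega> N k n \<xi> \<eta> * f \<eta>)"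
    by (intro suminf_sum[symmetric] summable_mult2 summable_generator_pow assms)
  also have "\<dots> = chain.evolve t f \<xi>"
    unfolding chain.evolve_def sum_generator_pow[OF assms, symmetric]
    by (simp add: sum_distrib_left mult.assoc)
  finally show ?thesis .
qed

section \<open>Equilibrium and the distance to it\<close>

abbreviation "\<pi> \<equiv> equilibrium \<omega> N k"
abbreviation "V \<equiv> potential \<omega>"
abbreviation "w \<equiv> gibbs V 0 {1..N}"

definition conf :: "nat set \<Rightarrow> config" where
  "conf B = restrict (\<lambda>x. of_bool (x \<in> B)) {1..N}"

lemma conf_Omega: "B \<subseteq> {1..N} \<Longrightarrow> card B = k \<Longrightarrow> conf B \<in> Omega N k"
proof -
  assume B: "B \<subseteq> {1..N}" "card B = k"
  have "(\<Sum>x=1..N. conf B x) = (\<Sum>x=1..N. of_bool (x \<in> B))"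
    by (intro sum.cong) (auto simp: conf_def)
  also have "\<dots> = card ({1..N} \<inter> B)" by simp
  also have "{1..N} \<inter> B = B" using B by auto
  finally show ?thesis using B by (auto simp: Omega_def conf_def)
qed

lemma Omega_nonempty: "Omega N k \<noteq> {}"
  using conf_Omega[of "{1..k}"] k by auto

lemma Z_pos: "0 < sum w (Omega N k)"
  using Omega_nonempty finite_Omega by (intro sum_pos gibbs_pos)

lemma equilibrium_pos: "0 < \<pi> \<xi>"
  unfolding equilibrium_gibbs by (intro divide_pos_pos gibbs_pos Z_pos)

lemma sum_equilibrium: "(\<Sum>\<xi>\<in>Omega N k. \<pi> \<xi>) = 1"
  unfolding equilibrium_gibbs using Z_pos by (simp add: sum_divide_distrib[symmetric])

lemma equilibrium_stationary: "(\<Sum>\<xi>\<in>Omega N k. \<pi> \<xi> * chain.gen f \<xi>) = 0"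
proof -
  have "(\<Sum>\<xi>\<in>Omega N k. w \<xi> * chain.gen f \<xi>)
      = (\<Sum>\<xi>\<in>Omega N k. \<Sum>z\<in>{1..<N}. w \<xi> * (site_rate \<omega> \<xi> z * (f (exchange \<xi> z) - f \<xi>)))"
    by (simp add: gen_eq sum_distrib_left)
  also have "\<dots> = (\<Sum>z\<in>{1..<N}. \<Sum>\<xi>\<in>Omega N k. w \<xi> * (site_rate \<omega> \<xi> z * (f (exchange \<xi> z) - f \<xi>)))"
    by (rule sum.swap)
  also have "\<dots> = 0"
  proof (rule sum.neutral, rule ballI)
    fix z assume z: "z \<in> {1..<N}"
    show "(\<Sum>\<xi>\<in>Omega N k. w \<xi> * (site_rate \<omega> \<xi> z * (f (exchange \<xi> z) - f \<xi>))) = 0"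
      using z omega[of "int z"] omega[of "int z + 1"] potential_Suc[of z \<omega>]
      by (intro gibbs_detailed_balance finite_Omega exchange_Omega) (auto simp: Omega_def)
  qed
  finally show ?thesis
    by (simp add: equilibrium_gibbs sum_divide_distrib[symmetric])
qed

lemma mix_dist_ge_abs:
  assumes "\<xi> \<in> Omega N k" and "\<And>\<zeta>. \<zeta> \<in> Omega N k \<Longrightarrow> 0 \<le> f \<zeta> \<and> f \<zeta> \<le> 1"
  shows "\<bar>chain.evolve t f \<xi> - (\<Sum>\<zeta>\<in>Omega N k. \<pi> \<zeta> * f \<zeta>)\<bar> \<le> mix_dist \<omega> N k t"
proof -
  let ?p = "transition \<omega> N k t \<xi>"
  have "tv_dist (Omega N k) ?p \<pi> \<le> mix_dist \<omega> N k t"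
    unfolding mix_dist_def using finite_Omega assms(1) by (intro Max_ge) auto
  moreover have "tv_dist (Omega N k) ?p \<pi> = tv_dist (Omega N k) \<pi> ?p"
    by (simp add: tv_dist_def abs_minus_commute)
  moreover note tv_dist_ge[OF finite_Omega, where f = f and p = ?p and q = \<pi> and N1 = N and k1 = k]
    tv_dist_ge[OF finite_Omega, where f = f and q = ?p and p = \<pi> and N1 = N and k1 = k]
  ultimately show ?thesis using assms by (simp add: sum_transition abs_le_iff)
qed

text \<open>Among the \<open>k + 1\<close> rightmost sites one is empty, and moving a particle there from \<open>{1..Y}\<close>
  multiplies the weight by at least \<open>1 / \<delta>\<close>.\<close>

lemma left_mass:
  assumes "Y + k < N"
    and slope: "\<And>u v. u \<in> {1..Y} \<Longrightarrow> v \<in> {N-k..N} \<Longrightarrow> exp (V v - V u) \<le> \<delta>"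
    and "0 \<le> \<delta>"
  shows "(\<Sum>\<xi>\<in>Omega N k. \<pi> \<xi> * of_bool (\<exists>u\<in>{1..Y}. \<xi> u = 1)) \<le> (real N)\<^sup>2 * \<delta>"
proof -
  let ?O = "Omega N k" and ?P = "{1..Y} \<times> {N-k..N}"
  have ex: "\<exists>v\<in>{N-k..N}. \<xi> v = 0" if "\<xi> \<in> ?O" for \<xi>
  proof (rule ccontr)
    assume a: "\<not> ?thesis"
    have "\<xi> v = 1" if "v \<in> {N-k..N}" for v
      using OmegaD[OF \<open>\<xi> \<in> ?O\<close>, of v] a that assms(1) by force
    then have "(\<Sum>v\<in>{N-k..N}. \<xi> v) = k + 1" using assms(1) by simp
    moreover have "(\<Sum>v\<in>{N-k..N}. \<xi> v) \<le> (\<Sum>v\<in>{1..N}. \<xi> v)"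
      using assms(1) by (intro sum_mono2) auto
    ultimately show False using that by (simp add: Omega_def)
  qed
  have "(\<Sum>\<xi>\<in>?O. w \<xi> * of_bool (\<exists>u\<in>{1..Y}. \<xi> u = 1))
      \<le> (\<Sum>\<xi>\<in>?O. \<Sum>(u,v)\<in>?P. if \<xi> u = 1 \<and> \<xi> v = 0 then w \<xi> else 0)"
  proof (rule sum_mono)
    fix \<xi> assume \<xi>: "\<xi> \<in> ?O"
    show "w \<xi> * of_bool (\<exists>u\<in>{1..Y}. \<xi> u = 1) \<le> (\<Sum>(u,v)\<in>?P. if \<xi> u = 1 \<and> \<xi> v = 0 then w \<xi> else 0)"
    proof (cases "\<exists>u\<in>{1..Y}. \<xi> u = 1")
      case True
      then obtain u v where "u \<in> {1..Y}" "\<xi> u = 1" "v \<in> {N-k..N}" "\<xi> v = 0" using ex[OF \<xi>] by auto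
      then show ?thesis
        using member_le_sum[of "(u,v)" ?P "\<lambda>(u,v). if \<xi> u = 1 \<and> \<xi> v = 0 then w \<xi> else 0"] gibbs_pos
        by (auto simp: less_imp_le split: prod.splits)
    next
      case False
      then have "w \<xi> * of_bool (\<exists>u\<in>{1..Y}. \<xi> u = 1) = 0" by auto
      also have "0 \<le> (\<Sum>(u,v)\<in>?P. if \<xi> u = 1 \<and> \<xi> v = 0 then w \<xi> else 0)"
        using gibbs_pos by (intro sum_nonneg) (auto simp: less_imp_le)
      finally show ?thesis .
    qed
  qed
  also have "\<dots> = (\<Sum>(u,v)\<in>?P. \<Sum>\<xi>\<in>?O. if \<xi> u = 1 \<and> \<xi> v = 0 then w \<xi> else 0)"
    by (subst sum.swap) (simp add: case_prod_unfold)
  also have "\<dots> \<le> (\<Sum>(u,v)\<in>?P. \<delta> * sum w ?O)"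
  proof (rule sum_mono, clarify)
    fix u v assume uv: "u \<in> {1..Y}" "v \<in> {N-k..N}"
    have "(\<Sum>\<xi>\<in>?O. if \<xi> u = 1 \<and> \<xi> v = 0 then w \<xi> else 0) = sum w {\<xi> \<in> ?O. \<xi> u = 1 \<and> \<xi> v = 0}"
      using finite_Omega by (rule sum.inter_filter[symmetric])
    also have "\<dots> \<le> \<delta> * sum w ?O"
    proof (rule sum_weight_le_inj[where \<phi> = "\<lambda>\<xi>. swap_sites \<xi> u v"])
      show "(\<lambda>\<xi>. swap_sites \<xi> u v) ` {\<xi> \<in> ?O. \<xi> u = 1 \<and> \<xi> v = 0} \<subseteq> ?O"
        using uv assms(1) by (auto intro!: swap_sites_Omega)
      fix \<xi> assume "\<xi> \<in> {\<xi> \<in> ?O. \<xi> u = 1 \<and> \<xi> v = 0}"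
      then have "w (swap_sites \<xi> u v) = w \<xi> * exp (V u - V v)"
        using uv assms(1) by (intro gibbs_swap) auto
      then have "w \<xi> = exp (V v - V u) * w (swap_sites \<xi> u v)"
        by (simp add: exp_diff)
      also have "\<dots> \<le> \<delta> * w (swap_sites \<xi> u v)"
        using slope[OF uv] gibbs_pos by (intro mult_right_mono) (auto simp: less_imp_le)
      finally show "w \<xi> \<le> \<delta> * w (swap_sites \<xi> u v)" .
    qed (use gibbs_pos assms(3) finite_Omega inj_swap_sites in \<open>auto simp: less_imp_le\<close>)
    finally show "(\<Sum>\<xi>\<in>?O. if \<xi> u = 1 \<and> \<xi> v = 0 then w \<xi> else 0) \<le> \<delta> * sum w ?O" .
  qed
  also have "\<dots> = real (card ?P) * (\<delta> * sum w ?O)" by (simp add: case_prod_unfold)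
  also have "\<dots> \<le> (real N)\<^sup>2 * (\<delta> * sum w ?O)"
  proof (rule mult_right_mono)
    have "card ?P = Y * (k + 1)" using assms(1) by (simp add: card_cartesian_product distrib_left)
    also have "\<dots> \<le> N * N" using assms(1) by (intro mult_le_mono) auto
    finally show "real (card ?P) \<le> (real N)\<^sup>2"
      by (metis of_nat_le_iff of_nat_power power2_eq_square)
    show "0 \<le> \<delta> * sum w ?O" using assms(3) Z_pos by simp
  qed
  finally show ?thesis
    using Z_pos by (simp add: equilibrium_gibbs sum_divide_distrib[symmetric] divide_simps mult_ac)
qed

lemma sum_equilibrium_le:
  assumes "\<And>\<xi>. \<xi> \<in> Omega N k \<Longrightarrow> f \<xi> \<le> g \<xi>"
  shows "(\<Sum>\<xi>\<in>Omega N k. \<pi> \<xi> * f \<xi>) \<le> (\<Sum>\<xi>\<in>Omega N k. \<pi> \<xi> * g \<xi>)"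
  using assms equilibrium_pos by (intro sum_mono mult_left_mono) (auto simp: less_imp_le)

section \<open>Distance bound from the leftmost particle\<close>

lemma mix_dist_ballistic:
  assumes "1 \<le> Y" and "0 \<le> t"
  shows "1 - t / real Y - (\<Sum>\<xi>\<in>Omega N k. \<pi> \<xi> * of_bool (\<exists>u\<in>{1..Y}. \<xi> u = 1)) \<le> mix_dist \<omega> N k t"
proof -
  define lm where "lm = (\<lambda>\<xi>::config. LEAST z. 1 \<le> z \<and> \<xi> z = 1)"
  \<comment> \<open>Falls linearly with the position \<open>lm\<close> of the leftmost particle,
    from 1 at site 1 to 0 beyond \<open>Y\<close>. Only the right-jump clock of that particle can
    lower it, by at most \<open>1 / Y\<close>; all other attempts keep it or raise it.\<close>
  define g where "g = (\<lambda>\<xi>. max 0 (1 - (real (lm \<xi>) - 1) / real Y))"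
  have lm: "1 \<le> lm \<xi>" "\<xi> (lm \<xi>) = 1" "lm \<xi> \<le> N" if "\<xi> \<in> Omega N k" for \<xi>
  proof -
    have "\<exists>z\<in>{1..N}. \<xi> z = 1"
    proof (rule ccontr)
      assume "\<not> ?thesis"
      then have "(\<Sum>x=1..N. \<xi> x) = 0" using OmegaD[OF that] by (intro sum.neutral) blast
      then show False using that k by (simp add: Omega_def)
    qed
    then obtain z where z: "1 \<le> z" "z \<le> N" "\<xi> z = 1" by auto
    show "1 \<le> lm \<xi>" "\<xi> (lm \<xi>) = 1" using LeastI[of "\<lambda>z. 1 \<le> z \<and> \<xi> z = 1" z] z unfolding lm_def by auto
    show "lm \<xi> \<le> N" using Least_le[of "\<lambda>z. 1 \<le> z \<and> \<xi> z = 1" z] z unfolding lm_def by auto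
  qed
  have lm_le: "lm \<xi> \<le> z" if "1 \<le> z" "\<xi> z = 1" for \<xi> z
    unfolding lm_def using that by (intro Least_le) auto
  have g01: "0 \<le> g \<xi> \<and> g \<xi> \<le> 1" if "\<xi> \<in> Omega N k" for \<xi>
    using lm[OF that] by (auto simp: g_def)
  have lm_move: "lm (attempt a \<xi>) \<le> lm \<xi> + (if a = (lm \<xi>, True) then 1 else 0)"
    if "\<xi> \<in> Omega N k" "a \<in> moves" for \<xi> a
  proof -
    obtain z d where a: "a = (z, d)" "1 \<le> z" "z < N" using \<open>a \<in> moves\<close> by (auto simp: moves_def)
    note l = lm[OF that(1)]
    have "attempt a \<xi> (lm \<xi>) = 1 \<or> d \<and> z = lm \<xi> \<and> \<xi> (z + 1) = 0 \<or> \<not> d \<and> z + 1 = lm \<xi> \<and> \<xi> z = 0"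
      using l a by (cases d) (auto simp: attempt_def exchange_def)
    then consider "attempt a \<xi> (lm \<xi>) = 1" | "d" "z = lm \<xi>" "\<xi> (z + 1) = 0"
      | "\<not> d" "z + 1 = lm \<xi>" "\<xi> z = 0" by metis
    then show ?thesis
    proof cases
      case 1
      then show ?thesis using lm_le[of "lm \<xi>" "attempt a \<xi>"] l by simp
    next
      case 2
      then have "attempt a \<xi> (z + 1) = 1" using l a by (simp add: attempt_def exchange_def)
      then show ?thesis using lm_le[of "z + 1" "attempt a \<xi>"] 2 a by simp
    next
      case 3
      then have "attempt a \<xi> z = 1" using l a by (simp add: attempt_def exchange_def)
      then show ?thesis using lm_le[of "z" "attempt a \<xi>"] 3 a by simp
    qed
  qed
  have gen: "- (1 / real Y) \<le> chain.gen g \<xi>" if "\<xi> \<in> Omega N k" for \<xi>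
  proof -
    have "- (1 / real Y) \<le> (\<Sum>a\<in>moves. if a = (lm \<xi>, True) then clock \<omega> a * (- (1 / real Y)) else 0)"
    proof (cases "(lm \<xi>, True) \<in> moves")
      case True
      have "clock \<omega> (lm \<xi>, True) * (1 / real Y) \<le> 1 * (1 / real Y)"
        using clock_bounds[OF True] by (intro mult_right_mono) auto
      then show ?thesis using True chain.finite_A by (simp add: sum.delta)
    next
      case False
      then show ?thesis using chain.finite_A by (simp add: sum.delta)
    qed
    also have "\<dots> \<le> chain.gen g \<xi>"
      unfolding chain.gen_def
    proof (rule sum_mono)
      fix a assume a: "a \<in> moves"
      define e where "e = (if a = (lm \<xi>, True) then 1 / real Y else 0)"
      have "real (lm (attempt a \<xi>)) - 1 \<le> (real (lm \<xi>) - 1) + (if a = (lm \<xi>, True) then 1 else 0)"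
        using lm_move[OF that a] by (auto split: if_splits)
      then have "(real (lm (attempt a \<xi>)) - 1) / real Y
          \<le> ((real (lm \<xi>) - 1) + (if a = (lm \<xi>, True) then 1 else 0)) / real Y"
        by (intro divide_right_mono) auto
      also have "\<dots> = (real (lm \<xi>) - 1) / real Y + e"
        by (simp add: e_def add_divide_distrib)
      finally have "- e \<le> g (attempt a \<xi>) - g \<xi>"
      proof -
        have "0 \<le> e" by (simp add: e_def)
        then show "- e \<le> g (attempt a \<xi>) - g \<xi>"
          if "(real (lm (attempt a \<xi>)) - 1) / real Y \<le> (real (lm \<xi>) - 1) / real Y + e"
          using that unfolding g_def by linarith
      qed
      then have "- (if a = (lm \<xi>, True) then 1 / real Y else 0) \<le> g (attempt a \<xi>) - g \<xi>"
        by (simp only: e_def)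
      then have "clock \<omega> a * - (if a = (lm \<xi>, True) then 1 / real Y else 0) \<le> clock \<omega> a * (g (attempt a \<xi>) - g \<xi>)"
        using clock_bounds[OF a] by (intro mult_left_mono) auto
      then show "(if a = (lm \<xi>, True) then clock \<omega> a * (- (1 / real Y)) else 0)
          \<le> clock \<omega> a * (g (attempt a \<xi>) - g \<xi>)"
        by (auto split: if_splits)
    qed
    finally show ?thesis .
  qed
  let ?\<xi> = "conf {1..k}"
  have \<xi>: "?\<xi> \<in> Omega N k" using k by (intro conf_Omega) auto
  have "?\<xi> 1 = 1" using k by (simp add: conf_def)
  then have "lm ?\<xi> = 1" using lm_le[of 1 ?\<xi>] lm(1)[OF \<xi>] by simp
  then have g1: "g ?\<xi> = 1" by (simp add: g_def)
  have "1 - (1 / real Y) * t \<le> chain.evolve t g ?\<xi>"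
    using chain.stepn_drift_lower[of "1 / real Y" g, OF gen \<xi>] g1 g01 \<xi> assms(2)
    by (intro chain.evolve_lower[where B = 1]) auto
  moreover have "(\<Sum>\<xi>\<in>Omega N k. \<pi> \<xi> * g \<xi>)
      \<le> (\<Sum>\<xi>\<in>Omega N k. \<pi> \<xi> * of_bool (\<exists>u\<in>{1..Y}. \<xi> u = 1))"
  proof (rule sum_equilibrium_le)
    fix \<xi> assume \<xi>: "\<xi> \<in> Omega N k"
    have "g \<xi> = 0" if "Y < lm \<xi>"
    proof -
      have "real Y \<le> real (lm \<xi>) - 1" using that by linarith
      then show ?thesis using assms(1) by (simp add: g_def divide_simps)
    qed
    then show "g \<xi> \<le> of_bool (\<exists>u\<in>{1..Y}. \<xi> u = 1)"
      using lm[OF \<xi>] g01[OF \<xi>] by (cases "lm \<xi> \<le> Y") auto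
  qed
  ultimately show ?thesis using mix_dist_ge_abs[where f = g and t = t, OF \<xi> g01] by (simp add: abs_le_iff)
qed

section \<open>Distance bound from escape over the barrier\<close>

lemma mix_dist_barrier:
  assumes "1 \<le> x" and "x < y" and "y < N" and "0 \<le> t"
  defines "p \<equiv> (\<Sum>\<xi>\<in>Omega N k. \<pi> \<xi> * of_bool (\<exists>u\<in>{1..y}. \<xi> u = 1))"
  shows "1 - t * exp (V x - V y) - p \<le> mix_dist \<omega> N k t"
proof (rule ccontr)
  \<comment> \<open>Were the distance smaller, every state of \<open>D\<close> would have escaped by
    time \<open>t\<close> with probability above \<open>t * ?h\<close>, whereas the average over
    \<open>D\<close> is at most that. No particular bad state has to be exhibited.\<close>
  assume neg: "\<not> ?thesis"
  let ?O = "Omega N k" and ?h = "exp (V x - V y)"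
  define D where "D = {\<xi> \<in> ?O. \<exists>u\<in>{1..y}. \<xi> u = 1}"
  \<comment> \<open>The exit boundary of \<open>D\<close>: the only particle left in
    \<open>{1..y}\<close> stands at \<open>y\<close>.\<close>
  define E where "E = {\<xi> \<in> ?O. \<xi> y = 1 \<and> (\<forall>u\<in>{1..<y}. \<xi> u = 0)}"
  define f where "f = (\<lambda>\<xi>::config. of_bool (\<not> (\<exists>u\<in>{1..y}. \<xi> u = 1)) :: real)"
  define b where "b = (\<lambda>\<xi>::config. of_bool (\<xi> \<in> E) :: real)"
  have D: "D \<subseteq> ?O" by (auto simp: D_def)
  have p: "p = sum \<pi> D"
    unfolding p_def D_def using finite_Omega by (simp add: sum.inter_filter of_bool_def if_distrib cong: if_cong)
  have pos: "0 < p"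
  proof -
    have "conf {1..k} \<in> D" using k assms conf_Omega[of "{1..k}"]
      by (auto simp: D_def conf_def intro!: bexI[of _ 1])
    then show ?thesis unfolding p
      using D finite_Omega equilibrium_pos by (intro sum_pos) (auto intro: finite_subset)
  qed
  have fm: "chain.gen f \<xi> \<le> b \<xi>" if \<xi>: "\<xi> \<in> ?O" for \<xi>
  proof -
    have "chain.gen f \<xi> \<le> (\<Sum>a\<in>moves. if a = (y, True) then clock \<omega> a * b \<xi> else 0)"
      unfolding chain.gen_def
    proof (rule sum_mono)
      fix a assume a: "a \<in> moves"
      have "f (attempt a \<xi>) - f \<xi> \<le> (if a = (y, True) then b \<xi> else 0)"
      proof (cases "f (attempt a \<xi>) - f \<xi> \<le> 0")
        case False
        then obtain u where u: "u \<in> {1..y}" "\<xi> u = 1" and no: "\<And>v. v \<in> {1..y} \<Longrightarrow> attempt a \<xi> v \<noteq> 1"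
          by (auto simp: f_def split: if_splits)
        obtain z d where zd: "a = (z, d)" "1 \<le> z" "z < N" using a by (auto simp: moves_def)
        have *: "u' = y \<and> z = y \<and> d" if "u' \<in> {1..y}" "\<xi> u' = 1" for u'
          using no[of u'] no[of "u' + 1"] no[of "u' - 1"] that zd
          by (cases d; cases "z + 1 \<le> y") (auto simp: attempt_def exchange_def split: if_splits)
        have "\<xi> u' = 0" if "u' \<in> {1..<y}" for u'
          using *[of u'] that OmegaD[OF \<xi>, of u'] assms by auto
        then have "\<xi> \<in> E" using *[OF u] u \<xi> by (auto simp: E_def)
        then show ?thesis using *[OF u] zd by (simp add: b_def f_def)
      qed (auto simp: b_def)
      then have "clock \<omega> a * (f (attempt a \<xi>) - f \<xi>) \<le> clock \<omega> a * (if a = (y, True) then b \<xi> else 0)"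
        using clock_bounds[OF a] by (intro mult_left_mono) auto
      then show "clock \<omega> a * (f (attempt a \<xi>) - f \<xi>) \<le> (if a = (y, True) then clock \<omega> a * b \<xi> else 0)"
        by (auto split: if_splits)
    qed
    also have "\<dots> = (if (y, True) \<in> moves then clock \<omega> (y, True) * b \<xi> else 0)"
      using chain.finite_A by (simp add: sum.delta)
    also have "\<dots> \<le> 1 * b \<xi>"
      using clock_bounds[of "(y, True)"] by (auto simp: b_def intro!: mult_right_mono)
    finally show ?thesis by simp
  qed
  have pb: "(\<Sum>\<xi>\<in>?O. \<pi> \<xi> * b \<xi>) \<le> ?h * p"
  proof -
    have "(\<Sum>\<xi>\<in>?O. \<pi> \<xi> * b \<xi>) = sum \<pi> {\<xi> \<in> ?O. \<xi> \<in> E}"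
      unfolding b_def using finite_Omega by (simp add: sum.inter_filter of_bool_def if_distrib cong: if_cong)
    also have "{\<xi> \<in> ?O. \<xi> \<in> E} = E" by (auto simp: E_def)
    \<comment> \<open>Moving that particle from \<open>y\<close> back to \<open>x\<close> stays
      inside \<open>D\<close> and gains the height of the barrier.\<close>
    also have "sum \<pi> E \<le> ?h * sum \<pi> D"
    proof (rule sum_weight_le_inj[where \<phi> = "\<lambda>\<xi>. swap_sites \<xi> y x"])
      show "finite D" using D finite_Omega by (rule finite_subset)
      show "(\<lambda>\<xi>. swap_sites \<xi> y x) ` E \<subseteq> D"
      proof clarify
        fix \<xi> assume "\<xi> \<in> E"
        then show "swap_sites \<xi> y x \<in> D"
          using assms by (auto simp: E_def D_def swap_sites_apply intro!: swap_sites_Omega bexI[of _ x])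
      qed
      fix \<xi> assume "\<xi> \<in> E"
      then have "w (swap_sites \<xi> y x) = w \<xi> * exp (V y - V x)"
        using assms by (intro gibbs_swap) (auto simp: E_def)
      then have "w \<xi> = ?h * w (swap_sites \<xi> y x)"
        by (simp add: exp_diff)
      then show "\<pi> \<xi> \<le> ?h * \<pi> (swap_sites \<xi> y x)"
        unfolding equilibrium_gibbs by simp
    qed (use equilibrium_pos inj_swap_sites in \<open>auto simp: less_imp_le\<close>)
    finally show ?thesis by (simp add: p)
  qed
  have b0: "0 \<le> (chain.step ^^ m) b \<xi>" if "\<xi> \<in> ?O" for m \<xi>
    using chain.stepn_mono[of "\<lambda>_. 0" b \<xi> m] that by (simp add: chain.stepn_const b_def)
  have up: "(\<Sum>\<xi>\<in>D. \<pi> \<xi> * (chain.step ^^ n) f \<xi>) \<le> 0 + ?h * p * real n / (2 * real N)" for n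
  proof -
    have "(\<Sum>\<xi>\<in>D. \<pi> \<xi> * (chain.step ^^ n) f \<xi>)
        \<le> (\<Sum>\<xi>\<in>D. \<pi> \<xi> * ((\<Sum>m<n. (chain.step ^^ m) b \<xi>) / (2 * real N)))"
    proof (intro sum_mono mult_left_mono)
      fix \<xi> assume \<xi>: "\<xi> \<in> D"
      have "f \<xi> = 0" using \<xi> by (auto simp: D_def f_def)
      then show "(chain.step ^^ n) f \<xi> \<le> (\<Sum>m<n. (chain.step ^^ m) b \<xi>) / (2 * real N)"
        using chain.stepn_drift_upper[of f b \<xi> n, OF fm] \<xi> D by auto
    qed (use equilibrium_pos in \<open>auto simp: less_imp_le\<close>)
    \<comment> \<open>Enlarging \<open>D\<close> to the whole state space makes the initial weight
      stationary, so each of the \<open>n\<close> terms becomes the equilibrium mass of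
      \<open>E\<close>.\<close>
    also have "\<dots> \<le> (\<Sum>\<xi>\<in>?O. \<pi> \<xi> * ((\<Sum>m<n. (chain.step ^^ m) b \<xi>) / (2 * real N)))"
      using D b0 equilibrium_pos N finite_Omega
      by (intro sum_mono2) (auto intro!: divide_nonneg_nonneg mult_nonneg_nonneg sum_nonneg simp: less_imp_le)
    also have "\<dots> = (\<Sum>m<n. \<Sum>\<xi>\<in>?O. \<pi> \<xi> * (chain.step ^^ m) b \<xi>) / (2 * real N)"
      by (subst sum.swap) (simp add: sum_distrib_left sum_divide_distrib)
    also have "\<dots> = real n * (\<Sum>\<xi>\<in>?O. \<pi> \<xi> * b \<xi>) / (2 * real N)"
      by (simp add: chain.stationary_stepn[OF equilibrium_stationary])
    also have "\<dots> \<le> real n * (?h * p) / (2 * real N)"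
      using pb N by (intro divide_right_mono mult_left_mono) auto
    finally show ?thesis by (simp add: mult_ac)
  qed
  have f01: "0 \<le> f \<xi> \<and> f \<xi> \<le> 1" for \<xi> by (simp add: f_def)
  have "(\<Sum>\<xi>\<in>D. \<pi> \<xi> * chain.evolve t f \<xi>) \<le> 0 + ?h * p * t"
    using D assms(4) up f01 by (intro chain.evolve_sum_upper[where B = 1]) auto
  moreover have "(\<Sum>\<xi>\<in>D. \<pi> \<xi> * (t * ?h)) < (\<Sum>\<xi>\<in>D. \<pi> \<xi> * chain.evolve t f \<xi>)"
  proof (rule sum_strict_mono)
    show "finite D" using D finite_Omega by (rule finite_subset)
    show "D \<noteq> {}" using pos p by auto
    fix \<xi> assume "\<xi> \<in> D"
    then have "\<bar>chain.evolve t f \<xi> - (\<Sum>\<zeta>\<in>?O. \<pi> \<zeta> * f \<zeta>)\<bar> \<le> mix_dist \<omega> N k t"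
      using D f01 by (intro mix_dist_ge_abs) auto
    moreover have "(\<Sum>\<zeta>\<in>?O. \<pi> \<zeta> * f \<zeta>) = 1 - p"
    proof -
      have "(\<Sum>\<zeta>\<in>?O. \<pi> \<zeta> * f \<zeta>) + p = (\<Sum>\<zeta>\<in>?O. \<pi> \<zeta>)"
        unfolding p_def sum.distrib[symmetric] by (intro sum.cong) (auto simp: f_def)
      then show ?thesis using sum_equilibrium by simp
    qed
    ultimately have "t * ?h < chain.evolve t f \<xi>" using neg by (simp add: abs_le_iff)
    then show "\<pi> \<xi> * (t * ?h) < \<pi> \<xi> * chain.evolve t f \<xi>"
      using equilibrium_pos by (intro mult_strict_left_mono)
  qed
  moreover have "(\<Sum>\<xi>\<in>D. \<pi> \<xi> * (t * ?h)) = ?h * p * t"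
    by (simp add: p sum_distrib_right[symmetric])
  ultimately show False by simp
qed

section \<open>Current across the barrier, by coupling with a closed segment\<close>

context
  fixes x y :: nat
  assumes xy: "1 \<le> x" "x < y" "y < N"
begin

definition segment :: "config set" where
  "segment = {x..y} \<rightarrow>\<^sub>E {0, 1}"

text \<open>Clocks of edges outside the segment do nothing, so that both coordinates of the pair
  have the same index set and rates.\<close>

definition seg_move :: "nat \<times> bool \<Rightarrow> config \<Rightarrow> config" where
  "seg_move a \<eta> = (if x \<le> fst a \<and> fst a < y then attempt a \<eta> else \<eta>)"

definition pair_move :: "nat \<times> bool \<Rightarrow> config \<times> config \<Rightarrow> config \<times> config" where
  "pair_move a s = (attempt a (fst s), seg_move a (snd s))"

lemma segmentD: "\<eta> \<in> segment \<Longrightarrow> z \<in> {x..y} \<Longrightarrow> \<eta> z = 0 \<or> \<eta> z = 1"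
  by (auto simp: segment_def)

lemma finite_segment: "finite segment"
  by (simp add: segment_def finite_PiE)

lemma seg_move_closed: "\<eta> \<in> segment \<Longrightarrow> seg_move a \<eta> \<in> segment"
  by (simp add: seg_move_def segment_def attempt_PiE del: PiE_iff)

lemma seg_mapping: "random_mapping moves (clock \<omega>) seg_move segment (2 * real N)"
  by unfold_locales (use chain.finite_A chain.r_nonneg chain.r_sum chain.c_pos seg_move_closed in auto)

interpretation seg: random_mapping moves "clock \<omega>" seg_move segment "2 * real N"
  by (rule seg_mapping)

lemma pair_mapping: "random_mapping moves (clock \<omega>) pair_move (Omega N k \<times> segment) (2 * real N)"
  by unfold_locales
    (use chain.finite_A chain.r_nonneg chain.r_sum chain.c_pos chain.T_closed seg_move_closed in
      \<open>auto simp: pair_move_def\<close>)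

interpretation pair: random_mapping moves "clock \<omega>" pair_move "Omega N k \<times> segment" "2 * real N"
  by (rule pair_mapping)

definition fermi :: real where
  "fermi = (V x + V y) / 2"

abbreviation "v \<equiv> gibbs V fermi {x..y}"

lemma segment_stationary: "(\<Sum>\<eta>\<in>segment. v \<eta> * seg.gen F \<eta>) = 0"
proof -
  have gen: "seg.gen F \<eta> = (\<Sum>z\<in>{1..<N}. if x \<le> z \<and> z < y then site_rate \<omega> \<eta> z * (F (exchange \<eta> z) - F \<eta>) else 0)"
    if "\<eta> \<in> segment" for \<eta>
  proof -
    have "seg.gen F \<eta> = (\<Sum>z\<in>{1..<N}. \<Sum>d\<in>UNIV. clock \<omega> (z, d) * (F (seg_move (z, d) \<eta>) - F \<eta>))"
      unfolding seg.gen_def by (simp add: moves_def sum.cartesian_product)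
    also have "\<dots> = (\<Sum>z\<in>{1..<N}. if x \<le> z \<and> z < y then site_rate \<omega> \<eta> z * (F (exchange \<eta> z) - F \<eta>) else 0)"
    proof (intro sum.cong refl)
      fix z assume "z \<in> {1..<N}"
      show "(\<Sum>d\<in>UNIV. clock \<omega> (z, d) * (F (seg_move (z, d) \<eta>) - F \<eta>))
        = (if x \<le> z \<and> z < y then site_rate \<omega> \<eta> z * (F (exchange \<eta> z) - F \<eta>) else 0)"
      proof (cases "x \<le> z \<and> z < y")
        case True
        then show ?thesis using attempt_gen[of \<eta> "{x..y}" z \<omega> F] that
          by (simp add: seg_move_def segment_def)
      next
        case False
        then have "seg_move (z, d) \<eta> = \<eta>" for d by (auto simp: seg_move_def)
        then show ?thesis using False by auto
      qed
    qed
    finally show ?thesis .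
  qed
  have "(\<Sum>\<eta>\<in>segment. v \<eta> * seg.gen F \<eta>) = (\<Sum>\<eta>\<in>segment. \<Sum>z\<in>{1..<N}.
      if x \<le> z \<and> z < y then v \<eta> * (site_rate \<omega> \<eta> z * (F (exchange \<eta> z) - F \<eta>)) else 0)"
    by (simp add: gen sum_distrib_left if_distrib cong: if_cong)
  also have "\<dots> = (\<Sum>z\<in>{1..<N}. \<Sum>\<eta>\<in>segment.
      if x \<le> z \<and> z < y then v \<eta> * (site_rate \<omega> \<eta> z * (F (exchange \<eta> z) - F \<eta>)) else 0)"
    by (rule sum.swap)
  also have "\<dots> = 0"
  proof (rule sum.neutral, rule ballI)
    fix z assume z: "z \<in> {1..<N}"
    show "(\<Sum>\<eta>\<in>segment. if x \<le> z \<and> z < y then v \<eta> * (site_rate \<omega> \<eta> z * (F (exchange \<eta> z) - F \<eta>)) else 0) = 0"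
    proof (cases "x \<le> z \<and> z < y")
      case True
      have "(\<Sum>\<eta>\<in>segment. v \<eta> * (site_rate \<omega> \<eta> z * (F (exchange \<eta> z) - F \<eta>))) = 0"
      proof (rule gibbs_detailed_balance[OF finite_segment])
        show "exchange \<eta> z \<in> segment" if "\<eta> \<in> segment" for \<eta>
          using that True swap_sites_PiE[of \<eta> "{x..y}" z "z + 1"] by (simp add: segment_def exchange_eq_swap)
      qed (use True z omega[of "int z"] omega[of "int z + 1"] potential_Suc[of z \<omega>] in \<open>auto simp: segment_def\<close>)
      then show ?thesis using True by simp
    qed auto
  qed
  finally show ?thesis .
qed

text \<open>The joint process uses the same clocks for both coordinates. The height difference below only
  grows when a particle enters at \<open>x\<close> while \<open>\<eta> x = 0\<close>, or leaves at \<open>y\<close> while \<open>\<eta> y = 1\<close>.\<close>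

definition height :: "config \<times> config \<Rightarrow> nat \<Rightarrow> real" where
  "height s z = (\<Sum>u=z..N. real (fst s u)) - (\<Sum>u=z..y. real (snd s u))"

text \<open>At \<open>z = y + 1\<close> the height is the number of particles to the right of
  \<open>y\<close>, the quantity to be controlled. The maximum over all \<open>z\<close> is taken
  because it, unlike a single height, cannot grow through moves inside the segment.\<close>

definition max_height :: "config \<times> config \<Rightarrow> real" where
  "max_height s = Max (height s ` {x..y+1})"

definition defect :: "config \<Rightarrow> real" where
  "defect \<eta> = of_bool (\<eta> x = 0) + of_bool (\<eta> y = 1)"

lemma height_le_max: "z \<in> {x..y+1} \<Longrightarrow> height s z \<le> max_height s"
  by (simp add: max_height_def)

lemma height_step:
  assumes "z \<in> {x..y}"
  shows "height s z = height s (z + 1) + (real (fst s z) - real (snd s z))"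
  using assms xy by (simp add: height_def sum.atLeast_Suc_atMost[of z] del: Suc_eq_plus1 flip: Suc_eq_plus1)

lemma height_move:
  assumes "a \<in> moves"
  shows "height (pair_move a s) z = height s z + (if z = fst a + 1 then shift a (fst s)
    - (if x \<le> fst a \<and> fst a < y then shift a (snd s) else 0) else 0)"
proof -
  have 1: "(\<Sum>u=z..N. real (attempt a (fst s) u)) = (\<Sum>u=z..N. real (fst s u)) + (if z = fst a + 1 then shift a (fst s) else 0)"
    using assms by (intro sum_tail_attempt) (auto simp: moves_def)
  have 2: "(\<Sum>u=z..y. real (seg_move a (snd s) u)) = (\<Sum>u=z..y. real (snd s u))
      + (if z = fst a + 1 \<and> x \<le> fst a \<and> fst a < y then shift a (snd s) else 0)"
    by (auto simp: seg_move_def sum_tail_attempt)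
  show ?thesis using 1 2 by (simp add: height_def pair_move_def)
qed

text \<open>An attempt changes the height only just right of its edge. If it raises that height and
  no defect is present, the occupation numbers show that a neighbouring height was already larger by
  one, so the maximum does not grow.\<close>

lemma max_height_move:
  assumes "s \<in> Omega N k \<times> segment" and "a \<in> moves"
  shows "max_height (pair_move a s) \<le> max_height s
    + (of_bool (a = (x - 1, True)) * of_bool (snd s x = 0) + of_bool (a = (y, True)) * of_bool (snd s y = 1))"
proof -
  obtain \<xi> \<eta> where s: "s = (\<xi>, \<eta>)" "\<xi> \<in> Omega N k" "\<eta> \<in> segment" using assms(1) by auto
  obtain z0 d where a: "a = (z0, d)" "1 \<le> z0" "z0 < N" using assms(2) by (auto simp: moves_def)
  define b where "b = of_bool (a = (x - 1, True)) * of_bool (\<eta> x = 0) + of_bool (a = (y, True)) * (of_bool (\<eta> y = 1) :: real)"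
  have b0: "0 \<le> b" by (simp add: b_def)
  have bx: "1 \<le> b" if "a = (x - 1, True)" "\<eta> x = 0" using that by (simp add: b_def)
  have b_y: "1 \<le> b" if "a = (y, True)" "\<eta> y = 1" using that by (simp add: b_def)
  have "height (pair_move a s) z \<le> max_height s + b" if z: "z \<in> {x..y+1}" for z
  proof (cases "z = z0 + 1")
    case False
    then have "height (pair_move a s) z = height s z" using height_move[OF assms(2), of s z] a by simp
    then show ?thesis using height_le_max[OF z, of s] b0 by linarith
  next
    case True
    note hm = height_move[OF assms(2), of s z]
    have hz: "height s z \<le> max_height s" by (rule height_le_max[OF z])
    have \<xi>0: "\<xi> z0 = 0 \<or> \<xi> z0 = 1" and \<xi>1: "\<xi> (z0 + 1) = 0 \<or> \<xi> (z0 + 1) = 1"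
      using OmegaD[OF s(2)] a by auto
    \<comment> \<open>Entry at \<open>x\<close>, exit at \<open>y\<close>, or an edge inside the
      segment, where both coordinates answer to the same clock and therefore never move in opposite
      directions.\<close>
    consider "z0 + 1 = x" | "z0 = y" | "x \<le> z0" "z0 < y" using True z by force
    then show ?thesis
    proof cases
      case 1
      have "height s x = height s (x + 1) + (real (\<xi> x) - real (\<eta> x))"
        using height_step[of x s] xy s by simp
      moreover have "height s (x + 1) \<le> max_height s" using xy by (intro height_le_max) auto
      moreover have "\<eta> x = 0 \<or> \<eta> x = 1" using segmentD[OF s(3), of x] xy by simp
      moreover have "height (pair_move a s) z = height s x + shift a \<xi>"
        using hm 1 True a s by simp
      moreover have "shift a \<xi> \<le> 0 \<or> a = (x - 1, True) \<and> \<xi> x = 0 \<and> shift a \<xi> = 1"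
        using 1 a by (auto simp: shift_cases)
      ultimately show ?thesis
        using hz 1 True b0 bx by (elim disjE conjE) simp_all
    next
      case 2
      have "height s y = height s (y + 1) + (real (\<xi> y) - real (\<eta> y))"
        using height_step[of y s] xy s by simp
      moreover have "height s y \<le> max_height s" using xy by (intro height_le_max) auto
      moreover have "\<eta> y = 0 \<or> \<eta> y = 1" using segmentD[OF s(3), of y] xy by simp
      moreover have "height (pair_move a s) z = height s (y + 1) + shift a \<xi>"
        using hm 2 True a s by simp
      moreover have "shift a \<xi> \<le> 0 \<or> a = (y, True) \<and> \<xi> y = 1 \<and> shift a \<xi> = 1"
        using 2 a by (auto simp: shift_cases)
      ultimately show ?thesis
        using hz 2 True b0 b_y by (elim disjE conjE) simp_all
    next
      case 3
      have 1: "height s z0 = height s (z0 + 1) + (real (\<xi> z0) - real (\<eta> z0))"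
        using height_step[of z0 s] 3 s by simp
      have 2: "height s (z0 + 1) = height s (z0 + 1 + 1) + (real (\<xi> (z0 + 1)) - real (\<eta> (z0 + 1)))"
        using height_step[of "z0 + 1" s] 3 s by simp
      have 3: "height s z0 \<le> max_height s" "height s (z0 + 1 + 1) \<le> max_height s"
        using 3 by (auto intro!: height_le_max)
      have 4: "\<eta> z0 = 0 \<or> \<eta> z0 = 1" "\<eta> (z0 + 1) = 0 \<or> \<eta> (z0 + 1) = 1"
        using segmentD[OF s(3)] \<open>x \<le> z0\<close> \<open>z0 < y\<close> by auto
      have 5: "height (pair_move a s) z = height s (z0 + 1) + (shift a \<xi> - shift a \<eta>)"
        using hm True a s \<open>x \<le> z0\<close> \<open>z0 < y\<close> by simp
      have 6: "height s (z0 + 1) \<le> max_height s" using hz True by simp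
      have "height (pair_move a s) z \<le> max_height s"
        unfolding 5 using 1 2 3 4 6 \<xi>0 \<xi>1 a(1)
        by (cases d; elim disjE) (simp_all add: shift_cases)
      then show ?thesis using b0 by linarith
    qed
  qed
  then have "max_height (pair_move a s) \<le> max_height s + b"
    unfolding max_height_def[of "pair_move a s"] using xy by (intro Max.boundedI) auto
  then show ?thesis by (simp add: s b_def)
qed

lemma max_height_gen:
  assumes "s \<in> Omega N k \<times> segment"
  shows "pair.gen max_height s \<le> defect (snd s)"
proof -
  let ?p = "of_bool (snd s x = 0) :: real" and ?q = "of_bool (snd s y = 1) :: real"
  \<comment> \<open>The attempt \<open>a0\<close> need not be in \<open>moves\<close>: for
    \<open>x = 1\<close> there is no edge to the left of the segment, and the sum is 0.\<close>
  have le1: "(\<Sum>a\<in>moves. if a = a0 then clock \<omega> a * u else 0) \<le> u" if "0 \<le> u" for a0 u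
  proof -
    have "(\<Sum>a\<in>moves. if a = a0 then clock \<omega> a * u else 0) = (if a0 \<in> moves then clock \<omega> a0 * u else 0)"
      using chain.finite_A by (simp add: sum.delta)
    also have "\<dots> \<le> 1 * u"
      using clock_bounds[of a0] that mult_right_mono[of "clock \<omega> a0" 1 u] by auto
    finally show ?thesis by simp
  qed
  have "pair.gen max_height s \<le> (\<Sum>a\<in>moves. (if a = (x - 1, True) then clock \<omega> a * ?p else 0)
      + (if a = (y, True) then clock \<omega> a * ?q else 0))"
    unfolding pair.gen_def
  proof (rule sum_mono)
    fix a assume a: "a \<in> moves"
    have "clock \<omega> a * (max_height (pair_move a s) - max_height s)
        \<le> clock \<omega> a * (of_bool (a = (x - 1, True)) * ?p + of_bool (a = (y, True)) * ?q)"
      using max_height_move[OF assms a] clock_bounds[OF a] by (intro mult_left_mono) auto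
    also have "\<dots> = (if a = (x - 1, True) then clock \<omega> a * ?p else 0) + (if a = (y, True) then clock \<omega> a * ?q else 0)"
      unfolding distrib_left by (intro arg_cong2[of _ _ _ _ "(+)"]) simp_all
    finally show "clock \<omega> a * (max_height (pair_move a s) - max_height s)
        \<le> (if a = (x - 1, True) then clock \<omega> a * ?p else 0) + (if a = (y, True) then clock \<omega> a * ?q else 0)" .
  qed
  also have "\<dots> \<le> ?p + ?q"
    unfolding sum.distrib by (intro add_mono le1) auto
  finally show ?thesis by (simp add: defect_def)
qed

text \<open>Filling \<open>x\<close> and emptying \<open>y\<close> multiply the weight by
  \<open>exp (fermi - V x)\<close> and \<open>exp (V y - fermi)\<close>. The midpoint makes both
  equal to \<open>exp ((V y - V x) / 2)\<close>.\<close>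

lemma sum_defect:
  "(\<Sum>\<eta>\<in>segment. v \<eta> * defect \<eta>) \<le> 2 * exp ((V x - V y) / 2) * sum v segment"
proof -
  let ?h = "exp ((V x - V y) / 2)"
  have "(\<Sum>\<eta>\<in>segment. v \<eta> * of_bool (\<eta> x = 0)) = sum v {\<eta> \<in> segment. \<eta> x = 0}"
    using finite_segment by (simp add: sum.inter_filter of_bool_def if_distrib cong: if_cong)
  also have "\<dots> \<le> ?h * sum v segment"
  proof (rule sum_weight_le_inj[where \<phi> = "\<lambda>\<eta>. \<eta>(x := 1)"])
    show "inj_on (\<lambda>\<eta>. \<eta>(x := 1)) {\<eta> \<in> segment. \<eta> x = 0}"
    proof (rule inj_on_inverseI[where g = "\<lambda>\<eta>. \<eta>(x := 0)"])
      fix \<eta> assume "\<eta> \<in> {\<eta> \<in> segment. \<eta> x = 0}"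
      then show "(\<eta>(x := 1))(x := 0) = \<eta>" by auto
    qed
    show "(\<lambda>\<eta>. \<eta>(x := 1)) ` {\<eta> \<in> segment. \<eta> x = 0} \<subseteq> segment"
      using xy by (auto simp: segment_def PiE_iff extensional_def split: if_splits)
    fix \<eta> assume "\<eta> \<in> {\<eta> \<in> segment. \<eta> x = 0}"
    then have "v (\<eta>(x := 1)) = v \<eta> * exp (fermi - V x)"
      using xy by (simp add: gibbs_update)
    then have "?h * v (\<eta>(x := 1)) = v \<eta> * (exp ((V x - V y) / 2) * exp (fermi - V x))" by simp
    also have "exp ((V x - V y) / 2) * exp (fermi - V x) = 1"
      unfolding exp_add[symmetric] by (simp add: fermi_def field_simps)
    finally show "v \<eta> \<le> ?h * v (\<eta>(x := 1))" by (simp only: mult_1_right order_refl)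
  qed (use finite_segment gibbs_pos in \<open>auto simp: less_imp_le\<close>)
  finally have 1: "(\<Sum>\<eta>\<in>segment. v \<eta> * of_bool (\<eta> x = 0)) \<le> ?h * sum v segment" .
  have "(\<Sum>\<eta>\<in>segment. v \<eta> * of_bool (\<eta> y = 1)) = sum v {\<eta> \<in> segment. \<eta> y = 1}"
    using finite_segment by (simp add: sum.inter_filter of_bool_def if_distrib cong: if_cong)
  also have "\<dots> \<le> ?h * sum v segment"
  proof (rule sum_weight_le_inj[where \<phi> = "\<lambda>\<eta>. \<eta>(y := 0)"])
    show "inj_on (\<lambda>\<eta>. \<eta>(y := 0)) {\<eta> \<in> segment. \<eta> y = 1}"
    proof (rule inj_on_inverseI[where g = "\<lambda>\<eta>. \<eta>(y := 1)"])
      fix \<eta> assume "\<eta> \<in> {\<eta> \<in> segment. \<eta> y = 1}"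
      then show "(\<eta>(y := 0))(y := 1) = \<eta>" by auto
    qed
    show "(\<lambda>\<eta>. \<eta>(y := 0)) ` {\<eta> \<in> segment. \<eta> y = 1} \<subseteq> segment"
      using xy by (auto simp: segment_def PiE_iff extensional_def split: if_splits)
    fix \<eta> assume "\<eta> \<in> {\<eta> \<in> segment. \<eta> y = 1}"
    then have "v (\<eta>(y := 0)) = v \<eta> * exp (V y - fermi)"
      using xy by (simp add: gibbs_update)
    then have "?h * v (\<eta>(y := 0)) = v \<eta> * (exp ((V x - V y) / 2) * exp (V y - fermi))" by simp
    also have "exp ((V x - V y) / 2) * exp (V y - fermi) = 1"
      unfolding exp_add[symmetric] by (simp add: fermi_def field_simps)
    finally show "v \<eta> \<le> ?h * v (\<eta>(y := 0))" by (simp only: mult_1_right order_refl)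
  qed (use finite_segment gibbs_pos in \<open>auto simp: less_imp_le\<close>)
  finally have 2: "(\<Sum>\<eta>\<in>segment. v \<eta> * of_bool (\<eta> y = 1)) \<le> ?h * sum v segment" .
  show ?thesis using 1 2 by (simp add: defect_def distrib_left sum.distrib)
qed

text \<open>The comparison holds for every initial \<open>\<eta>\<close>, while its left side does
  not involve \<open>\<eta>\<close>. Averaging over the stationary weight \<open>v\<close> turns the
  defect terms into \<open>n\<close> times their equilibrium mean. The term \<open>y - x + 1\<close>
  pays for an arbitrary \<open>\<eta>\<close> at time 0.\<close>

lemma stepn_right_particles:
  assumes \<xi>: "\<xi> \<in> Omega N k"
  defines "R \<equiv> \<lambda>\<xi>::config. \<Sum>u=y+1..N. real (\<xi> u)"
  shows "(chain.step ^^ n) R \<xi> \<le> R \<xi> + real (y - x + 1) + 2 * exp ((V x - V y) / 2) * real n / (2 * real N)"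
proof -
  let ?W = "sum v segment" and ?c = "2 * real N"
  have W: "0 < ?W"
    using finite_segment by (intro sum_pos gibbs_pos) (auto simp: segment_def PiE_eq_empty_iff)
  have le: "(chain.step ^^ n) R \<xi> \<le> R \<xi> + real (y - x + 1) + (\<Sum>m<n. (seg.step ^^ m) defect \<eta>) / ?c"
    if \<eta>: "\<eta> \<in> segment" for \<eta>
  proof -
    have s: "(\<xi>, \<eta>) \<in> Omega N k \<times> segment" using \<xi> \<eta> by simp
    have "(chain.step ^^ n) R \<xi> = (pair.step ^^ n) (\<lambda>s. R (fst s)) (\<xi>, \<eta>)"
      using chain.stepn_proj[OF pair_mapping, of fst n R] by (simp add: pair_move_def)
    also have "\<dots> \<le> (pair.step ^^ n) max_height (\<xi>, \<eta>)"
    proof (rule pair.stepn_mono[OF _ s])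
      fix s :: "config \<times> config"
      show "R (fst s) \<le> max_height s"
        using height_le_max[of "y + 1" s] xy by (simp add: height_def R_def)
    qed
    also have "\<dots> \<le> max_height (\<xi>, \<eta>) + (\<Sum>m<n. (pair.step ^^ m) (\<lambda>s. defect (snd s)) (\<xi>, \<eta>)) / ?c"
      using max_height_gen s by (intro pair.stepn_drift_upper)
    also have "(\<Sum>m<n. (pair.step ^^ m) (\<lambda>s. defect (snd s)) (\<xi>, \<eta>)) = (\<Sum>m<n. (seg.step ^^ m) defect \<eta>)"
    proof (intro sum.cong refl)
      fix m
      show "(pair.step ^^ m) (\<lambda>s. defect (snd s)) (\<xi>, \<eta>) = (seg.step ^^ m) defect \<eta>"
        using seg.stepn_proj[OF pair_mapping, of snd m defect] by (simp add: pair_move_def)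
    qed
    also have "max_height (\<xi>, \<eta>) \<le> R \<xi> + real (y - x + 1)"
      unfolding max_height_def
    proof (rule Max.boundedI)
      fix h assume "h \<in> height (\<xi>, \<eta>) ` {x..y+1}"
      then obtain z where z: "z \<in> {x..y+1}" "h = height (\<xi>, \<eta>) z" by auto
      have "h \<le> (\<Sum>u=z..N. real (\<xi> u))" by (simp add: z height_def sum_nonneg)
      also have "\<dots> \<le> (\<Sum>u=x..N. real (\<xi> u))" using z by (intro sum_mono2) auto
      also have "{x..N} = {x..y} \<union> {y+1..N}" using xy by auto
      also have "(\<Sum>u\<in>{x..y} \<union> {y+1..N}. real (\<xi> u)) = (\<Sum>u=x..y. real (\<xi> u)) + R \<xi>"
        unfolding R_def by (intro sum.union_disjoint) auto
      also have "(\<Sum>u=x..y. real (\<xi> u)) \<le> (\<Sum>u=x..y. 1)"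
      proof (rule sum_mono)
        fix u assume "u \<in> {x..y}"
        then show "real (\<xi> u) \<le> 1" using OmegaD[OF \<xi>, of u] xy by auto
      qed
      also have "(\<Sum>u=x..y. 1) = real (y - x + 1)" using xy by simp
      finally show "h \<le> R \<xi> + real (y - x + 1)" by simp
    qed (use xy in auto)
    finally show ?thesis by simp
  qed
  let ?r = "(chain.step ^^ n) R \<xi>" and ?a = "R \<xi> + real (y - x + 1)"
  have "?W * ?r = (\<Sum>\<eta>\<in>segment. v \<eta> * ?r)" by (simp add: sum_distrib_right)
  also have "\<dots> \<le> (\<Sum>\<eta>\<in>segment. v \<eta> * (?a + (\<Sum>m<n. (seg.step ^^ m) defect \<eta>) / ?c))"
    using le gibbs_pos by (intro sum_mono mult_left_mono) (auto simp: less_imp_le)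
  also have "\<dots> = ?W * ?a + (\<Sum>\<eta>\<in>segment. \<Sum>m<n. v \<eta> * (seg.step ^^ m) defect \<eta>) / ?c"
    by (simp add: distrib_left sum.distrib sum_distrib_left sum_distrib_right sum_divide_distrib)
  also have "(\<Sum>\<eta>\<in>segment. \<Sum>m<n. v \<eta> * (seg.step ^^ m) defect \<eta>) = real n * (\<Sum>\<eta>\<in>segment. v \<eta> * defect \<eta>)"
    by (subst sum.swap) (simp add: seg.stationary_stepn[OF segment_stationary])
  also have "\<dots> \<le> real n * (2 * exp ((V x - V y) / 2) * ?W)"
    by (intro mult_left_mono sum_defect) auto
  finally have "?W * ?r \<le> ?W * (?a + 2 * exp ((V x - V y) / 2) * real n / ?c)"
    by (simp add: algebra_simps divide_right_mono)
  then show ?thesis using W by simp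
qed

end

lemma mix_dist_current:
  assumes xy: "1 \<le> x" "x < y" "y < N" and "0 \<le> t" and j: "j \<le> k" "j \<le> x" "y + k < N + j"
  defines "p \<equiv> (\<Sum>\<xi>\<in>Omega N k. \<pi> \<xi> * of_bool (\<exists>u\<in>{1..y}. \<xi> u = 1))"
  shows "(real j - real (y - x + 1) - 2 * t * exp ((V x - V y) / 2)) / real k - p \<le> mix_dist \<omega> N k t"
proof -
  let ?R = "\<lambda>\<xi>::config. \<Sum>u=y+1..N. real (\<xi> u)" and ?h = "exp ((V x - V y) / 2)"
  \<comment> \<open>\<open>j\<close> particles start packed at the left and the others at the right
    end, so at most \<open>k - j\<close> are right of \<open>y\<close>. In equilibrium the mean
    number there is at least \<open>(1 - p) * k\<close>, and the difference has to cross the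
    barrier.\<close>
  let ?B = "{1..j} \<union> {N - (k - j) + 1..N}"
  let ?\<xi> = "conf ?B"
  have "card ?B = card {1..j} + card {N - (k - j) + 1..N}"
    using j k by (intro card_Un_disjoint) auto
  also have "\<dots> = k" using j k by simp
  finally have \<xi>: "?\<xi> \<in> Omega N k" using j k by (intro conf_Omega) auto
  have split: "real k = (\<Sum>u=1..y. real (\<xi> u)) + ?R \<xi>" if "\<xi> \<in> Omega N k" for \<xi>
  proof -
    have "real k = (\<Sum>u\<in>{1..N}. real (\<xi> u))" using that by (simp add: Omega_def flip: of_nat_sum)
    also have "{1..N} = {1..y} \<union> {y+1..N}" using xy by auto
    also have "(\<Sum>u\<in>{1..y} \<union> {y+1..N}. real (\<xi> u)) = (\<Sum>u=1..y. real (\<xi> u)) + ?R \<xi>"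
      by (intro sum.union_disjoint) auto
    finally show ?thesis .
  qed
  have R_nonneg: "0 \<le> ?R \<xi>" and R_le: "?R \<xi> \<le> real k" if "\<xi> \<in> Omega N k" for \<xi>
    using split[OF that] sum_nonneg[of "{1..y}" "\<lambda>u. real (\<xi> u)"] by (auto intro: sum_nonneg)
  have R0: "?R ?\<xi> \<le> real k - real j"
  proof -
    have "(\<Sum>u=1..j. (1::real)) \<le> (\<Sum>u=1..y. real (?\<xi> u))"
    proof -
      have "(\<Sum>u=1..j. (1::real)) = (\<Sum>u=1..j. real (?\<xi> u))"
        using j xy by (intro sum.cong) (auto simp: conf_def)
      also have "\<dots> \<le> (\<Sum>u=1..y. real (?\<xi> u))" using j xy by (intro sum_mono2) auto
      finally show ?thesis .
    qed
    then show ?thesis using split[OF \<xi>] by simp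
  qed
  have "chain.evolve t (\<lambda>\<xi>. (1 / real k) * ?R \<xi>) ?\<xi>
      \<le> (?R ?\<xi> + real (y - x + 1)) / real k + (2 * ?h / real k) * t"
  proof (rule chain.evolve_upper[where B = 1])
    fix n
    have "(chain.step ^^ n) (\<lambda>\<xi>. (1 / real k) * ?R \<xi>) ?\<xi> = (1 / real k) * (chain.step ^^ n) ?R ?\<xi>"
      by (simp only: chain.stepn_mult)
    also have "\<dots> \<le> (1 / real k) * (?R ?\<xi> + real (y - x + 1) + 2 * ?h * real n / (2 * real N))"
      by (intro mult_left_mono stepn_right_particles xy \<xi>) auto
    finally show "(chain.step ^^ n) (\<lambda>\<xi>. (1 / real k) * ?R \<xi>) ?\<xi>
       \<le> (?R ?\<xi> + real (y - x + 1)) / real k + (2 * ?h / real k) * real n / (2 * real N)"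
      using k by (simp add: field_simps)
    show "\<bar>(1 / real k) * ?R \<zeta>\<bar> \<le> 1" if "\<zeta> \<in> Omega N k" for \<zeta>
      using R_nonneg[OF that] R_le[OF that] k by (simp add: abs_le_iff divide_simps)
  qed (use \<xi> assms in auto)
  also have "\<dots> = (?R ?\<xi> + real (y - x + 1) + 2 * t * ?h) / real k"
    by (simp add: add_divide_distrib mult_ac)
  also have "\<dots> \<le> (real k - real j + real (y - x + 1) + 2 * t * ?h) / real k"
    using R0 by (intro divide_right_mono) auto
  finally have 1: "chain.evolve t (\<lambda>\<xi>. (1 / real k) * ?R \<xi>) ?\<xi>
      \<le> (real k - real j + real (y - x + 1) + 2 * t * ?h) / real k" .
  have "(\<Sum>\<xi>\<in>Omega N k. \<pi> \<xi> * (1 - of_bool (\<exists>u\<in>{1..y}. \<xi> u = 1))) \<le> (\<Sum>\<xi>\<in>Omega N k. \<pi> \<xi> * ((1 / real k) * ?R \<xi>))"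
  proof (rule sum_equilibrium_le)
    fix \<xi> assume \<xi>: "\<xi> \<in> Omega N k"
    show "1 - of_bool (\<exists>u\<in>{1..y}. \<xi> u = 1) \<le> (1 / real k) * ?R \<xi>"
    proof (cases "\<exists>u\<in>{1..y}. \<xi> u = 1")
      case False
      then have "\<xi> u = 0" if "u \<in> {1..y}" for u
        using OmegaD[OF \<xi>, of u] that xy by auto
      then have "(\<Sum>u=1..y. real (\<xi> u)) = 0" by (intro sum.neutral) auto
      then have "?R \<xi> = real k" using split[OF \<xi>] by simp
      then show ?thesis using k by simp
    qed (use R_nonneg[OF \<xi>] k in auto)
  qed
  then have 2: "1 - p \<le> (\<Sum>\<xi>\<in>Omega N k. \<pi> \<xi> * ((1 / real k) * ?R \<xi>))"
    using sum_equilibrium by (simp add: p_def right_diff_distrib sum_subtractf)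
  have "\<bar>chain.evolve t (\<lambda>\<xi>. (1 / real k) * ?R \<xi>) ?\<xi> - (\<Sum>\<xi>\<in>Omega N k. \<pi> \<xi> * ((1 / real k) * ?R \<xi>))\<bar>
      \<le> mix_dist \<omega> N k t"
    using R_nonneg R_le k by (intro mix_dist_ge_abs \<xi>) (auto simp: divide_simps)
  then have "1 - p - (real k - real j + real (y - x + 1) + 2 * t * ?h) / real k \<le> mix_dist \<omega> N k t"
    using 1 2 by (simp add: abs_le_iff)
  moreover have "1 - (real k - real j + real (y - x + 1) + 2 * t * ?h) / real k
      = (real j - real (y - x + 1) - 2 * t * ?h) / real k"
    using k by (simp add: field_simps)
  ultimately show ?thesis by linarith
qed

end

section \<open>Convergence to equilibrium\<close>

context sep begin

text \<open>Local form of the state with all particles packed at the right end; it serves as the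
  small set of the Doeblin argument.\<close>

definition is_sorted :: "config \<Rightarrow> bool" where
  "is_sorted \<xi> \<longleftrightarrow> (\<forall>z\<in>{1..<N}. \<not> (\<xi> z = 1 \<and> \<xi> (z + 1) = 0))"

lemma is_sorted_mono:
  assumes "is_sorted \<xi>" and "\<xi> \<in> Omega N k" and "1 \<le> u" and "u \<le> u'" and "u' \<le> N"
  shows "\<xi> u \<le> \<xi> u'"
  using assms(4,5)
proof (induction u' rule: dec_induct)
  case (step n)
  have "\<xi> n \<le> \<xi> (n + 1)"
    using assms(1,3) step OmegaD[OF assms(2), of n] OmegaD[OF assms(2), of "n + 1"]
    by (auto simp: is_sorted_def)
  then show ?case using step by (simp flip: Suc_eq_plus1)
qed simp

text \<open>Two sorted states that differ at one site are ordered at every site by monotonicity,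
  which contradicts equal particle numbers.\<close>

lemma is_sorted_unique:
  assumes "is_sorted \<xi>" "\<xi> \<in> Omega N k" "is_sorted \<xi>'" "\<xi>' \<in> Omega N k"
  shows "\<xi> = \<xi>'"
proof -
  have no: "\<not> (\<zeta> z = 0 \<and> \<zeta>' z = 1)"
    if h: "is_sorted \<zeta>" "\<zeta> \<in> Omega N k" "is_sorted \<zeta>'" "\<zeta>' \<in> Omega N k" "z \<in> {1..N}" for \<zeta> \<zeta>' z
  proof
    assume z: "\<zeta> z = 0 \<and> \<zeta>' z = 1"
    have "\<zeta> u \<le> \<zeta>' u" if "u \<in> {1..N}" for u
    proof (cases "u \<le> z")
      case True
      then show ?thesis using is_sorted_mono[OF h(1,2), of u z] z h(5) that by auto
    next
      case False
      then show ?thesis using is_sorted_mono[OF h(3,4), of z u] z h(5) that OmegaD[OF h(2) that] by auto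
    qed
    then have "(\<Sum>u=1..N. \<zeta> u) < (\<Sum>u=1..N. \<zeta>' u)"
      using z h(5) by (intro sum_strict_mono_ex1 ballI bexI[of _ z]) auto
    then show False using h by (simp add: Omega_def)
  qed
  have "\<xi> u = \<xi>' u" if "u \<in> {1..N}" for u
    using no[OF assms that] no[OF assms(3,4,1,2) that] OmegaD[OF assms(2) that] OmegaD[OF assms(4) that] by metis
  moreover have "\<xi> \<in> {1..N} \<rightarrow>\<^sub>E {0, 1}" "\<xi>' \<in> {1..N} \<rightarrow>\<^sub>E {0, 1}"
    using assms(2,4) unfolding Omega_def by blast+
  ultimately show ?thesis by (metis PiE_ext)
qed

lemma sorting_moves_up:
  assumes "\<xi> \<in> Omega N k" and "\<not> is_sorted \<xi>"
  obtains a where "a \<in> moves"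
    "(\<Sum>u=1..N. real u * real (attempt a \<xi> u)) = (\<Sum>u=1..N. real u * real (\<xi> u)) + 1"
proof -
  obtain z where z: "1 \<le> z" "z < N" "\<xi> z = 1" "\<xi> (z + 1) = 0" using assms(2) by (auto simp: is_sorted_def)
  then have "(\<Sum>u=1..N. real u * real (attempt (z, True) \<xi> u)) = (\<Sum>u=1..N. real u * real (\<xi> u)) + 1"
    using sum_attempt[of "{1..N}" real "(z, True)" \<xi>] by (simp add: shift_cases)
  then show ?thesis using z by (intro that[of "(z, True)"]) (auto simp: moves_def)
qed

text \<open>From an unsorted state some attempt raises the sum of particle positions by 1, and that
  sum is at most \<open>N * N\<close>. So \<open>N * N\<close> steps suffice to sort; surplus steps
  are spent by laziness, and each prescribed step has probability at least
  \<open>\<epsilon>\<close>.\<close>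

lemma doeblin:
  obtains \<delta> where "0 < \<delta>" "\<delta> \<le> 1"
    "\<And>\<xi>. \<xi> \<in> Omega N k \<Longrightarrow> \<delta> \<le> (chain.step ^^ (N * N)) (\<lambda>\<xi>. of_bool (is_sorted \<xi>)) \<xi>"
proof -
  let ?c = "2 * real N" and ?F = "\<lambda>\<xi>::config. \<Sum>u=1..N. real u * real (\<xi> u)"
  define \<epsilon> where "\<epsilon> = Min (insert (1 / real N) ((\<lambda>a. clock \<omega> a / ?c) ` moves))"
  have fin: "finite (insert (1 / real N) ((\<lambda>a. clock \<omega> a / ?c) ` moves))" using chain.finite_A by simp
  have \<epsilon>: "0 < \<epsilon>" "\<epsilon> \<le> 1 / real N" "\<And>a. a \<in> moves \<Longrightarrow> \<epsilon> \<le> clock \<omega> a / ?c"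
    unfolding \<epsilon>_def using fin clock_bounds N by auto
  have lazy: "\<epsilon> \<le> 1 - sum (clock \<omega>) moves / ?c"
  proof -
    have "sum (clock \<omega>) moves / ?c \<le> (2 * real N - 2) / ?c"
      using sum_clock by (intro divide_right_mono) auto
    also have "\<dots> = 1 - 1 / real N" using N by (simp add: field_simps)
    finally show ?thesis using \<epsilon>(2) by simp
  qed
  let ?o = "\<lambda>\<xi>::config. of_bool (is_sorted \<xi>) :: real"
  have nn: "0 \<le> (chain.step ^^ m) ?o \<xi>" if "\<xi> \<in> Omega N k" for m \<xi>
    using chain.stepn_mono[of "\<lambda>_. 0" ?o \<xi> m] that by (simp add: chain.stepn_const)
  have F_le: "?F \<xi> \<le> real (N * N)" if "\<xi> \<in> Omega N k" for \<xi>
  proof -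
    have "?F \<xi> \<le> (\<Sum>u=1..N. real N * 1)"
      using OmegaD[OF that] by (intro sum_mono mult_mono) fastforce+
    then show ?thesis by simp
  qed
  have main: "\<epsilon> ^ m \<le> (chain.step ^^ m) ?o \<xi>"
    if "\<xi> \<in> Omega N k" "is_sorted \<xi> \<or> real (N * N) \<le> ?F \<xi> + real m" for m \<xi>
    using that
  proof (induction m arbitrary: \<xi>)
    case 0
    \<comment> \<open>With no step left the sum of positions has reached its bound, which a further
      sorting move would exceed.\<close>
    have "is_sorted \<xi>"
    proof (rule ccontr)
      assume ns: "\<not> is_sorted \<xi>"
      then obtain a where a: "a \<in> moves" "?F (attempt a \<xi>) = ?F \<xi> + 1"
        using sorting_moves_up[OF 0(1) ns] by blast
      then show False using F_le[OF chain.T_closed[OF a(1) 0(1)]] 0(2) ns by simp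
    qed
    then show ?case by simp
  next
    case (Suc m)
    let ?g = "(chain.step ^^ m) ?o"
    have eq: "(chain.step ^^ Suc m) ?o \<xi>
        = (1 - sum (clock \<omega>) moves / ?c) * ?g \<xi> + (\<Sum>a\<in>moves. clock \<omega> a / ?c * ?g (attempt a \<xi>))"
      by (simp add: chain.step_eq)
    have terms: "0 \<le> clock \<omega> a / ?c * ?g (attempt a \<xi>)" if "a \<in> moves" for a
      using clock_bounds[OF that] nn[OF chain.T_closed[OF that Suc.prems(1)]] by simp
    show ?case
    proof (cases "is_sorted \<xi>")
      case True
      have "\<epsilon> * \<epsilon> ^ m \<le> (1 - sum (clock \<omega>) moves / ?c) * ?g \<xi>"
        using Suc.IH[OF Suc.prems(1)] True lazy \<epsilon>(1) by (intro mult_mono) auto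
      also have "\<dots> \<le> (chain.step ^^ Suc m) ?o \<xi>"
        unfolding eq using terms by (simp add: sum_nonneg)
      finally show ?thesis by simp
    next
      case False
      then obtain a where a: "a \<in> moves" "?F (attempt a \<xi>) = ?F \<xi> + 1"
        using sorting_moves_up[OF Suc.prems(1) False] by blast
      have "\<epsilon> ^ m \<le> ?g (attempt a \<xi>)"
        using a Suc.prems False chain.T_closed by (intro Suc.IH) auto
      then have "\<epsilon> * \<epsilon> ^ m \<le> clock \<omega> a / ?c * ?g (attempt a \<xi>)"
        using \<epsilon>(1) \<epsilon>(3)[OF a(1)] by (intro mult_mono) auto
      also have "\<dots> \<le> (\<Sum>a\<in>moves. clock \<omega> a / ?c * ?g (attempt a \<xi>))"
        using a terms chain.finite_A by (intro member_le_sum) auto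
      also have "\<dots> \<le> (chain.step ^^ Suc m) ?o \<xi>"
        unfolding eq using nn[OF Suc.prems(1)] lazy \<epsilon>(1) by simp
      finally show ?thesis by simp
    qed
  qed
  have "\<epsilon> ^ (N * N) \<le> (chain.step ^^ (N * N)) ?o \<xi>" if "\<xi> \<in> Omega N k" for \<xi>
    using that by (intro main) (auto intro!: sum_nonneg)
  moreover have "1 / real N \<le> 1" using N by simp
  then have "\<epsilon> \<le> 1" using \<epsilon>(2) by linarith
  ultimately show ?thesis using \<epsilon>(1) by (intro that[of "\<epsilon> ^ (N * N)"]) (auto simp: power_le_one)
qed

text \<open>Every \<open>N * N\<close> steps both ends of the range of \<open>f\<close> are drawn
  towards the value at the sorted state, and the range shrinks by the factor
  \<open>1 - \<delta>\<close>. By stationarity the equilibrium mean lies in every such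
  range.\<close>

lemma stepn_contraction:
  obtains \<delta> where "0 < \<delta>" "\<delta> \<le> 1"
    "\<And>f n \<xi>. (\<And>\<zeta>. \<zeta> \<in> Omega N k \<Longrightarrow> 0 \<le> f \<zeta> \<and> f \<zeta> \<le> 1) \<Longrightarrow> \<xi> \<in> Omega N k \<Longrightarrow>
       \<bar>(chain.step ^^ n) f \<xi> - (\<Sum>\<zeta>\<in>Omega N k. \<pi> \<zeta> * f \<zeta>)\<bar> \<le> (1 - \<delta>) ^ (n div (N * N))"
proof -
  let ?O = "Omega N k" and ?o = "\<lambda>\<xi>::config. of_bool (is_sorted \<xi>) :: real"
  obtain \<delta> where \<delta>: "0 < \<delta>" "\<delta> \<le> 1" "\<And>\<xi>. \<xi> \<in> ?O \<Longrightarrow> \<delta> \<le> (chain.step ^^ (N * N)) ?o \<xi>"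
    by (rule doeblin) blast
  obtain \<zeta>0 where val: "\<And>\<xi>. \<xi> \<in> ?O \<Longrightarrow> is_sorted \<xi> \<Longrightarrow> \<xi> = \<zeta>0" and \<zeta>0: "\<zeta>0 \<in> ?O"
  proof -
    \<comment> \<open>Without a sorted state the indicator would vanish on the state space, and so
      would its image under the steps, against the lower bound \<open>\<delta>\<close>.\<close>
    have "\<exists>\<xi>\<in>?O. is_sorted \<xi>"
    proof (rule ccontr)
      assume none: "\<not> ?thesis"
      obtain \<xi> where \<xi>: "\<xi> \<in> ?O" using Omega_nonempty by auto
      have "(chain.step ^^ (N * N)) ?o \<xi> \<le> (chain.step ^^ (N * N)) (\<lambda>_. 0) \<xi>"
        using none \<xi> by (intro chain.stepn_mono) auto
      then show False using \<delta>(1) \<delta>(3)[OF \<xi>] by (simp add: chain.stepn_const)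
    qed
    then obtain \<zeta> where \<zeta>: "\<zeta> \<in> ?O" "is_sorted \<zeta>" by blast
    show ?thesis using \<zeta> by (intro that[of \<zeta>] is_sorted_unique) auto
  qed
  have osc: "\<exists>l h. h - l = (1 - \<delta>) ^ j \<and> (\<forall>n\<ge>j * (N * N). \<forall>\<xi>\<in>?O. l \<le> (chain.step ^^ n) f \<xi> \<and> (chain.step ^^ n) f \<xi> \<le> h)"
    if f: "\<And>\<zeta>. \<zeta> \<in> ?O \<Longrightarrow> 0 \<le> f \<zeta> \<and> f \<zeta> \<le> 1" for f j
  proof (induction j)
    case 0
    have "0 \<le> (chain.step ^^ n) f \<xi> \<and> (chain.step ^^ n) f \<xi> \<le> 1" if "\<xi> \<in> ?O" for n \<xi>
      using chain.stepn_mono[of "\<lambda>_. 0" f \<xi> n] chain.stepn_mono[of f "\<lambda>_. 1" \<xi> n] f that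
      by (simp add: chain.stepn_const)
    then show ?case by (intro exI[of _ 0] exI[of _ 1]) auto
  next
    case (Suc j)
    then obtain l h where lh: "h - l = (1 - \<delta>) ^ j"
      "\<And>n \<xi>. j * (N * N) \<le> n \<Longrightarrow> \<xi> \<in> ?O \<Longrightarrow> l \<le> (chain.step ^^ n) f \<xi> \<and> (chain.step ^^ n) f \<xi> \<le> h"
      by blast
    let ?g = "(chain.step ^^ (j * (N * N))) f"
    let ?l = "l + (?g \<zeta>0 - l) * \<delta>" and ?h = "h + (?g \<zeta>0 - h) * \<delta>"
    have affine: "(chain.step ^^ n) (\<lambda>\<xi>. p + q * ?o \<xi>) \<xi> = p + q * (chain.step ^^ n) ?o \<xi>" for n p q \<xi>
      by (simp only: chain.stepn_add chain.stepn_mult chain.stepn_const)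
    have g: "l \<le> ?g \<xi>" "?g \<xi> \<le> h" if "\<xi> \<in> ?O" for \<xi> using lh(2)[of "j * (N * N)" \<xi>] that by auto
    have base: "?l \<le> (chain.step ^^ (N * N)) ?g \<xi> \<and> (chain.step ^^ (N * N)) ?g \<xi> \<le> ?h" if \<xi>: "\<xi> \<in> ?O" for \<xi>
    proof
      have "(chain.step ^^ (N * N)) (\<lambda>\<xi>. l + (?g \<zeta>0 - l) * ?o \<xi>) \<xi> \<le> (chain.step ^^ (N * N)) ?g \<xi>"
      proof (rule chain.stepn_mono[OF _ \<xi>])
        fix \<zeta> assume "\<zeta> \<in> ?O"
        then show "l + (?g \<zeta>0 - l) * ?o \<zeta> \<le> ?g \<zeta>" using g[of \<zeta>] val[of \<zeta>] by (cases "is_sorted \<zeta>") auto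
      qed
      moreover have "(?g \<zeta>0 - l) * \<delta> \<le> (?g \<zeta>0 - l) * (chain.step ^^ (N * N)) ?o \<xi>"
        using \<delta>(3)[OF \<xi>] g(1)[OF \<zeta>0] by (intro mult_left_mono) auto
      ultimately show "?l \<le> (chain.step ^^ (N * N)) ?g \<xi>"
        unfolding affine by linarith
      have "(chain.step ^^ (N * N)) ?g \<xi> \<le> (chain.step ^^ (N * N)) (\<lambda>\<xi>. h + (?g \<zeta>0 - h) * ?o \<xi>) \<xi>"
      proof (rule chain.stepn_mono[OF _ \<xi>])
        fix \<zeta> assume "\<zeta> \<in> ?O"
        then show "?g \<zeta> \<le> h + (?g \<zeta>0 - h) * ?o \<zeta>" using g[of \<zeta>] val[of \<zeta>] by (cases "is_sorted \<zeta>") auto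
      qed
      moreover have "(?g \<zeta>0 - h) * (chain.step ^^ (N * N)) ?o \<xi> \<le> (?g \<zeta>0 - h) * \<delta>"
        using \<delta>(3)[OF \<xi>] g(2)[OF \<zeta>0] by (intro mult_left_mono_neg) auto
      ultimately show "(chain.step ^^ (N * N)) ?g \<xi> \<le> ?h"
        unfolding affine by linarith
    qed
    have "?l \<le> (chain.step ^^ n) f \<xi> \<and> (chain.step ^^ n) f \<xi> \<le> ?h" if "Suc j * (N * N) \<le> n" "\<xi> \<in> ?O" for n \<xi>
    proof -
      define i where "i = n - Suc j * (N * N)"
      have n: "n = i + (N * N + j * (N * N))" using that(1) by (simp add: i_def)
      let ?G = "(chain.step ^^ (N * N)) ?g"
      have "(chain.step ^^ n) f = (chain.step ^^ i) ?G" by (simp add: n funpow_add)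
      moreover have "(chain.step ^^ i) (\<lambda>_. ?l) \<xi> \<le> (chain.step ^^ i) ?G \<xi>"
        "(chain.step ^^ i) ?G \<xi> \<le> (chain.step ^^ i) (\<lambda>_. ?h) \<xi>"
        using base that(2) by (auto intro!: chain.stepn_mono)
      ultimately show ?thesis by (simp add: chain.stepn_const)
    qed
    moreover have "?h - ?l = (1 - \<delta>) ^ Suc j"
    proof -
      have "?h - ?l = (1 - \<delta>) * (h - l)" by (simp add: algebra_simps)
      then show ?thesis by (simp add: lh(1))
    qed
    ultimately show ?case by blast
  qed
  have fin: "\<bar>(chain.step ^^ n) f \<xi> - (\<Sum>\<zeta>\<in>?O. \<pi> \<zeta> * f \<zeta>)\<bar> \<le> (1 - \<delta>) ^ (n div (N * N))"
    if f: "\<And>\<zeta>. \<zeta> \<in> ?O \<Longrightarrow> 0 \<le> f \<zeta> \<and> f \<zeta> \<le> 1" and \<xi>: "\<xi> \<in> ?O" for f n \<xi>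
  proof -
    have "n div (N * N) * (N * N) \<le> n" by simp
    with osc[where f = f and j = "n div (N * N)", OF f] obtain l h where lh: "h - l = (1 - \<delta>) ^ (n div (N * N))"
      "\<And>\<zeta>. \<zeta> \<in> ?O \<Longrightarrow> l \<le> (chain.step ^^ n) f \<zeta> \<and> (chain.step ^^ n) f \<zeta> \<le> h" by blast
    have "(\<Sum>\<zeta>\<in>?O. \<pi> \<zeta> * f \<zeta>) = (\<Sum>\<zeta>\<in>?O. \<pi> \<zeta> * (chain.step ^^ n) f \<zeta>)"
      by (simp add: chain.stationary_stepn[OF equilibrium_stationary])
    moreover have "(\<Sum>\<zeta>\<in>?O. \<pi> \<zeta> * l) \<le> \<dots>" "\<dots> \<le> (\<Sum>\<zeta>\<in>?O. \<pi> \<zeta> * h)"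
      using lh(2) by (auto intro!: sum_equilibrium_le)
    ultimately have "l \<le> (\<Sum>\<zeta>\<in>?O. \<pi> \<zeta> * f \<zeta>)" "(\<Sum>\<zeta>\<in>?O. \<pi> \<zeta> * f \<zeta>) \<le> h"
      by (simp_all add: sum_distrib_right[symmetric] sum_equilibrium)
    then show ?thesis using lh(2)[OF \<xi>] lh(1) by linarith
  qed
  show ?thesis by (rule that[OF \<delta>(1,2) fin])
qed

lemma mix_dist_eventually_small: "\<exists>t\<ge>0. mix_dist \<omega> N k t \<le> 1 / 4"
proof -
  let ?O = "Omega N k" and ?m = "N * N" and ?c = "2 * real N"
  obtain \<delta> where \<delta>: "0 < \<delta>" "\<delta> \<le> 1"
    "\<And>f n \<xi>. (\<And>\<zeta>. \<zeta> \<in> ?O \<Longrightarrow> 0 \<le> f \<zeta> \<and> f \<zeta> \<le> 1) \<Longrightarrow> \<xi> \<in> ?O \<Longrightarrow>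
       \<bar>(chain.step ^^ n) f \<xi> - (\<Sum>\<zeta>\<in>?O. \<pi> \<zeta> * f \<zeta>)\<bar> \<le> (1 - \<delta>) ^ (n div ?m)"
    by (rule stepn_contraction) blast
  \<comment> \<open>A geometric rate per single step. It is positive even if
    \<open>\<delta> = 1\<close>, and Bernoulli's inequality bounds its power \<open>?m\<close> from
    below by \<open>1 - \<delta>\<close>.\<close>
  define q where "q = 1 - \<delta> / real ?m"
  have m: "4 \<le> ?m" using N mult_le_mono[of 2 N 2 N] by simp
  then have m': "4 \<le> real ?m" by (metis of_nat_le_iff of_nat_numeral)
  have q: "0 < q" "q < 1" using \<delta>(1,2) m' N by (auto simp: q_def divide_simps)
  have qm: "1 - \<delta> \<le> q ^ ?m"
    using Bernoulli_inequality[of "- \<delta> / real ?m" ?m] \<delta> m' by (simp add: q_def divide_simps split: if_splits)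
  have geo: "(1 - \<delta>) ^ (n div ?m) \<le> (1 / q ^ ?m) * q ^ n" for n
  proof -
    have "(1 - \<delta>) ^ (n div ?m) \<le> (q ^ ?m) ^ (n div ?m)"
      using qm \<delta> by (intro power_mono) auto
    also have "\<dots> = q ^ (?m * (n div ?m))" by (simp add: power_mult)
    also have "\<dots> \<le> q ^ n / q ^ ?m"
    proof -
      have "q ^ ?m * q ^ (?m * (n div ?m)) = q ^ (?m + ?m * (n div ?m))" by (simp add: power_add)
      also have "\<dots> \<le> q ^ n"
      proof (rule power_decreasing)
        show "n \<le> ?m + ?m * (n div ?m)"
          using m mod_less_divisor[of ?m n] mult_div_mod_eq[of ?m n] by linarith
      qed (use q in auto)
      finally show ?thesis using q by (simp add: field_simps)
    qed
    finally show ?thesis by simp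
  qed
  define u where "u = ?c * (1 - q)"
  have upos: "0 < u" using q N by (simp add: u_def)
  define C where "C = 1 / q ^ ?m"
  define t where "t = ln (4 * C) / u"
  have C1: "1 \<le> C" using q power_le_one[of q ?m] by (simp add: C_def divide_simps)
  have t0: "0 \<le> t" using C1 upos by (simp add: t_def)
  have small: "C * exp (- (?c * t * (1 - q))) = 1 / 4"
  proof -
    have "?c * t * (1 - q) = u * t" by (simp add: u_def)
    also have "\<dots> = ln (4 * C)" using upos by (simp add: t_def)
    finally have "?c * t * (1 - q) = ln (4 * C)" .
    then have "exp (- (?c * t * (1 - q))) = inverse (4 * C)" using C1 by (simp only: exp_minus) simp
    then show ?thesis using C1 by (simp only:) simp
  qed
  have "tv_dist ?O (transition \<omega> N k t \<xi>) \<pi> \<le> 1 / 4" if \<xi>: "\<xi> \<in> ?O" for \<xi>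
    unfolding tv_dist_def
  proof (rule cSUP_least)
    fix B assume "B \<in> Pow ?O"
    then have B: "B \<subseteq> ?O" by simp
    let ?f = "\<lambda>\<zeta>::config. of_bool (\<zeta> \<in> B) :: real"
    have ind: "sum p B = (\<Sum>\<zeta>\<in>?O. p \<zeta> * ?f \<zeta>)" for p :: "config \<Rightarrow> real"
    proof -
      have "(\<Sum>\<zeta>\<in>?O. p \<zeta> * ?f \<zeta>) = (\<Sum>\<zeta>\<in>?O. if \<zeta> \<in> B then p \<zeta> else 0)" by (intro sum.cong) auto
      also have "\<dots> = sum p {\<zeta> \<in> ?O. \<zeta> \<in> B}" using finite_Omega by (rule sum.inter_filter[symmetric])
      also have "{\<zeta> \<in> ?O. \<zeta> \<in> B} = B" using B by auto
      finally show ?thesis by simp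
    qed
    have "\<bar>chain.evolve t ?f \<xi> - (\<Sum>\<zeta>\<in>?O. \<pi> \<zeta> * ?f \<zeta>)\<bar> \<le> C * exp (- (?c * t * (1 - q)))"
    proof (rule chain.evolve_geometric[where B = 1])
      show "\<bar>(chain.step ^^ n) ?f \<xi> - (\<Sum>\<zeta>\<in>?O. \<pi> \<zeta> * ?f \<zeta>)\<bar> \<le> C * q ^ n" for n
        using \<delta>(3)[of ?f \<xi> n] geo[of n] \<xi> by (simp add: C_def)
    qed (use \<xi> t0 in auto)
    then show "\<bar>sum (transition \<omega> N k t \<xi>) B - sum \<pi> B\<bar> \<le> 1 / 4"
      using sum_transition[OF \<xi>, of t ?f] unfolding ind small by simp
  qed auto
  then have "mix_dist \<omega> N k t \<le> 1 / 4"
    unfolding mix_dist_def using finite_Omega Omega_nonempty by (intro Max.boundedI) auto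
  then show ?thesis using t0 by blast
qed

text \<open>The set of admissible times is non-empty, so its infimum is a genuine greatest lower
  bound.\<close>

lemma t_mix_ge:
  assumes "\<And>t. 0 \<le> t \<Longrightarrow> t < s \<Longrightarrow> 1 / 4 < mix_dist \<omega> N k t"
  shows "s \<le> t_mix \<omega> N k"
  unfolding t_mix_def
proof (rule cInf_greatest)
  show "{t. 0 \<le> t \<and> mix_dist \<omega> N k t \<le> 1 / 4} \<noteq> {}" using mix_dist_eventually_small by auto
  show "s \<le> t" if "t \<in> {t. 0 \<le> t \<and> mix_dist \<omega> N k t \<le> 1 / 4}" for t
    using assms[of t] that by (cases "t < s") auto
qed

end

section \<open>Good environments\<close>

context env_law begin

text \<open>Each increment of the potential mixes two neighbouring sites. Rewritten through
  \<open>\<rho>\<close>, it is a step of the walk plus a difference of \<open>ln \<omega>\<close>,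
  and the differences telescope.\<close>

lemma potential_diff:
  assumes "1 \<le> x" and "x \<le> y" and "\<And>z. x \<le> z \<Longrightarrow> z \<le> y \<Longrightarrow> f (int z) \<in> {\<alpha>..1 - \<alpha>}"
  shows "potential f y - potential f x = (\<Sum>z=x+1..y. ln (rho (f (int z)))) + ln (f (int y)) - ln (f (int x))"
  using assms(2,3)
proof (induction y rule: dec_induct)
  case (step y)
  have b: "0 < f (int y)" "0 < f (int y + 1)" "f (int y + 1) < 1"
    using rho_bounds(1,2)[OF step.prems[of y]] rho_bounds(1,2)[OF step.prems[of "y + 1"]] step.hyps
    by (auto simp: add.commute)
  have "potential f (Suc y) = potential f y + ln ((1 - f (int y + 1)) / f (int y))"
    using potential_Suc[of y f] assms(1) step.hyps by (simp add: Suc_eq_plus1)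
  also have "ln ((1 - f (int y + 1)) / f (int y)) = ln (rho (f (int y + 1))) + ln (f (int y + 1)) - ln (f (int y))"
    using b by (simp add: rho_def ln_div)
  finally show ?case using step.IH step.prems step.hyps by (simp add: add.commute)
qed simp

definition \<kappa> :: real where "\<kappa> = - ln (F (l / 2))"

lemma \<kappa>_pos: "0 < \<kappa>" and exp_\<kappa>: "exp (- \<kappa>) = F (l / 2)"
  using l_props(3) F_half_pos by (auto simp: \<kappa>_def)

text \<open>Long enough for \<open>F (l / 2) ^ block N \<le> 1 / N\<close>, so that at height
  \<open>barrier N\<close> the correction in the climb probability is at most
  \<open>N powr (- 1 / 2)\<close>.\<close>

definition block :: "nat \<Rightarrow> nat" where "block N = nat \<lceil>ln (real N) / \<kappa>\<rceil>"
definition blocks :: "nat \<Rightarrow> nat" where "blocks N = (N div 8) div block N"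
text \<open>Here \<open>exp (- l * barrier N)\<close> is \<open>(ln N)^2 / N\<close>. One logarithm
  pays for having only about \<open>N / ln N\<close> blocks, the other makes the expected number of
  blocks that climb this high diverge.\<close>

definition barrier :: "nat \<Rightarrow> real" where "barrier N = (ln (real N) - 2 * ln (ln (real N))) / l"

text \<open>The slope condition is written as a product so that Markov's inequality applies to it
  directly. The drop by \<open>3 * ln N\<close> beats the at most \<open>N^2\<close> pairs of sites
  summed over in \<open>left_mass\<close>. The right sites start at \<open>N div 2\<close> since
  \<open>{N-k..N}\<close> has to be covered for every \<open>k \<le> N div 2\<close>.\<close>

definition good :: "nat \<Rightarrow> (int \<Rightarrow> real) \<Rightarrow> bool" where
  "good N f \<longleftrightarrow> (\<forall>x\<in>{1..N}. f (int x) \<in> {\<alpha>..1 - \<alpha>}) \<and>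
    (\<forall>u\<in>{1..3 * N div 8}. \<forall>v\<in>{N div 2..N}.
       (\<Prod>x\<in>int ` {u+1..v}. rho (f x) powr (l / 2)) < real N powr (- (3 * l / 2))) \<and>
    (\<exists>j<blocks N. barrier N \<le> climb f (int (N div 4) + int j * int (block N)) (block N))"

lemma good_slope:
  assumes "good N f" and "40 \<le> N" and u: "u \<in> {1..3 * N div 8}" and v: "v \<in> {N div 2..N}"
  shows "exp (potential f v - potential f u) \<le> exp B / real N ^ 3"
proof -
  have el: "f (int x) \<in> {\<alpha>..1 - \<alpha>}" if "1 \<le> x" "x \<le> N" for x using assms(1) that by (auto simp: good_def)
  have uv: "u \<le> v" using u v assms(2) by auto
  let ?S = "\<Sum>z=u+1..v. ln (rho (f (int z)))"
  have "(\<Prod>x\<in>int ` {u+1..v}. rho (f x) powr (l / 2)) = (\<Prod>z=u+1..v. exp (l / 2 * ln (rho (f (int z)))))"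
  proof -
    have "rho (f (int z)) powr (l / 2) = exp (l / 2 * ln (rho (f (int z))))" if "z \<in> {u+1..v}" for z
      using that u v by (intro rho_powr el) auto
    then show ?thesis by (subst prod.reindex) simp_all
  qed
  also have "\<dots> = exp (l / 2 * ?S)" by (simp add: exp_sum sum_distrib_left)
  finally have "exp (l / 2 * ?S) < real N powr (- (3 * l / 2))"
    using assms(1) u v unfolding good_def by metis
  also have "\<dots> = exp (l / 2 * (- 3 * ln (real N)))" using assms(2) by (simp add: powr_def)
  finally have "l / 2 * ?S < l / 2 * (- 3 * ln (real N))" by (simp only: exp_less_cancel_iff)
  then have "?S \<le> - 3 * ln (real N)"
    using l_props(1) by (simp only: mult_less_cancel_left_pos[of "l / 2"] half_gt_zero less_imp_le)
  moreover have "potential f v - potential f u = ?S + ln (f (int v)) - ln (f (int u))"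
    using u v uv by (intro potential_diff el) auto
  moreover have "\<bar>ln (f (int v)) - ln (f (int u))\<bar> \<le> B"
    using u v uv by (intro ln_diff_bound el) auto
  ultimately have "potential f v - potential f u \<le> B + - 3 * ln (real N)" by linarith
  then have "exp (potential f v - potential f u) \<le> exp B * exp (- 3 * ln (real N))"
    by (simp add: exp_add[symmetric])
  also have "exp (- 3 * ln (real N)) = inverse (exp (ln (real N)) ^ 3)"
    by (simp add: exp_minus exp_of_nat_mult[of 3 "ln (real N)", symmetric])
  also have "exp (ln (real N)) = real N" using assms(2) by simp
  finally show ?thesis by (simp add: divide_inverse)
qed

lemma good_barrier:
  assumes "good N f" and "40 \<le> N" and "0 < barrier N"
  obtains x y where "N div 4 \<le> x" "x < y" "y \<le> 3 * N div 8" "y - x \<le> block N"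
    "potential f x - potential f y \<le> B - barrier N"
proof -
  have el: "f (int x) \<in> {\<alpha>..1 - \<alpha>}" if "1 \<le> x" "x \<le> N" for x using assms(1) that by (auto simp: good_def)
  obtain j where j: "j < blocks N" "barrier N \<le> climb f (int (N div 4) + int j * int (block N)) (block N)"
    using assms(1) by (auto simp: good_def)
  define x where "x = N div 4 + j * block N"
  have "int (N div 4) + int j * int (block N) = int x" by (simp add: x_def)
  then obtain i where i: "1 \<le> i" "i \<le> block N" "barrier N \<le> (\<Sum>j=1..i. ln (rho (f (int x + int j))))"
    using climb_witness[OF assms(3)] j(2) by metis
  have "(j + 1) * block N \<le> blocks N * block N" using j(1) by (intro mult_right_mono) auto
  also have "\<dots> \<le> N div 8" by (simp add: blocks_def)
  finally have "j * block N + block N \<le> N div 8" by (simp add: distrib_right)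
  then have y: "x + i \<le> 3 * N div 8" using i(2) by (simp add: x_def)
  have x: "1 \<le> x" "N div 4 \<le> x" using assms(2) by (auto simp: x_def)
  have "(\<Sum>j=1..i. ln (rho (f (int x + int j)))) = (\<Sum>z=x+1..x+i. ln (rho (f (int z))))"
    using sum.shift_bounds_cl_nat_ivl[of "\<lambda>z. ln (rho (f (int z)))" 1 x i] by (simp add: add_ac)
  then have "potential f (x + i) - potential f x
      = (\<Sum>j=1..i. ln (rho (f (int x + int j)))) + ln (f (int (x + i))) - ln (f (int x))"
    using potential_diff[of x "x + i" f] x y el by simp
  moreover have "\<bar>ln (f (int (x + i))) - ln (f (int x))\<bar> \<le> B"
    using x y by (intro ln_diff_bound el) auto
  ultimately have "potential f x - potential f (x + i) \<le> B - barrier N" using i(3) by linarith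
  then show ?thesis using x y i by (intro that[of x "x + i"]) auto
qed

section \<open>Mixing time in a good environment\<close>

lemma exp_barrier:
  assumes "1 \<le> ln (real N)"
  shows "exp (barrier N) = real N powr (1 / l) * ln (real N) powr (- 2 / l)"
    and "exp (barrier N / 2) = real N powr (1 / (2 * l)) * ln (real N) powr (- 1 / l)"
proof -
  have N: "0 < real N" "N \<noteq> Suc 0" using assms by (cases "N = 0"; auto)+
  show "exp (barrier N) = real N powr (1 / l) * ln (real N) powr (- 2 / l)"
    using assms N by (simp add: powr_def barrier_def exp_add[symmetric] diff_divide_distrib)
  show "exp (barrier N / 2) = real N powr (1 / (2 * l)) * ln (real N) powr (- 1 / l)"
    using assms N by (simp add: powr_def barrier_def exp_add[symmetric] diff_divide_distrib)
qed

lemma block_le: "1 \<le> ln (real N) \<Longrightarrow> real (block N) \<le> ln (real N) / \<kappa> + 1"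
  and block_ge: "1 \<le> ln (real N) \<Longrightarrow> ln (real N) / \<kappa> \<le> real (block N)"
proof -
  assume "1 \<le> ln (real N)"
  then have "0 \<le> ln (real N) / \<kappa>" using \<kappa>_pos by simp
  then show "real (block N) \<le> ln (real N) / \<kappa> + 1" "ln (real N) / \<kappa> \<le> real (block N)"
    unfolding block_def by linarith+
qed

text \<open>One constant for each of the three bounds, in their order. The factors
  \<open>exp (- B)\<close> and \<open>exp (- B / 2)\<close> come from the boundary terms by which
  the potential differs from the walk.\<close>

definition c0 :: real where
  "c0 = min (1 / 8) (min (exp (- B) / 2) (exp (- B / 2) / 40))"

lemma c0_pos: "0 < c0"
  by (simp add: c0_def)

lemma good_t_mix:
  assumes good: "good N f" and N40: "40 \<le> N" and k_le: "k \<in> {1..N div 2}" and lnN: "1 \<le> ln (real N)"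
    and small: "exp B / real N \<le> 1 / 20" and bar: "0 < barrier N"
    and few: "20 * (ln (real N) / \<kappa> + 2) * real N powr (1 / (2 * l)) * ln (real N) powr (- 2 * (1 + 1 / l))
        \<le> real N powr (1 / l) * ln (real N) powr (- 2 / l)"
  shows "c0 * Max {real N, real N powr (1 / l) * ln (real N) powr (- 2 / l),
      real k * real N powr (1 / (2 * l)) * ln (real N) powr (- 2 * (1 + 1 / l))} \<le> t_mix f N k"
proof -
  have el: "f (int x) \<in> {\<alpha>..1 - \<alpha>}" if "1 \<le> x" "x \<le> N" for x using good that by (auto simp: good_def)
  interpret sep f N k
  proof
    fix x assume "1 \<le> x" "x \<le> int N"
    then show "0 < f x \<and> f x < 1" using rho_bounds(1,2)[OF el[of "nat x"]] by simp
  qed (use k_le N40 in auto)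
  let ?Y = "3 * N div 8"
  let ?p = "\<lambda>Y. \<Sum>\<xi>\<in>Omega N k. \<pi> \<xi> * of_bool (\<exists>u\<in>{1..Y}. \<xi> u = 1)"
  have pY: "?p Y \<le> 1 / 20" if "Y \<le> ?Y" for Y
  proof -
    have "?p Y \<le> (real N)\<^sup>2 * (exp B / real N ^ 3)"
      using k_le N40 that by (intro left_mass good_slope[OF good N40]) auto
    also have "\<dots> = exp B / real N" using N40 by (simp add: power2_eq_square power3_eq_cube)
    finally show ?thesis using small by linarith
  qed
  let ?T2 = "real N powr (1 / l) * ln (real N) powr (- 2 / l)"
  let ?T3 = "real k * real N powr (1 / (2 * l)) * ln (real N) powr (- 2 * (1 + 1 / l))"
  obtain x y where xy: "N div 4 \<le> x" "x < y" "y \<le> ?Y" "y - x \<le> block N" "V x - V y \<le> B - barrier N"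
    by (rule good_barrier[OF good N40 bar])
  have xy': "1 \<le> x" "y < N" using xy N40 by auto
  have 1: "c0 * real N \<le> t_mix f N k"
  proof (rule t_mix_ge)
    fix t assume t: "0 \<le> t" "t < c0 * real N"
    have "c0 * real N \<le> 1 / 8 * real N" by (intro mult_right_mono) (auto simp: c0_def)
    moreover have "real N / 4 \<le> real ?Y" using N40 by linarith
    ultimately have "t \<le> real ?Y / 2" "0 < real ?Y" using t N40 by linarith+
    then have "t / real ?Y \<le> 1 / 2" by (simp add: divide_le_eq)
    moreover have "1 \<le> ?Y" using N40 by simp
    ultimately show "1 / 4 < mix_dist f N k t"
      using mix_dist_ballistic[of ?Y t] t(1) pY[OF order_refl] by linarith
  qed
  have 2: "c0 * ?T2 \<le> t_mix f N k"
  proof (rule t_mix_ge)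
    fix t assume t: "0 \<le> t" "t < c0 * ?T2"
    have "c0 * ?T2 \<le> exp (- B) / 2 * ?T2" by (intro mult_right_mono) (auto simp: c0_def)
    also have "\<dots> = exp (barrier N - B) / 2" unfolding exp_barrier(1)[OF lnN, symmetric] by (simp add: exp_diff exp_minus field_simps)
    finally have t': "t \<le> exp (barrier N - B) / 2" using t by linarith
    have "t * exp (V x - V y) \<le> exp (barrier N - B) / 2 * exp (B - barrier N)"
      using t' t(1) xy(5) by (intro mult_mono) auto
    also have "\<dots> = 1 / 2" by (simp add: exp_add[symmetric])
    finally show "1 / 4 < mix_dist f N k t"
      using mix_dist_barrier[OF xy'(1) xy(2) xy'(2) t(1)] pY[OF xy(3)] by linarith
  qed
  have 3: "c0 * ?T3 \<le> t_mix f N k"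
  \<comment> \<open>For smaller \<open>k\<close> the initial cost \<open>y - x + 1\<close> of the
    coupling may not be negligible against \<open>k\<close>; then the hypothesis \<open>few\<close>
    reduces the third bound to the second.\<close>
  proof (cases "20 * (real (block N) + 1) \<le> real k")
    case False
    have "real k \<le> 20 * (real (block N) + 1)" using False by simp
    also have "\<dots> \<le> 20 * (ln (real N) / \<kappa> + 2)"
      using block_le[OF lnN] by (intro mult_left_mono) auto
    finally have "real k \<le> 20 * (ln (real N) / \<kappa> + 2)" .
    then have "?T3 \<le> 20 * (ln (real N) / \<kappa> + 2) * real N powr (1 / (2 * l)) * ln (real N) powr (- 2 * (1 + 1 / l))"
      by (intro mult_right_mono) auto
    then have "?T3 \<le> ?T2" using few by linarith
    then have "c0 * ?T3 \<le> c0 * ?T2" using c0_pos by (intro mult_left_mono) auto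
    then show ?thesis using 2 by linarith
  next
    case True
    show ?thesis
    proof (rule t_mix_ge)
      fix t assume t: "0 \<le> t" "t < c0 * ?T3"
      define j where "j = min k (N div 4)"
      have j: "j \<le> k" "j \<le> x" "y + k < N + j" using k_le xy N40 by (auto simp: j_def min_def)
      \<comment> \<open>For \<open>k\<close> close to \<open>N / 2\<close> only about half of the
        particles start in the first \<open>N div 4\<close> sites; 9/20 leaves room for rounding. Of
        it, 1/20 each is lost to the initial coupling, the current and the equilibrium mass on the
        left, and 6/20 exceeds 1/4.\<close>
      have jk: "9 / 20 * real k \<le> real j" using k_le N40 unfolding j_def by (auto simp: min_def)
      have "ln (real N) powr (- 2 * (1 + 1 / l)) \<le> ln (real N) powr (- 1 / l)"
        using lnN l_props(1) by (intro powr_mono) (auto simp: divide_simps)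
      then have "?T3 \<le> real k * exp (barrier N / 2)"
        unfolding exp_barrier(2)[OF lnN] mult.assoc by (intro mult_left_mono) auto
      moreover have "c0 \<le> exp (- B / 2) / 40" by (simp add: c0_def)
      ultimately have "c0 * ?T3 \<le> exp (- B / 2) / 40 * (real k * exp (barrier N / 2))"
        using mult_mono[of c0 "exp (- B / 2) / 40" ?T3 "real k * exp (barrier N / 2)"] by simp
      also have "\<dots> = real k / 40 * (exp (barrier N / 2) * exp (- B / 2))" by simp
      also have "exp (barrier N / 2) * exp (- B / 2) = exp ((barrier N - B) / 2)"
        unfolding exp_add[symmetric] by (simp add: diff_divide_distrib)
      finally have t': "t \<le> real k / 40 * exp ((barrier N - B) / 2)" using t by linarith
      have "t * exp ((V x - V y) / 2) \<le> real k / 40 * exp ((barrier N - B) / 2) * exp ((B - barrier N) / 2)"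
        using t' t(1) xy(5) by (intro mult_mono) auto
      also have "\<dots> = real k / 40 * exp ((barrier N - B) / 2 + (B - barrier N) / 2)" by (simp only: exp_add mult.assoc)
      also have "(barrier N - B) / 2 + (B - barrier N) / 2 = 0" by (simp add: field_simps)
      finally have te: "2 * t * exp ((V x - V y) / 2) \<le> real k / 20" by simp
      have "real (y - x) \<le> real (block N)" using xy(4) by (simp only: of_nat_le_iff)
      then have "real (y - x + 1) \<le> real k / 20" using True by simp
      then have "7 / 20 * real k \<le> real j - real (y - x + 1) - 2 * t * exp ((V x - V y) / 2)"
        using te jk by linarith
      then have "7 / 20 \<le> (real j - real (y - x + 1) - 2 * t * exp ((V x - V y) / 2)) / real k"
        using k_le by (simp add: pos_le_divide_eq)
      then show "1 / 4 < mix_dist f N k t"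
        using mix_dist_current[OF xy'(1) xy(2) xy'(2) t(1) j] pY[OF xy(3)] by linarith
    qed
  qed
  have "Max {real N, ?T2, ?T3} \<in> {real N, ?T2, ?T3}" by (rule Max_in) auto
  then show ?thesis using 1 2 3 by auto
qed

lemma blocks_ge:
  assumes "40 \<le> N" and "1 \<le> ln (real N)"
  shows "(real N / 8 - 1) / (ln (real N) / \<kappa> + 1) - 1 \<le> real (blocks N)"
proof -
  have m: "0 < real (block N)" using block_ge[OF assms(2)] assms(2) \<kappa>_pos
    by (meson divide_pos_pos less_le_trans zero_less_one)
  have "(real N / 8 - 1) / (ln (real N) / \<kappa> + 1) \<le> real (N div 8) / real (block N)"
    using block_le[OF assms(2)] m assms(1) by (intro frac_le) auto
  also have "\<dots> \<le> real (blocks N) + 1"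
  proof -
    have "N div 8 < (blocks N + 1) * block N"
      unfolding blocks_def using m dividend_less_div_times[of "block N" "N div 8"]
      by (simp add: distrib_right add.commute)
    then have "real (N div 8) \<le> (real (blocks N) + 1) * real (block N)"
      by (metis less_imp_le of_nat_1 of_nat_add of_nat_le_iff of_nat_mult)
    then show ?thesis using m by (simp add: divide_le_eq)
  qed
  finally show ?thesis by simp
qed

lemma eventually_regular:
  "\<forall>\<^sub>F N in sequentially. 40 \<le> N \<and> 1 \<le> ln (real N) \<and> exp (- ln (real N) / 2) \<le> 1 / 2 \<and>
     exp B / real N \<le> 1 / 20 \<and> 0 < barrier N \<and>
     20 * (ln (real N) / \<kappa> + 2) * real N powr (1 / (2 * l)) * ln (real N) powr (- 2 * (1 + 1 / l))
       \<le> real N powr (1 / l) * ln (real N) powr (- 2 / l)"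
proof (intro eventually_conj)
  note l = l_props(1)
  define b where "b = 1 / (2 * l)"
  have b: "0 < b" using l by (simp add: b_def)
  have bl: "1 / (2 * l) = b" "1 / l = 2 * b" "- 2 / l = - (4 * b)" "- 2 * (1 + 1 / l) = - 2 - 4 * b"
    using l by (auto simp: b_def field_simps)
  show "\<forall>\<^sub>F N in sequentially. 40 \<le> N" by (rule eventually_ge_at_top)
  show "\<forall>\<^sub>F N in sequentially. 1 \<le> ln (real N)" by real_asymp
  show "\<forall>\<^sub>F N in sequentially. exp (- ln (real N) / 2) \<le> 1 / 2" by real_asymp
  show "\<forall>\<^sub>F N in sequentially. exp B / real N \<le> 1 / 20" by real_asymp
  have "\<forall>\<^sub>F N in sequentially. 0 < ln (real N) - 2 * ln (ln (real N))" by real_asymp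
  then show "\<forall>\<^sub>F N in sequentially. 0 < barrier N"
    by eventually_elim (simp add: barrier_def l)
  have "0 < inverse \<kappa>" using \<kappa>_pos by simp
  then show "\<forall>\<^sub>F N in sequentially. 20 * (ln (real N) / \<kappa> + 2) * real N powr (1 / (2 * l)) * ln (real N) powr (- 2 * (1 + 1 / l))
       \<le> real N powr (1 / l) * ln (real N) powr (- 2 / l)"
    unfolding bl divide_inverse[of _ \<kappa>] using b by real_asymp
qed

end

section \<open>Good environments have probability tending to 1\<close>

context iid_env begin

lemma good_event [measurable]: "{e \<in> space M. good N (\<lambda>x. \<omega> x e)} \<in> M.events"
  unfolding good_def by measurable

text \<open>Union bound over the three ways to fail: ellipticity fails with probability 0, each pair
  in the slope condition is at distance at least \<open>N / 8 - 1\<close>, and the blocks fail to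
  climb independently.\<close>

lemma prob_good:
  assumes N: "40 \<le> N" and lnN: "1 \<le> ln (real N)" and bar: "0 < barrier N"
    and half: "exp (- ln (real N) / 2) \<le> 1 / 2"
  shows "1 - real N ^ 2 * (exp (- \<kappa> * (real N / 8 - 1)) * real N powr (3 * l / 2))
      - exp (- (exp (- l * (barrier N + B)) / 2) * real (blocks N))
    \<le> M.prob {e \<in> space M. good N (\<lambda>x. \<omega> x e)}"
proof -
  let ?q = "F (l / 2)" and ?b = "real N powr (- (3 * l / 2))"
  define E1 where "E1 = {e \<in> space M. \<not> (\<forall>x\<in>{1..N}. \<omega> (int x) e \<in> {\<alpha>..1 - \<alpha>})}"
  define S where "S = (\<lambda>(u,v). {e \<in> space M. ?b \<le> (\<Prod>x\<in>int ` {u+1..v}. rho (\<omega> x e) powr (l / 2))})"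
  define P where "P = {1..3 * N div 8} \<times> {N div 2..N}"
  define E3 where "E3 = {e \<in> space M. \<forall>j<blocks N.
      climb (\<lambda>x. \<omega> x e) (int (N div 4) + int j * int (block N)) (block N) < barrier N}"
  have [measurable]: "E1 \<in> M.events" "\<And>z. S z \<in> M.events" "E3 \<in> M.events"
    unfolding E1_def S_def E3_def case_prod_unfold by measurable
  have "M.prob E1 = 0"
  proof -
    have "AE e in M. \<forall>x\<in>{1..N}. \<omega> (int x) e \<in> {\<alpha>..1 - \<alpha>}"
      by (intro AE_finite_allI env_ellip) simp
    then have "AE e in M. e \<notin> E1" by eventually_elim (auto simp: E1_def)
    then show ?thesis by (simp add: M.prob_eq_0)
  qed
  moreover have "M.prob (\<Union>z\<in>P. S z) \<le> real N ^ 2 * (exp (- \<kappa> * (real N / 8 - 1)) * real N powr (3 * l / 2))"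
  proof -
    have "M.prob (\<Union>z\<in>P. S z) \<le> (\<Sum>z\<in>P. M.prob (S z))"
      by (intro M.finite_measure_subadditive_finite) (auto simp: P_def)
    also have "\<dots> \<le> (\<Sum>z\<in>P. exp (- \<kappa> * (real N / 8 - 1)) * real N powr (3 * l / 2))"
    proof (rule sum_mono, clarify)
      fix u v assume uv: "(u, v) \<in> P"
      have card: "card (int ` {u+1..v}) = v - u" by (simp add: card_image)
      have "M.prob (S (u, v)) \<le> ?q ^ (v - u) / ?b"
        unfolding S_def prod.case card[symmetric] by (rule prob_slope) (use N in auto)
      also have "\<dots> = ?q ^ (v - u) * real N powr (3 * l / 2)"
        by (simp only: powr_minus divide_inverse inverse_inverse_eq)
      also have "?q ^ (v - u) = exp (- \<kappa> * real (v - u))"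
        unfolding exp_\<kappa>[symmetric] by (simp add: exp_of_nat_mult[symmetric] mult.commute)
      also have "\<dots> \<le> exp (- \<kappa> * (real N / 8 - 1))"
      proof -
        have "real N / 8 - 1 \<le> real (v - u)" using uv N unfolding P_def by auto
        then show ?thesis using \<kappa>_pos by simp
      qed
      finally show "M.prob (S (u, v)) \<le> exp (- \<kappa> * (real N / 8 - 1)) * real N powr (3 * l / 2)"
        by (simp add: mult_right_mono)
    qed
    also have "\<dots> = real (card P) * (exp (- \<kappa> * (real N / 8 - 1)) * real N powr (3 * l / 2))" by simp
    also have "\<dots> \<le> real N ^ 2 * (exp (- \<kappa> * (real N / 8 - 1)) * real N powr (3 * l / 2))"
    proof (rule mult_right_mono)
      have "card P \<le> N * N" unfolding P_def card_cartesian_product using N by (intro mult_le_mono) auto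
      then show "real (card P) \<le> real N ^ 2" by (metis of_nat_le_iff of_nat_power power2_eq_square)
    qed simp
    finally show ?thesis .
  qed
  moreover have "M.prob E3 \<le> exp (- (exp (- l * (barrier N + B)) / 2) * real (blocks N))"
    unfolding E3_def
  proof (rule prob_no_climb)
    fix a
    let ?m = "block N"
    have "exp (l * barrier N / 2) * ?q ^ ?m \<le> exp (ln (real N) / 2) * exp (- ln (real N))"
    proof (rule mult_mono)
      have "l * barrier N \<le> ln (real N)" using lnN l_props(1) by (simp add: barrier_def)
      then show "exp (l * barrier N / 2) \<le> exp (ln (real N) / 2)" by simp
      have "?q ^ ?m = exp (- \<kappa> * real ?m)"
        unfolding exp_\<kappa>[symmetric] by (simp add: exp_of_nat_mult[symmetric] mult.commute)
      moreover have "ln (real N) \<le> \<kappa> * real ?m" using block_ge[OF lnN] \<kappa>_pos by (simp add: field_simps)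
      ultimately show "?q ^ ?m \<le> exp (- ln (real N))" by simp
    qed (use F_half_pos in auto)
    also have "\<dots> = exp (- ln (real N) / 2)" by (simp add: exp_add[symmetric] field_simps del: exp_ln)
    finally have "1 / 2 \<le> 1 - exp (l * barrier N / 2) * ?q ^ ?m" using half by linarith
    then have "exp (- l * (barrier N + B)) * (1 / 2) \<le> exp (- l * (barrier N + B)) * (1 - exp (l * barrier N / 2) * ?q ^ ?m)"
      by (intro mult_left_mono) auto
    also have "\<dots> \<le> M.prob {e \<in> space M. barrier N \<le> climb (\<lambda>x. \<omega> x e) a ?m}"
      by (rule prob_climb_ge[OF bar])
    finally show "exp (- l * (barrier N + B)) / 2 \<le> M.prob {e \<in> space M. barrier N \<le> climb (\<lambda>x. \<omega> x e) a ?m}"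
      by simp
  qed
  moreover have "1 - M.prob (E1 \<union> ((\<Union>z\<in>P. S z) \<union> E3)) = M.prob {e \<in> space M. good N (\<lambda>x. \<omega> x e)}"
  proof -
    have "good N (\<lambda>x. \<omega> x e) \<longleftrightarrow> e \<notin> E1 \<union> ((\<Union>z\<in>P. S z) \<union> E3)" if e: "e \<in> space M" for e
    proof -
      have "e \<in> (\<Union>z\<in>P. S z) \<longleftrightarrow> (\<exists>u\<in>{1..3 * N div 8}. \<exists>v\<in>{N div 2..N}. e \<in> S (u, v))"
        by (auto simp: P_def)
      also have "\<dots> \<longleftrightarrow> \<not> (\<forall>u\<in>{1..3 * N div 8}. \<forall>v\<in>{N div 2..N}. (\<Prod>x\<in>int ` {u+1..v}. rho (\<omega> x e) powr (l / 2)) < ?b)"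
        using e by (simp only: S_def prod.case mem_Collect_eq simp_thms flip: not_less) blast
      moreover have "e \<in> E3 \<longleftrightarrow> \<not> (\<exists>j<blocks N.
          barrier N \<le> climb (\<lambda>x. \<omega> x e) (int (N div 4) + int j * int (block N)) (block N))"
        using e by (auto simp: E3_def not_le)
      moreover have "e \<in> E1 \<longleftrightarrow> \<not> (\<forall>x\<in>{1..N}. \<omega> (int x) e \<in> {\<alpha>..1 - \<alpha>})"
        using e by (simp only: E1_def mem_Collect_eq simp_thms)
      ultimately show ?thesis unfolding good_def by blast
    qed
    then have "M.prob {e \<in> space M. good N (\<lambda>x. \<omega> x e)} = M.prob (space M - (E1 \<union> ((\<Union>z\<in>P. S z) \<union> E3)))"
      by (intro arg_cong[of _ _ M.prob]) blast
    also have "\<dots> = 1 - M.prob (E1 \<union> ((\<Union>z\<in>P. S z) \<union> E3))"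
      by (intro M.prob_compl) (auto simp: P_def intro!: sets.finite_UN)
    finally show ?thesis by simp
  qed
  moreover have "M.prob (E1 \<union> ((\<Union>z\<in>P. S z) \<union> E3)) \<le> M.prob E1 + (M.prob (\<Union>z\<in>P. S z) + M.prob E3)"
    by (intro order_trans[OF measure_Un_le] add_left_mono measure_Un_le) (auto simp: P_def intro!: sets.finite_UN)
  ultimately show ?thesis by linarith
qed

lemma prob_good_tendsto: "(\<lambda>N. M.prob {e \<in> space M. good N (\<lambda>x. \<omega> x e)}) \<longlonglongrightarrow> 1"
proof (rule tendsto_sandwich)
  let ?E1 = "\<lambda>N. real N ^ 2 * (exp (- \<kappa> * (real N / 8 - 1)) * real N powr (3 * l / 2))"
  \<comment> \<open>This grows like a constant times \<open>ln N\<close>.\<close>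
  let ?g = "\<lambda>N. exp (- l * B) / 2 * exp (- (ln (real N) - 2 * ln (ln (real N)))) * ((real N / 8 - 1) / (ln (real N) / \<kappa> + 1) - 1)"
  show "\<forall>\<^sub>F N in sequentially. 1 - ?E1 N - exp (- ?g N) \<le> M.prob {e \<in> space M. good N (\<lambda>x. \<omega> x e)}"
    using eventually_regular
  proof eventually_elim
    case (elim N)
    have "l * barrier N = ln (real N) - 2 * ln (ln (real N))" using l_props(1) by (simp add: barrier_def)
    then have "exp (- l * (barrier N + B)) / 2 = exp (- l * B) / 2 * exp (- (ln (real N) - 2 * ln (ln (real N))))"
      by (simp add: distrib_left exp_add[symmetric] del: exp_ln)
    moreover have "(real N / 8 - 1) / (ln (real N) / \<kappa> + 1) - 1 \<le> real (blocks N)" using elim by (intro blocks_ge) auto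
    ultimately have "?g N \<le> exp (- l * (barrier N + B)) / 2 * real (blocks N)"
      by (simp only:) (intro mult_left_mono, auto)
    then have "exp (- (exp (- l * (barrier N + B)) / 2) * real (blocks N)) \<le> exp (- ?g N)" by simp
    then show ?case using prob_good[of N] elim by linarith
  qed
  show "\<forall>\<^sub>F N in sequentially. M.prob {e \<in> space M. good N (\<lambda>x. \<omega> x e)} \<le> 1" by simp
  have k: "0 < inverse \<kappa>" using \<kappa>_pos by simp
  have "?E1 \<longlonglongrightarrow> 0" using \<kappa>_pos l_props(1) by real_asymp
  moreover have "(\<lambda>N. exp (- ?g N)) \<longlonglongrightarrow> 0"
    unfolding divide_inverse[of _ \<kappa>] using k by real_asymp
  ultimately have "(\<lambda>N. 1 - ?E1 N - exp (- ?g N)) \<longlonglongrightarrow> 1 - 0 - 0" by (intro tendsto_diff tendsto_const)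
  then show "(\<lambda>N. 1 - ?E1 N - exp (- ?g N)) \<longlonglongrightarrow> 1" by simp
qed simp

end

theorem theorem2p5:
  fixes \<alpha> :: real and \<mu> :: "real measure" and l :: real
  assumes "prob_space \<mu>" and "sets \<mu> = sets borel"
    and "0 < \<alpha>" and "\<alpha> < 1 / 2"
    and "measure \<mu> {\<alpha>..1 - \<alpha>} = 1"
    and "(\<integral>w. ln (rho w) \<partial>\<mu>) < 0"
    and "lam \<mu> < \<infinity>"
    and "l = real_of_ereal (lam \<mu>)"
  shows "\<exists>c>0. \<forall>(M :: 'a measure) (\<omega> :: int \<Rightarrow> 'a \<Rightarrow> real). iid_environment M \<omega> \<mu> \<longrightarrow>
    (\<lambda>N::nat. INF k\<in>{1..N div 2}.
        measure M {e \<in> space M.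
          t_mix (\<lambda>x. \<omega> x e) N k \<ge>
            c * Max {real N,
                     real N powr (1 / l) * ln (real N) powr (- 2 / l),
                     real k * real N powr (1 / (2 * l)) * ln (real N) powr (- 2 * (1 + 1 / l))}})
      \<longlonglongrightarrow> 1"
proof -
  interpret env_law \<alpha> \<mu> l by (intro env_law.intro assms)
  show ?thesis
  proof (intro exI[of _ c0] conjI c0_pos allI impI)
    fix M :: "'a measure" and \<omega> :: "int \<Rightarrow> 'a \<Rightarrow> real"
    assume "iid_environment M \<omega> \<mu>"
    then interpret iid_env \<alpha> \<mu> l M \<omega> by unfold_locales
    let ?bound = "\<lambda>N k. c0 * Max {real N,
                     real N powr (1 / l) * ln (real N) powr (- 2 / l),
                     real k * real N powr (1 / (2 * l)) * ln (real N) powr (- 2 * (1 + 1 / l))}"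
    let ?B = "\<lambda>N k. {e \<in> space M. t_mix (\<lambda>x. \<omega> x e) N k \<ge> ?bound N k}"
    have lower: "\<forall>\<^sub>F N in sequentially. M.prob {e \<in> space M. good N (\<lambda>x. \<omega> x e)} \<le> (INF k\<in>{1..N div 2}. M.prob (?B N k))"
      using eventually_regular
    proof eventually_elim
      case (elim N)
      show ?case
      proof (rule cINF_greatest)
        have "1 \<in> {1..N div 2}" using elim by auto
        then show "{1..N div 2} \<noteq> {}" by blast
        fix k assume k: "k \<in> {1..N div 2}"
        \<comment> \<open>The state space does not involve the environment, so any admissible
          environment shows that it is non-empty.\<close>
        have "sep (\<lambda>_. 1 / 2) N k" by unfold_locales (use k elim in auto)
        then have ne: "Omega N k \<noteq> {}" by (rule sep.Omega_nonempty)
        have "{e \<in> space M. good N (\<lambda>x. \<omega> x e)} \<subseteq> ?B N k"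
          using elim k good_t_mix by blast
        then show "M.prob {e \<in> space M. good N (\<lambda>x. \<omega> x e)} \<le> M.prob (?B N k)"
          by (intro M.finite_measure_mono sets_t_mix_ge ne) auto
      qed
    qed
    have upper: "\<forall>\<^sub>F N in sequentially. (INF k\<in>{1..N div 2}. M.prob (?B N k)) \<le> 1"
      using eventually_ge_at_top[of 2]
    proof eventually_elim
      case (elim N)
      then have "1 \<in> {1..N div 2}" by auto
      then show ?case
        by (intro cINF_lower2[OF bdd_belowI2[of _ 0]]) auto
    qed
    show "(\<lambda>N. INF k\<in>{1..N div 2}. M.prob (?B N k)) \<longlonglongrightarrow> 1"
      by (rule tendsto_sandwich[OF lower upper prob_good_tendsto tendsto_const])
  qed
qed

end
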